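(* Let $L$ be a smooth branch on a smooth germ of surface $S$. Consider a finite set $\mathcal F$ of branches on $S$, distinct from $L$. Then $U_L$ is an ultrametric on $\mathcal F$ and the associated end-rooted tree is isomorphic to the Eggers-Wall tree $\Theta_L(\mathcal F)$ of $\mathcal F$ relative to $L$.
   Context: $S$ is a germ of smooth complex analytic surface; a branch is a germ of irreducible formal curve on $S$; $A\cdot B$ is the intersection number of distinct branches. For branches $A,B\neq L$: $U_L(A,B):=\frac{(L\cdot A)(L\cdot B)}{A\cdot B}$ if $A\ne B$, $U_L(A,A):=0$. $\mathcal F$ is non-empty. Eggers-Wall tree. Choose coordinates $(x,y)$ on $S$ with $L=\{x=0\}$. A branch $A\ne L$ is defined by a unique irreducible Weierstrass polynomial $f_A\in\mathbb C[[x]][y]$, monic of degree $d_A=L\cdot A$; its $d_A$ roots in $\mathbb C[[x^{1/d_A}]]$ are the Newton-Puiseux roots of $A$; their set is $Z(f_A)$. The characteristic exponents of $A$ are the $x$-orders $\nu_x(\eta-\eta')$ of differences of distinct Newton-Puiseux roots of $A$. The Eggers-Wall tree $\Theta_L(A)$ is a compact oriented segment with an increasing homeomorphism $\mathbf e_{L,A}:\Theta_L(A)\to[0,\infty]$ (exponent function), its smallest end being labeled $L$ and its greatest end being labeled $A$ (the points whose exponents are the characteristic exponents of $A$ are also marked). For two distinct branches $A,B\neq L$, the order of coincidence is $k_L(A,B):=\max\{\nu_x(\eta_A-\eta_B)\mid\eta_A\in Z(f_A),\ \eta_B\in Z(f_B)\}$. The tree $\Theta_L(\mathcal F)$ is the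 quotient of $\bigsqcup_{A\in\mathcal F}\Theta_L(A)$ by the equivalence relation generated by $\mathbf e_{L,A}^{-1}(\alpha)\sim\mathbf e_{L,B}^{-1}(\alpha)$ for all $A\neq B$ in $\mathcal F$ and all $\alpha\in[0,k_L(A,B)]$. It is rooted at $L$, with leaves labeled by the elements of $\mathcal F$. The tree $\Theta_L(\mathcal F)$ (with its exponent function) depends only on $(\mathcal F,L)$. End-rooted tree of an ultrametric $U$ on a non-empty finite set $X$: the closed balls of $(X,U)$, ordered by reverse inclusion, form a poset with minimum $X$ whose Hasse diagram is a tree, rooted at $X$, with leaves the singletons (identified with the elements of $X$). The end-rooted tree is obtained from it by adding a new root joined by one edge to the old root $X$. The isomorphism is meant as an isomorphism of rooted trees with leaf set $\mathcal F$, where $\Theta_L(\mathcal F)$ is considered with its topological vertex set (its root, its leaves and its points of valency at least $3$). *)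

theory Defs
  imports
    "HOL-Analysis.Analysis"
    "HOL-Computational_Algebra.Computational_Algebra"
begin

section \<open>Smooth germs of surfaces and branches\<close>

text \<open>
  Branches are formal, so a germ of smooth surface enters only through its formal local algebra
  (the completion of its local ring): a commutative ring \<open>'r\<close> with structure map
  \<open>\<iota> :: complex \<Rightarrow> 'r\<close> that is isomorphic, as a complex algebra, to \<open>\<complex>[[x,y]]\<close>.
  The latter is modelled as \<open>\<complex>[[x]][[y]]\<close>, i.e. \<open>complex fps fps\<close>, in which \<open>x\<close> is
  \<open>fps_const fps_X\<close> and \<open>y\<close> is \<open>fps_X\<close>. A coordinate system is encoded by the isomorphism
  \<open>\<phi>\<close> that sends a series to its value at the two coordinates; these are the images of
  \<open>fps_const fps_X\<close> and \<open>fps_X\<close>.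
\<close>

definition coordinates :: "(complex \<Rightarrow> 'r::comm_ring_1) \<Rightarrow> (complex fps fps \<Rightarrow> 'r) \<Rightarrow> bool" where
  "coordinates \<iota> \<phi> \<longleftrightarrow>
     bij \<phi> \<and> \<phi> 1 = 1 \<and>
     (\<forall>f g. \<phi> (f + g) = \<phi> f + \<phi> g) \<and>
     (\<forall>f g. \<phi> (f * g) = \<phi> f * \<phi> g) \<and>
     (\<forall>c. \<phi> (fps_const (fps_const c)) = \<iota> c)"

definition smooth_surface_germ :: "(complex \<Rightarrow> 'r::comm_ring_1) \<Rightarrow> bool" where
  "smooth_surface_germ \<iota> \<longleftrightarrow> (\<exists>\<phi>. coordinates \<iota> \<phi>)"

definition principal_ideal :: "'r::comm_ring_1 \<Rightarrow> 'r set" where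
  "principal_ideal f = {f * g | g. True}"

text \<open>A germ of irreducible formal curve is identified with its ideal.\<close>

definition branch :: "'r::comm_ring_1 set \<Rightarrow> bool" where
  "branch A \<longleftrightarrow> (\<exists>f. irreducible f \<and> A = principal_ideal f)"

definition maximal_ideal :: "'r::comm_ring_1 set" where
  "maximal_ideal = {a. \<not> a dvd 1}"

text \<open>Over a ring acting on itself, \<open>module.span (*)\<close> is the generated ideal.\<close>

definition maximal_ideal_squared :: "'r::comm_ring_1 set" where
  "maximal_ideal_squared =
     module.span (*) {a * b | a b. a \<in> maximal_ideal \<and> b \<in> maximal_ideal}"

definition smooth_branch :: "'r::comm_ring_1 set \<Rightarrow> bool" where
  "smooth_branch L \<longleftrightarrow> branch L \<and> \<not> L \<subseteq> maximal_ideal_squared"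


section \<open>Intersection numbers and the function \<open>U\<^sub>L\<close>\<close>

text \<open>\<open>quotient_basis \<iota> I B\<close>: the residue classes of the elements of \<open>B\<close> form a basis of
  the complex vector space \<open>'r / I\<close>, and are pairwise distinct.\<close>

definition quotient_basis :: "(complex \<Rightarrow> 'r::comm_ring_1) \<Rightarrow> 'r set \<Rightarrow> 'r set \<Rightarrow> bool" where
  "quotient_basis \<iota> I B \<longleftrightarrow>
     finite B \<and> (\<forall>f. \<exists>!c. c \<in> B \<rightarrow>\<^sub>E UNIV \<and> f - (\<Sum>b\<in>B. \<iota> (c b) * b) \<in> I)"

definition quotient_dim :: "(complex \<Rightarrow> 'r::comm_ring_1) \<Rightarrow> 'r set \<Rightarrow> nat" where
  "quotient_dim \<iota> I = (THE n. \<exists>B. quotient_basis \<iota> I B \<and> card B = n)"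

text \<open>For distinct branches this is the (finite) dimension of \<open>\<complex>[[x,y]] / (f, g)\<close>.\<close>

definition intersection_number ::
    "(complex \<Rightarrow> 'r::comm_ring_1) \<Rightarrow> 'r set \<Rightarrow> 'r set \<Rightarrow> nat" where
  "intersection_number \<iota> A B = quotient_dim \<iota> {a + b | a b. a \<in> A \<and> b \<in> B}"

definition U_L :: "(complex \<Rightarrow> 'r::comm_ring_1) \<Rightarrow> 'r set \<Rightarrow> 'r set \<Rightarrow> 'r set \<Rightarrow> real" where
  "U_L \<iota> L A B =
     (if A = B then 0
      else real (intersection_number \<iota> L A) * real (intersection_number \<iota> L B)
             / real (intersection_number \<iota> A B))"


section \<open>Ultrametrics and end-rooted trees\<close>

definition ultrametric_on :: "'a set \<Rightarrow> ('a \<Rightarrow> 'a \<Rightarrow> real) \<Rightarrow> bool" where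
  "ultrametric_on X U \<longleftrightarrow>
     Metric_space X U \<and> (\<forall>a\<in>X. \<forall>b\<in>X. \<forall>c\<in>X. U a c \<le> max (U a b) (U b c))"

text \<open>Finite rooted trees, given by their vertices and edges (an edge being the set of its two
  ends), with leaves labelled by elements of \<open>'l\<close>.\<close>

record ('v, 'l) rooted_tree =
  tree_verts :: "'v set"
  tree_edges :: "'v set set"
  tree_root :: 'v
  tree_leaf :: "'l \<Rightarrow> 'v"

definition rooted_tree_iso ::
    "'l set \<Rightarrow> ('v, 'l) rooted_tree \<Rightarrow> ('w, 'l) rooted_tree \<Rightarrow> bool" where
  "rooted_tree_iso X T T' \<longleftrightarrow>
     (\<exists>h. bij_betw h (tree_verts T) (tree_verts T') \<and>
          (\<forall>u\<in>tree_verts T. \<forall>v\<in>tree_verts T.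
             {u, v} \<in> tree_edges T \<longleftrightarrow> {h u, h v} \<in> tree_edges T') \<and>
          h (tree_root T) = tree_root T' \<and>
          (\<forall>a\<in>X. h (tree_leaf T a) = tree_leaf T' a))"

definition closed_balls :: "'a set \<Rightarrow> ('a \<Rightarrow> 'a \<Rightarrow> real) \<Rightarrow> 'a set set" where
  "closed_balls X U = {Metric_space.mcball X U a r | a r. a \<in> X \<and> 0 \<le> r}"

definition covers :: "'a set set \<Rightarrow> 'a set \<Rightarrow> 'a set \<Rightarrow> bool" where
  "covers \<B> B C \<longleftrightarrow> B \<in> \<B> \<and> C \<in> \<B> \<and> C \<subset> B \<and> \<not> (\<exists>D\<in>\<B>. C \<subset> D \<and> D \<subset> B)"

text \<open>\<open>Some B\<close> is the vertex of the closed ball \<open>B\<close>, and \<open>None\<close> is the additional root.\<close>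

definition end_rooted_tree ::
    "'a set \<Rightarrow> ('a \<Rightarrow> 'a \<Rightarrow> real) \<Rightarrow> ('a set option, 'a) rooted_tree" where
  "end_rooted_tree X U =
     \<lparr> tree_verts = insert None (Some ` closed_balls X U),
       tree_edges = insert {None, Some X}
         {{Some B, Some C} | B C. covers (closed_balls X U) B C},
       tree_root = None,
       tree_leaf = (\<lambda>a. Some {a}) \<rparr>"


section \<open>Newton-Puiseux roots and orders of coincidence\<close>

definition adapted_coordinates ::
    "(complex \<Rightarrow> 'r::comm_ring_1) \<Rightarrow> 'r set \<Rightarrow> (complex fps fps \<Rightarrow> 'r) \<Rightarrow> bool" where
  "adapted_coordinates \<iota> L \<phi> \<longleftrightarrow>
     coordinates \<iota> \<phi> \<and> L = principal_ideal (\<phi> (fps_const fps_X))"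

text \<open>Elements of \<open>\<complex>[[x]][y]\<close> have type \<open>complex fps poly\<close>.\<close>

definition weierstrass_polynomial :: "complex fps poly \<Rightarrow> bool" where
  "weierstrass_polynomial p \<longleftrightarrow>
     lead_coeff p = 1 \<and> (\<forall>i<degree p. fps_nth (coeff p i) 0 = 0)"

definition branch_poly ::
    "(complex fps fps \<Rightarrow> 'r::comm_ring_1) \<Rightarrow> 'r set \<Rightarrow> complex fps poly" where
  "branch_poly \<phi> A =
     (THE p. weierstrass_polynomial p \<and> irreducible p \<and> A = principal_ideal (\<phi> (fps_of_poly p)))"

text \<open>A Newton-Puiseux series in \<open>x\<close> is represented by its coefficient function on the rational
  exponents. The following one is \<open>s(x\<^bsup>1/n\<^esup>)\<close>.\<close>

definition puiseux_series :: "nat \<Rightarrow> complex fps \<Rightarrow> rat \<Rightarrow> complex" where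
  "puiseux_series n s =
     (\<lambda>q. if q * of_nat n \<in> \<nat> then fps_nth s (nat \<lfloor>q * of_nat n\<rfloor>) else 0)"

text \<open>With \<open>x = t\<^sup>n\<close>, where \<open>n = degree p\<close>, the series \<open>s(x\<^bsup>1/n\<^esup>)\<close> is a root of \<open>p\<close> iff \<open>s(t)\<close>
  is a root of the polynomial obtained by substituting \<open>t\<^sup>n\<close> for \<open>x\<close> in the coefficients.\<close>

definition newton_puiseux_roots :: "complex fps poly \<Rightarrow> (rat \<Rightarrow> complex) set" where
  "newton_puiseux_roots p =
     {puiseux_series (degree p) s | s.
        poly (map_poly (\<lambda>c. fps_compose c (fps_X ^ degree p)) p) s = 0}"

definition x_order :: "(rat \<Rightarrow> complex) \<Rightarrow> ennreal" where
  "x_order \<eta> = (INF q\<in>{q. \<eta> q \<noteq> 0}. ennreal (real_of_rat q))"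

definition coincidence_order ::
    "(complex fps fps \<Rightarrow> 'r::comm_ring_1) \<Rightarrow> 'r set \<Rightarrow> 'r set \<Rightarrow> ennreal" where
  "coincidence_order \<phi> A B =
     Max {x_order (\<lambda>q. \<eta>\<^sub>A q - \<eta>\<^sub>B q) | \<eta>\<^sub>A \<eta>\<^sub>B.
            \<eta>\<^sub>A \<in> newton_puiseux_roots (branch_poly \<phi> A) \<and>
            \<eta>\<^sub>B \<in> newton_puiseux_roots (branch_poly \<phi> B)}"


section \<open>Quotient spaces and trees from topological spaces\<close>

text \<open>For a set \<open>U\<close> of equivalence classes, \<open>\<Union>U\<close> is the preimage of \<open>U\<close> under the projection
  to the quotient.\<close>

definition quotient_topology :: "'a topology \<Rightarrow> ('a \<times> 'a) set \<Rightarrow> 'a set topology" where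
  "quotient_topology X r = topology (\<lambda>U. U \<subseteq> topspace X // r \<and> openin X (\<Union>U))"

lemma openin_quotient_topology:
  assumes "equiv (topspace X) r"
  shows "openin (quotient_topology X r) U \<longleftrightarrow> U \<subseteq> topspace X // r \<and> openin X (\<Union>U)"
proof -
  have "istopology (\<lambda>U. U \<subseteq> topspace X // r \<and> openin X (\<Union>U))"
    unfolding istopology_def
  proof (intro conjI allI impI)
    fix S T
    assume S: "S \<subseteq> topspace X // r \<and> openin X (\<Union>S)"
      and T: "T \<subseteq> topspace X // r \<and> openin X (\<Union>T)"
    have "\<Union>(S \<inter> T) = \<Union>S \<inter> \<Union>T"
    proof
      show "\<Union>S \<inter> \<Union>T \<subseteq> \<Union>(S \<inter> T)"
      proof
        fix p assume "p \<in> \<Union>S \<inter> \<Union>T"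
        then obtain P Q where PQ: "P \<in> S" "p \<in> P" "Q \<in> T" "p \<in> Q" by blast
        then have "P = Q"
          using quotient_disj[OF assms, of P Q] S T by blast
        then show "p \<in> \<Union>(S \<inter> T)" using PQ by blast
      qed
    qed blast
    then show "openin X (\<Union>(S \<inter> T))" using S T by auto
    show "S \<inter> T \<subseteq> topspace X // r" using S by blast
  next
    fix K
    assume K: "\<forall>S\<in>K. S \<subseteq> topspace X // r \<and> openin X (\<Union>S)"
    then show "\<Union>K \<subseteq> topspace X // r" by blast
    have "\<Union>(\<Union>K) = \<Union>(Union ` K)" by blast
    then show "openin X (\<Union>(\<Union>K))" using K by auto
  qed
  then show ?thesis
    by (simp add: quotient_topology_def)
qed

definition valency :: "'a topology \<Rightarrow> 'a \<Rightarrow> nat" where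
  "valency T p = card (connected_components_of (subtopology T (topspace T - {p})))"

text \<open>Given a finite set \<open>V\<close> of points of a topological tree \<open>T\<close> that contains all leaves and
  ramification points, the open edges are the connected components of \<open>T - V\<close>, and the ends of
  an edge are the points of \<open>V\<close> in its closure.\<close>

definition topological_edges :: "'a topology \<Rightarrow> 'a set \<Rightarrow> 'a set set" where
  "topological_edges T V =
     {{p, q} | p q. p \<in> V \<and> q \<in> V \<and> p \<noteq> q \<and>
        (\<exists>C\<in>connected_components_of (subtopology T (topspace T - V)).
           p \<in> T closure_of C \<and> q \<in> T closure_of C)}"


section \<open>Eggers-Wall trees\<close>

text \<open>The segment of a branch \<open>A\<close> is identified with \<open>[0,\<infinity>]\<close> (the type \<open>ennreal\<close>) by means of
  its exponent function, so that \<open>(A, \<alpha>)\<close> stands for its point of exponent \<open>\<alpha>\<close> in the disjoint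
  union of the segments. The marking of characteristic exponents plays no role for the underlying
  rooted tree, and is left out.\<close>

definition segments_topology :: "'b set \<Rightarrow> ('b \<times> ennreal) topology" where
  "segments_topology F = sum_topology (\<lambda>_. euclidean) F"

definition EW_glued ::
    "(complex fps fps \<Rightarrow> 'r::comm_ring_1) \<Rightarrow> 'r set set \<Rightarrow> 'r set \<times> ennreal \<Rightarrow> 'r set \<times> ennreal \<Rightarrow> bool"
  where
  "EW_glued \<phi> F = (\<lambda>(A, \<alpha>) (B, \<beta>).
     A \<in> F \<and> B \<in> F \<and> A \<noteq> B \<and> \<alpha> = \<beta> \<and> \<alpha> \<le> coincidence_order \<phi> A B)"

definition EW_rel ::
    "(complex fps fps \<Rightarrow> 'r::comm_ring_1) \<Rightarrow> 'r set set \<Rightarrow>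
       (('r set \<times> ennreal) \<times> ('r set \<times> ennreal)) set" where
  "EW_rel \<phi> F = {(p, q). p \<in> F \<times> UNIV \<and> q \<in> F \<times> UNIV \<and> equivclp (EW_glued \<phi> F) p q}"

lemma equiv_EW_rel: "equiv (F \<times> UNIV) (EW_rel \<phi> F)"
  by (rule equivI)
    (auto simp: EW_rel_def refl_on_def sym_def trans_def
      intro: equivclp_refl equivclp_sym equivclp_trans)

definition EW_space ::
    "(complex fps fps \<Rightarrow> 'r::comm_ring_1) \<Rightarrow> 'r set set \<Rightarrow> ('r set \<times> ennreal) set topology" where
  "EW_space \<phi> F = quotient_topology (segments_topology F) (EW_rel \<phi> F)"

definition EW_root ::
    "(complex fps fps \<Rightarrow> 'r::comm_ring_1) \<Rightarrow> 'r set set \<Rightarrow> ('r set \<times> ennreal) set" where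
  "EW_root \<phi> F = (THE P. P \<in> topspace (EW_space \<phi> F) \<and> (\<forall>A\<in>F. (A, 0) \<in> P))"

definition EW_leaf ::
    "(complex fps fps \<Rightarrow> 'r::comm_ring_1) \<Rightarrow> 'r set set \<Rightarrow> 'r set \<Rightarrow> ('r set \<times> ennreal) set" where
  "EW_leaf \<phi> F A = EW_rel \<phi> F `` {(A, \<infinity>)}"

definition EW_vertices ::
    "(complex fps fps \<Rightarrow> 'r::comm_ring_1) \<Rightarrow> 'r set set \<Rightarrow> ('r set \<times> ennreal) set set" where
  "EW_vertices \<phi> F =
     {EW_root \<phi> F} \<union> EW_leaf \<phi> F ` F \<union>
     {P \<in> topspace (EW_space \<phi> F). 3 \<le> valency (EW_space \<phi> F) P}"

definition eggers_wall_tree ::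
    "(complex fps fps \<Rightarrow> 'r::comm_ring_1) \<Rightarrow> 'r set set \<Rightarrow>
       (('r set \<times> ennreal) set, 'r set) rooted_tree" where
  "eggers_wall_tree \<phi> F =
     \<lparr> tree_verts = EW_vertices \<phi> F,
       tree_edges = topological_edges (EW_space \<phi> F) (EW_vertices \<phi> F),
       tree_root = EW_root \<phi> F,
       tree_leaf = EW_leaf \<phi> F \<rparr>"

end

theory Submission
  imports Defs
begin

text \<open>
  Fix coordinates with \<open>L = {x = 0}\<close>. By Weierstrass preparation and the Newton-Puiseux theorem, the
  polynomial of a branch \<open>A\<close> of degree \<open>d\<^sub>A = L \<cdot> A\<close> splits over \<open>\<complex>[[x\<^bsup>1/d\<^esup>]]\<close>, its roots being
  permuted transitively by \<open>x\<^bsup>1/d\<^esup> \<mapsto> \<zeta> x\<^bsup>1/d\<^esup>\<close>. Computing the dimension of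
  \<open>\<complex>[[x]][y] / (f\<^sub>A, f\<^sub>B)\<close> after the base change \<open>x = t\<^sup>d\<close>, which multiplies it by \<open>d\<close>, gives
  \<open>(A \<cdot> B) / d\<^sub>B\<close> as the sum of the orders \<open>\<nu>\<^sub>x(\<eta> - \<theta>)\<close> over the roots \<open>\<eta>\<close> of \<open>A\<close>, for any fixed
  root \<open>\<theta>\<close> of \<open>B\<close>. If \<open>\<eta>\<^sub>0\<close> is a root of \<open>A\<close> closest to \<open>\<theta>\<close>, the summand is
  \<open>min (\<nu>\<^sub>x(\<eta> - \<eta>\<^sub>0)) (k\<^sub>L(A,B))\<close>, so \<open>U\<^sub>L(A,B)\<close> is a strictly decreasing function, depending only on
  \<open>A\<close>, of \<open>k\<^sub>L(A,B)\<close>. Hence \<open>U\<^sub>L\<close> is an ultrametric whose closed balls are the sets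
  \<open>{B. k\<^sub>L(A,B) \<ge> \<alpha>}\<close>. The point of exponent \<open>\<alpha>\<close> on the segment of \<open>A\<close> is identified with exactly
  the points of exponent \<open>\<alpha>\<close> on the segments of the members of this ball, so the vertices and
  edges of the Eggers-Wall tree can be read off from the balls.
\<close>

text \<open>The Newton-Puiseux theorem is obtained by Newton's algorithm. Removing the second
  coefficient ensures that, after the step along the least slope, the reduction modulo t is not a
  power of a linear factor; Weierstrass preparation at one of its roots then splits off a factor of
  smaller degree, as Hensel's lemma would. \<open>quotient_dim\<close> is a definite description, so
  intersection numbers need both a basis and the uniqueness of its size; linear maps onto truncated
  series supply both. The monodromy x -> exp(2 pi i j) x acts on the roots of all branches at once
  and preserves contacts, so every root of A, not merely one, attains the order of coincidence with
  B. This gives the ultrametric inequality, and it lets one fixed root of A serve all B. The sum is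
  strictly increasing in the order of coincidence k because the summand of the fixed root is k
  itself. On the tree, each ball B occupies the exponents above its last contact with an outsider
  and up to the first separation of its members; hence B labels both a vertex and the edge below it,
  and only the root is left over.\<close>

unbundle no vec_syntax

section \<open>Weierstrass division and preparation\<close>

text \<open>Division by a series regular in y recurses on the degree in x, but the outer index of a
  double series is the y-degree. After the exchange, \<open>fps_swap f $ n\<close> is the whole
  coefficient of x^n, a series in y.\<close>

definition fps_swap :: "'a::zero fps fps \<Rightarrow> 'a fps fps" where
  "fps_swap f = Abs_fps (\<lambda>i. Abs_fps (\<lambda>j. f $ j $ i))"

lemma fps_swap_nth [simp]: "fps_swap f $ i $ j = f $ j $ i"
  by (simp add: fps_swap_def)

lemma fps_fps_eqI: "(\<And>i j. f $ i $ j = g $ i $ j) \<Longrightarrow> f = g"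
  by (simp add: fps_eq_iff)

lemma fps_swap_swap [simp]: "fps_swap (fps_swap f) = f"
  by (rule fps_fps_eqI) simp

lemma fps_swap_0 [simp]: "fps_swap 0 = 0"
  by (rule fps_fps_eqI) simp

lemma fps_swap_add: "fps_swap (f + g :: 'a::monoid_add fps fps) = fps_swap f + fps_swap g"
  by (rule fps_fps_eqI) simp

lemma fps_swap_const_const [simp]: "fps_swap (fps_const (fps_const c)) = fps_const (fps_const c)"
  by (rule fps_fps_eqI) (auto simp: fps_nth_fps_const)

lemma fps_swap_X [simp]: "fps_swap fps_X = fps_const (fps_X :: 'a::zero_neq_one fps)"
  by (rule fps_fps_eqI) (auto simp: fps_X_def fps_nth_fps_const)

lemma fps_swap_mult: "fps_swap (f * g :: 'a::comm_semiring_1 fps fps) = fps_swap f * fps_swap g"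
proof (rule fps_fps_eqI)
  fix i j
  have "fps_swap (f * g) $ i $ j = (\<Sum>k=0..j. \<Sum>l=0..i. f $ k $ l * g $ (j - k) $ (i - l))"
    by (simp add: fps_mult_nth fps_sum_nth)
  also have "\<dots> = (\<Sum>l=0..i. \<Sum>k=0..j. f $ k $ l * g $ (j - k) $ (i - l))"
    by (rule sum.swap)
  also have "\<dots> = (fps_swap f * fps_swap g) $ i $ j"
    by (simp add: fps_mult_nth fps_sum_nth)
  finally show "fps_swap (f * g) $ i $ j = (fps_swap f * fps_swap g) $ i $ j" .
qed

lemma bij_fps_swap: "bij fps_swap"
  by (rule o_bij[of fps_swap]) (auto simp: fun_eq_iff)

text \<open>Regularity in y: f(0,y) has order exactly d, since the inner index 0 selects the part
  free of x.\<close>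

definition regular_of_order :: "nat \<Rightarrow> 'a::zero fps fps \<Rightarrow> bool" where
  "regular_of_order d f \<longleftrightarrow> (\<forall>i<d. f $ i $ 0 = 0) \<and> f $ d $ 0 \<noteq> 0"

text \<open>Both series arrive with the variables exchanged. \<open>R\<close> is what is left at x^n
  after the earlier quotient coefficients; its terms of y-degree below d go to the remainder, and
  the others are divisible by \<open>f $ 0\<close> when that has order d.\<close>

fun division_coeff :: "'a::field fps fps \<Rightarrow> 'a fps fps \<Rightarrow> nat \<Rightarrow> nat \<Rightarrow> 'a fps" where
  "division_coeff f h d n =
     (let R = h $ n - (\<Sum>i<n. division_coeff f h d i * f $ (n - i))
      in (R - fps_cutoff d R) / f $ 0)"

declare division_coeff.simps [simp del]

lemma fps_dvd_diff_cutoff: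
  fixes f R :: "'a::field fps"
  assumes "f \<noteq> 0" "subdegree f \<le> d"
  shows "f dvd R - fps_cutoff d R"
proof (cases "R - fps_cutoff d R = 0")
  case False
  have "d \<le> subdegree (R - fps_cutoff d R)"
    by (rule subdegree_geI[OF False]) simp
  with assms show ?thesis
    by (subst fps_dvd_iff[OF assms(1) False]) simp
qed simp

lemma regular_swap:
  assumes "regular_of_order d f"
  shows "fps_swap f $ 0 \<noteq> 0" "subdegree (fps_swap f $ 0) = d"
proof -
  show "fps_swap f $ 0 \<noteq> 0"
    using assms by (auto simp: regular_of_order_def fps_eq_iff)
  show "subdegree (fps_swap f $ 0) = d"
    using assms by (intro subdegreeI) (auto simp: regular_of_order_def)
qed

text \<open>The coefficients of the quotient are found by recursion on the degree in \<open>x\<close>: after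
  exchanging the variables, the coefficient of \<open>x\<^sup>0\<close> in \<open>f\<close> is a unit times \<open>y\<^sup>d\<close>.\<close>

lemma weierstrass_division:
  fixes f h :: "'a::field fps fps"
  assumes "regular_of_order d f"
  obtains q r where "h = q * f + r" "\<And>i. d \<le> i \<Longrightarrow> r $ i = 0"
proof -
  define F where "F = fps_swap f"
  define Q where "Q = Abs_fps (division_coeff F (fps_swap h) d)"
  define R where "R = fps_swap h - Q * F"
  note F0 = regular_swap[OF assms, folded F_def]
  have R: "R $ n $ i = 0" if "d \<le> i" for n i
  proof -
    define S where "S = fps_swap h $ n - (\<Sum>i<n. Q $ i * F $ (n - i))"
    have "Q $ n = (S - fps_cutoff d S) / F $ 0"
      by (simp add: Q_def S_def Let_def division_coeff.simps[of _ _ _ n])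
    then have "Q $ n * F $ 0 = S - fps_cutoff d S"
      using fps_dvd_diff_cutoff[of "F $ 0" d S] F0 by simp
    moreover have "(Q * F) $ n = (\<Sum>i<n. Q $ i * F $ (n - i)) + Q $ n * F $ 0"
      by (simp add: fps_mult_nth atLeast0AtMost flip: lessThan_Suc_atMost)
    ultimately have "R $ n = fps_cutoff d S"
      by (simp add: R_def S_def)
    then show ?thesis using that by simp
  qed
  show ?thesis
  proof
    have "h = fps_swap (Q * F + R)" by (simp add: R_def)
    then show "h = fps_swap Q * f + fps_swap R"
      by (simp add: fps_swap_add fps_swap_mult F_def)
    show "fps_swap R $ i = 0" if "d \<le> i" for i
      using R[OF that] by (auto simp: fps_eq_iff)
  qed
qed

text \<open>In (q - q') f = r' - r, the first nonzero x-coefficient of q - q' would be multiplied by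
  f(0,y) and have y-order at least d, where the right side has no terms.\<close>

lemma weierstrass_division_unique:
  fixes f :: "'a::field fps fps"
  assumes reg: "regular_of_order d f"
    and eq: "q * f + r = q' * f + r'"
    and r: "\<And>i. d \<le> i \<Longrightarrow> r $ i = 0" and r': "\<And>i. d \<le> i \<Longrightarrow> r' $ i = 0"
  shows "q = q'" "r = r'"
proof -
  define F where "F = fps_swap f"
  define Q where "Q = fps_swap (q - q')"
  note F0 = regular_swap[OF reg, folded F_def]
  have "(q - q') * f = r' - r"
    using eq by algebra
  then have *: "Q * F = fps_swap (r' - r)"
    by (simp add: Q_def F_def flip: fps_swap_mult)
  have "Q $ n = 0" for n
  proof (induction n rule: less_induct)
    case (less n)
    have "(Q * F) $ n = (\<Sum>i<n. Q $ i * F $ (n - i)) + Q $ n * F $ 0"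
      by (simp add: fps_mult_nth atLeast0AtMost flip: lessThan_Suc_atMost)
    then have Qn: "Q $ n * F $ 0 = fps_swap (r' - r) $ n"
      using less by (simp add: *)
    have "(Q $ n * F $ 0) $ i = 0" for i
    proof (cases "d \<le> i")
      case True
      then show ?thesis unfolding Qn by (simp add: r r')
    next
      case False
      then show ?thesis using F0 by (intro fps_mult_nth_eq0) auto
    qed
    then have "Q $ n * F $ 0 = 0" by (simp add: fps_eq_iff)
    with F0 show ?case by simp
  qed
  then have "Q = 0" by (simp add: fps_eq_iff)
  then have "fps_swap Q = 0" by simp
  then show "q = q'" by (simp add: Q_def)
  with eq show "r = r'" by simp
qed

text \<open>For the converse direction, 1 is divided by \<open>u\<close>, which is regular of order
  0, so that the remainder must vanish.\<close>

lemma fps_fps_unit_iff: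
  fixes u :: "'a::field fps fps"
  shows "u dvd 1 \<longleftrightarrow> u $ 0 $ 0 \<noteq> 0"
proof
  assume "u dvd 1"
  then obtain v where v: "1 = u * v" by (rule dvdE)
  have "u $ 0 $ 0 * v $ 0 $ 0 = (u * v) $ 0 $ 0" by simp
  also have "\<dots> = 1" unfolding v[symmetric] by simp
  finally show "u $ 0 $ 0 \<noteq> 0" by auto
next
  assume "u $ 0 $ 0 \<noteq> 0"
  then have "regular_of_order 0 u" by (simp add: regular_of_order_def)
  then obtain q r where "1 = q * u + r" "\<And>i. 0 \<le> i \<Longrightarrow> r $ i = 0"
    using weierstrass_division[of 0 u 1] by blast
  then have "1 = u * q" by (simp add: fps_eq_iff mult.commute)
  then show "u dvd 1" by (rule dvdI)
qed

lemma weierstrass_regular: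
  assumes "weierstrass_polynomial W"
  shows "regular_of_order (degree W) (fps_of_poly W)"
  using assms by (auto simp: weierstrass_polynomial_def regular_of_order_def)

lemma fps_of_poly_exists:
  assumes "\<And>i. d \<le> i \<Longrightarrow> r $ i = 0"
  obtains p where "fps_of_poly p = r" "p = 0 \<or> degree p < d"
proof
  define p where "p = Abs_poly (fps_nth r)"
  have c: "coeff p i = r $ i" for i
    unfolding p_def
    by (subst coeff_Abs_poly[of d]) (use assms in auto)
  show "fps_of_poly p = r" by (simp add: fps_eq_iff c)
  show "p = 0 \<or> degree p < d"
  proof (rule disjCI)
    assume "\<not> degree p < d"
    then have "lead_coeff p = 0" using assms c by simp
    then show "p = 0" by simp
  qed
qed

text \<open>The polynomial is y^d - r, where r is the remainder of y^d on division by f; the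
  quotient is the unit.\<close>

lemma weierstrass_preparation:
  fixes f :: "complex fps fps"
  assumes reg: "regular_of_order d f"
  obtains W u where "weierstrass_polynomial W" "degree W = d" "u dvd 1" "fps_of_poly W = u * f"
proof -
  obtain q r where qr: "fps_X ^ d = q * f + r" and r: "\<And>i. d \<le> i \<Longrightarrow> r $ i = 0"
    using weierstrass_division[OF reg] by blast
  have eq0: "fps_swap q $ 0 * fps_swap f $ 0 = fps_swap (fps_X ^ d - r) $ 0"
    unfolding qr by (simp add: fps_swap_mult)
  note f0 = regular_swap[OF reg]
  \<comment> \<open>At x = 0 both q f and y^d have y-order at least d, so r, of degree below d,
    vanishes there, as a Weierstrass polynomial requires.\<close>
  have r0: "r $ i $ 0 = 0" for i
  proof (cases "d \<le> i")
    case False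
    then have "(fps_swap q $ 0 * fps_swap f $ 0) $ i = 0"
      using f0 by (intro fps_mult_nth_eq0) auto
    with False show ?thesis unfolding eq0 by simp
  qed (simp add: r)
  \<comment> \<open>Comparing the coefficients of y^d at x = 0 shows that the constant term of q is
    nonzero.\<close>
  have "(fps_swap q $ 0 * fps_swap f $ 0) $ d = q $ 0 $ 0 * f $ d $ 0"
    using nth_subdegree_mult_right[of "fps_swap q $ 0" "fps_swap f $ 0"] f0 
    by (simp add: fps_mult_nth_conv_upto_subdegree_right)
  moreover have "(fps_swap q $ 0 * fps_swap f $ 0) $ d = 1"
    unfolding eq0 by (simp add: r0)
  ultimately have "q dvd 1" by (auto simp: fps_fps_unit_iff)
  obtain p where p: "fps_of_poly p = r" "p = 0 \<or> degree p < d"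
    using fps_of_poly_exists[OF r] by blast
  define W where "W = monom 1 d - p"
  have W: "fps_of_poly W = q * f"
    using qr p by (simp add: W_def fps_of_poly_diff fps_of_poly_monom')
  have dW: "degree W = d"
  proof (cases "p = 0")
    case False
    with p have "degree (- p) < degree (monom (1::complex fps) d)" by (simp add: degree_monom_eq)
    from degree_add_eq_left[OF this] show ?thesis by (simp add: W_def degree_monom_eq)
  qed (simp add: W_def degree_monom_eq)
  have cp: "coeff p i = r $ i" for i using p(1) by auto
  have "weierstrass_polynomial W"
    unfolding weierstrass_polynomial_def dW by (auto simp: W_def cp r r0)
  with dW \<open>q dvd 1\<close> W show ?thesis using that by blast
qed

lemma monic_division:
  fixes f g :: "'a::comm_ring_1 poly"
  assumes "lead_coeff g = 1"
  obtains q r where "f = q * g + r" "r = 0 \<or> degree r < degree g"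
proof -
  obtain q r where qr: "pseudo_divmod f g = (q, r)" by fastforce
  have "g \<noteq> 0" using assms by auto
  from pseudo_divmod[OF this qr] assms that[of q r] show ?thesis
    by (simp add: mult.commute)
qed

lemma fps_of_poly_low:
  assumes "p = 0 \<or> degree p < d" "d \<le> i"
  shows "fps_of_poly p $ i = 0"
  using assms by (auto simp: coeff_eq_0)

text \<open>Division by a monic polynomial inside C[[x]][y] is also a Weierstrass division, so
  uniqueness forces its remainder to be zero.\<close>

lemma weierstrass_dvd_poly:
  fixes W p :: "complex fps poly"
  assumes W: "weierstrass_polynomial W" and "fps_of_poly W dvd fps_of_poly p"
  shows "W dvd p"
proof -
  obtain q r where qr: "p = q * W + r" "r = 0 \<or> degree r < degree W"
    using monic_division[of W p] W by (auto simp: weierstrass_polynomial_def)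
  obtain k where "fps_of_poly p = fps_of_poly W * k"
    using assms(2) by (rule dvdE)
  then have "fps_of_poly p = k * fps_of_poly W + 0" by (simp add: mult.commute)
  moreover have "fps_of_poly p = fps_of_poly q * fps_of_poly W + fps_of_poly r"
    by (simp add: qr fps_of_poly_add fps_of_poly_mult)
  ultimately have "fps_of_poly r = 0"
    using weierstrass_division_unique(2)[OF weierstrass_regular[OF W],
        of "fps_of_poly q" "fps_of_poly r" k 0] fps_of_poly_low[OF qr(2)]
    by simp
  then have "r = 0" by (metis fps_of_poly_0 fps_of_poly_eq_iff)
  with qr show ?thesis by simp
qed

lemma irreducible_weierstrass:
  fixes W :: "complex fps poly"
  assumes W: "weierstrass_polynomial W" and irr: "irreducible (fps_of_poly W)"
  shows "irreducible W"
proof (rule irreducibleI)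
  show "W \<noteq> 0" using irr by auto
  show "\<not> W dvd 1"
  proof
    assume "W dvd 1"
    then obtain v where "1 = W * v" by (rule dvdE)
    then have "1 = fps_of_poly W * fps_of_poly v" by (metis fps_of_poly_mult fps_of_poly_1)
    then have "fps_of_poly W dvd 1" by (rule dvdI)
    with irr show False by (simp add: irreducible_not_unit)
  qed
next
  \<comment> \<open>If a is a unit among series, then W divides b already in C[[x]][y]; cancelling W
    exhibits a polynomial inverse of a.\<close>
  have aux: "a dvd 1" if ab: "W = a * b" and u: "fps_of_poly a dvd 1" for a b
  proof -
    have "fps_of_poly W dvd fps_of_poly b"
      using u by (simp add: ab fps_of_poly_mult mult_unit_dvd_iff')
    then have "W dvd b" by (rule weierstrass_dvd_poly[OF W])
    then obtain c where "b = W * c" by (rule dvdE)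
    then have "W * (a * c) = W * 1" using ab by (simp add: ac_simps)
    moreover have "W \<noteq> 0" using irr by auto
    ultimately have "a * c = 1" using mult_left_cancel by blast
    then show "a dvd 1" by (metis dvdI)
  qed
  fix a b assume ab: "W = a * b"
  then have "fps_of_poly a dvd 1 \<or> fps_of_poly b dvd 1"
    using irr by (auto simp: fps_of_poly_mult dest: irreducibleD)
  then show "a dvd 1 \<or> b dvd 1"
    using aux[of a b] aux[of b a] ab by (auto simp: mult.commute)
qed

lemma weierstrass_associated_unique:
  assumes V: "weierstrass_polynomial V" and W: "weierstrass_polynomial W"
    and "fps_of_poly V dvd fps_of_poly W" "fps_of_poly W dvd fps_of_poly V"
  shows "V = W"
proof -
  have "V dvd W" "W dvd V" using weierstrass_dvd_poly assms by blast+
  then obtain a b where a: "W = V * a" and b: "V = W * b" unfolding dvd_def by blast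
  have nz: "V \<noteq> 0" "W \<noteq> 0" using V W by (auto simp: weierstrass_polynomial_def)
  have "W * (b * a) = W * 1" using a b by (simp add: ac_simps)
  then have ba: "b * a = 1" using nz mult_left_cancel by blast
  have "degree b + degree a = 0"
    using ba degree_mult_eq[of b a] by (metis degree_1 mult_eq_0_iff one_neq_zero)
  then obtain c where c: "a = [:c:]" by (metis add_is_0 degree_eq_zeroE)
  have "lead_coeff W = lead_coeff V * c" using a c by (simp add: lead_coeff_mult)
  then have "c = 1" using V W by (simp add: weierstrass_polynomial_def)
  with a c show ?thesis by simp
qed

section \<open>Coordinates and branches\<close>

abbreviation const2 :: "complex \<Rightarrow> complex fps fps" where
  "const2 \<equiv> \<lambda>c. fps_const (fps_const c)"

lemma principal_ideal_altdef: "principal_ideal f = {g. f dvd g}"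
  by (auto simp: principal_ideal_def dvd_def)

lemma principal_ideal_eq_iff: "principal_ideal f = principal_ideal g \<longleftrightarrow> f dvd g \<and> g dvd f"
proof
  assume "principal_ideal f = principal_ideal g"
  then have "f dvd h \<longleftrightarrow> g dvd h" for h by (auto simp: principal_ideal_altdef set_eq_iff)
  from this[of f] this[of g] show "f dvd g \<and> g dvd f" by simp
next
  assume "f dvd g \<and> g dvd f"
  then show "principal_ideal f = principal_ideal g"
    unfolding principal_ideal_altdef by (intro Collect_cong iffI) (meson dvd_trans)+
qed

context
  fixes \<iota> :: "complex \<Rightarrow> 'r::comm_ring_1" and \<phi>
  assumes \<phi>: "coordinates \<iota> \<phi>"
begin

lemma coordinates_add: "\<phi> (f + g) = \<phi> f + \<phi> g"
  and coordinates_mult: "\<phi> (f * g) = \<phi> f * \<phi> g"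
  and coordinates_1: "\<phi> 1 = 1"
  and coordinates_const: "\<phi> (fps_const (fps_const c)) = \<iota> c"
  using \<phi> by (auto simp: coordinates_def)

lemma coordinates_0: "\<phi> 0 = 0"
  using coordinates_add[of 0 0] by simp

lemma coordinates_eq_iff: "\<phi> f = \<phi> g \<longleftrightarrow> f = g"
  using \<phi> by (auto simp: coordinates_def bij_def inj_eq)

lemma coordinates_surj: obtains f where "a = \<phi> f"
  using \<phi> unfolding coordinates_def bij_def surj_def by metis

lemma coordinates_dvd_iff: "\<phi> f dvd \<phi> g \<longleftrightarrow> f dvd g"
proof
  assume "\<phi> f dvd \<phi> g"
  then obtain a where "\<phi> g = \<phi> f * a" by (rule dvdE)
  moreover obtain h where "a = \<phi> h" by (rule coordinates_surj)
  ultimately have "\<phi> g = \<phi> (f * h)" by (simp add: coordinates_mult)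
  then show "f dvd g" by (simp add: coordinates_eq_iff)
qed (auto simp: dvd_def coordinates_mult)

lemma coordinates_unit_iff: "\<phi> f dvd 1 \<longleftrightarrow> f dvd 1"
  using coordinates_dvd_iff[of f 1] by (simp add: coordinates_1)

lemma coordinates_irreducible: "irreducible (\<phi> f) \<longleftrightarrow> irreducible f"
proof -
  have "(\<forall>a b. \<phi> f = a * b \<longrightarrow> a dvd 1 \<or> b dvd 1) \<longleftrightarrow> (\<forall>a b. f = a * b \<longrightarrow> a dvd 1 \<or> b dvd 1)"
  proof (intro iffI allI impI)
    fix a b assume *: "\<forall>a b. \<phi> f = a * b \<longrightarrow> a dvd 1 \<or> b dvd 1" and "f = a * b"
    then have "\<phi> f = \<phi> a * \<phi> b" by (simp add: coordinates_mult)
    with * have "\<phi> a dvd 1 \<or> \<phi> b dvd 1" by blast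
    then show "a dvd 1 \<or> b dvd 1" by (simp add: coordinates_unit_iff)
  next
    fix a b assume *: "\<forall>a b. f = a * b \<longrightarrow> a dvd 1 \<or> b dvd 1" and ab: "\<phi> f = a * b"
    obtain a' b' where ab': "a = \<phi> a'" "b = \<phi> b'" by (metis coordinates_surj)
    with ab have "f = a' * b'" by (simp add: coordinates_eq_iff flip: coordinates_mult)
    with * show "a dvd 1 \<or> b dvd 1" by (simp add: ab' coordinates_unit_iff)
  qed
  moreover have "\<phi> f = 0 \<longleftrightarrow> f = 0"
    using coordinates_eq_iff[of f 0] by (simp add: coordinates_0)
  ultimately show ?thesis
    unfolding irreducible_def coordinates_unit_iff by blast
qed

lemma branch_coordinates:
  assumes "branch A"
  obtains f where "irreducible f" "A = principal_ideal (\<phi> f)"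
  using assms coordinates_irreducible unfolding branch_def by (metis coordinates_surj)

lemma coordinates_comp:
  assumes "coordinates const2 \<psi>"
  shows "coordinates \<iota> (\<phi> \<circ> \<psi>)"
  using assms \<phi> unfolding coordinates_def by (auto intro: bij_comp)

end

lemma fps_const_X_dvd:
  fixes f :: "complex fps fps"
  assumes "\<And>i. f $ i $ 0 = 0"
  shows "fps_const fps_X dvd f"
proof
  show "f = fps_const fps_X * Abs_fps (\<lambda>i. fps_shift 1 (f $ i))"
    using assms by (intro fps_fps_eqI) (auto simp: fps_X_mult_nth gr0_conv_Suc)
qed

text \<open>A series that is not regular vanishes at x = 0 and is a multiple of x; being
  irreducible, it would be associated to x.\<close>

lemma irreducible_regular:
  fixes f :: "complex fps fps"
  assumes irr: "irreducible f" and X: "\<not> (f dvd fps_const fps_X)"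
  obtains d where "regular_of_order d f"
proof -
  have "\<exists>i. f $ i $ 0 \<noteq> 0"
  proof (rule ccontr)
    assume "\<nexists>i. f $ i $ 0 \<noteq> 0"
    then have "fps_const fps_X dvd f" by (intro fps_const_X_dvd) auto
    then obtain h where h: "f = fps_const fps_X * h" by (rule dvdE)
    have "\<not> fps_const (fps_X :: complex fps) dvd 1" by (simp add: fps_fps_unit_iff)
    then have "h dvd 1" using irr h by (auto dest: irreducibleD)
    then obtain k where "1 = h * k" by (rule dvdE)
    then have "fps_const fps_X = f * k" using h by (simp add: mult.assoc)
    with X show False by auto
  qed
  then have "regular_of_order (LEAST i. f $ i $ 0 \<noteq> 0) f"
    unfolding regular_of_order_def by (metis (mono_tags, lifting) LeastI_ex not_less_Least)
  then show ?thesis by (rule that)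
qed

lemma irreducible_unit_mult:
  fixes f u :: "'a::idom"
  assumes "u dvd 1" "irreducible f"
  shows "irreducible (u * f)"
proof (rule irreducibleI)
  obtain v where v: "1 = u * v" using assms(1) by (rule dvdE)
  show "u * f \<noteq> 0" using assms by auto
  show "\<not> u * f dvd 1" using assms dvd_mult_right irreducible_not_unit by blast
  fix a b assume "u * f = a * b"
  then have "(u * v) * f = (v * a) * b" by algebra
  then have "f = (v * a) * b" by (simp flip: v)
  then have "v * a dvd 1 \<or> b dvd 1" using assms(2) irreducibleD by blast
  then show "a dvd 1 \<or> b dvd 1" using dvd_mult_right by blast
qed

text \<open>Existence and uniqueness of the Weierstrass generator give the definite description its
  meaning. A \<noteq> L is what makes a generator regular in y.\<close>

lemma branch_poly:
  assumes \<phi>: "adapted_coordinates \<iota> L \<phi>" and A: "branch A" "A \<noteq> L"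
  shows "weierstrass_polynomial (branch_poly \<phi> A)" "irreducible (branch_poly \<phi> A)"
    "A = principal_ideal (\<phi> (fps_of_poly (branch_poly \<phi> A)))"
proof -
  have c: "coordinates \<iota> \<phi>" and L: "L = principal_ideal (\<phi> (fps_const fps_X))"
    using \<phi> by (auto simp: adapted_coordinates_def)
  obtain f where irr: "irreducible f" and Af: "A = principal_ideal (\<phi> f)"
    using branch_coordinates[OF c A(1)] by blast
  have "\<not> f dvd fps_const fps_X"
  proof
    assume *: "f dvd fps_const fps_X"
    then obtain h where h: "fps_const fps_X = f * h" by (rule dvdE)
    have "f $ 0 $ 0 = 0"
      using irr fps_fps_unit_iff[of f] by (auto simp: irreducible_not_unit)
    \<comment> \<open>As f(0,0) = 0, the coefficient of x in f h is the one in f times h(0,0); hence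
      h is a unit, and f would be associated to x.\<close>
    moreover have "(f * h) $ 0 $ 1 = 1" unfolding h[symmetric] by simp
    ultimately have "h $ 0 $ 0 \<noteq> 0" by auto
    then have "h dvd 1" by (simp add: fps_fps_unit_iff)
    then obtain k where "1 = h * k" by (rule dvdE)
    then have "f = fps_const fps_X * k" using h by (simp add: mult.assoc)
    then have "fps_const fps_X dvd f" by simp
    with * have "A = L"
      unfolding Af L principal_ideal_eq_iff coordinates_dvd_iff[OF c] by blast
    with A(2) show False by simp
  qed
  then obtain d where "regular_of_order d f" by (rule irreducible_regular[OF irr])
  then obtain W u where W: "weierstrass_polynomial W" "u dvd 1" "fps_of_poly W = u * f"
    by (rule weierstrass_preparation)
  have "irreducible (fps_of_poly W)" using irr W by (simp add: irreducible_unit_mult)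
  then have irrW: "irreducible W" using irreducible_weierstrass W by blast
  have "f dvd fps_of_poly W" "fps_of_poly W dvd f"
    using W by (auto simp: mult_unit_dvd_iff')
  then have AW: "A = principal_ideal (\<phi> (fps_of_poly W))"
    unfolding Af principal_ideal_eq_iff coordinates_dvd_iff[OF c] by blast
  let ?P = "\<lambda>p. weierstrass_polynomial p \<and> irreducible p \<and> A = principal_ideal (\<phi> (fps_of_poly p))"
  have "?P (branch_poly \<phi> A)" unfolding branch_poly_def
  proof (rule theI)
    show "?P W" using W irrW AW by blast
    fix V assume V: "?P V"
    then have "principal_ideal (\<phi> (fps_of_poly V)) = principal_ideal (\<phi> (fps_of_poly W))"
      using AW by simp
    then show "V = W"
      unfolding principal_ideal_eq_iff coordinates_dvd_iff[OF c]
      using weierstrass_associated_unique V W by blast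
  qed
  then show "weierstrass_polynomial (branch_poly \<phi> A)" "irreducible (branch_poly \<phi> A)"
    "A = principal_ideal (\<phi> (fps_of_poly (branch_poly \<phi> A)))" by blast+
qed

section \<open>Shears y -> y + g(x) and the existence of adapted coordinates\<close>

definition linear_quotient :: "'a::field fps \<Rightarrow> 'a fps fps \<Rightarrow> 'a fps fps" where
  "linear_quotient g h = (SOME q. \<exists>r. h = q * (fps_X - fps_const g) + fps_const r)"

text \<open>For g(0) = 0 this is the value h(x, g(x)): substitution is obtained from division by y -
  g, which is why it is additive and multiplicative.\<close>

definition linear_remainder :: "'a::field fps \<Rightarrow> 'a fps fps \<Rightarrow> 'a fps" where
  "linear_remainder g h = (SOME r. h = linear_quotient g h * (fps_X - fps_const g) + fps_const r)"

primrec shear_coeff :: "'a::field fps \<Rightarrow> nat \<Rightarrow> 'a fps fps \<Rightarrow> 'a fps" where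
  "shear_coeff g 0 h = linear_remainder g h"
| "shear_coeff g (Suc k) h = shear_coeff g k (linear_quotient g h)"

text \<open>The automorphism \<open>y \<mapsto> y + g(x)\<close>: the coefficients of the image of \<open>h\<close> are the digits of
  \<open>h\<close> in base \<open>y - g(x)\<close>.\<close>

definition shear :: "'a::field fps \<Rightarrow> 'a fps fps \<Rightarrow> 'a fps fps" where
  "shear g h = Abs_fps (\<lambda>k. shear_coeff g k h)"

context
  fixes g :: "'a::field fps"
  assumes g: "g $ 0 = 0"
begin

lemma regular_linear: "regular_of_order 1 (fps_X - fps_const g)"
  using g by (simp add: regular_of_order_def)

lemma linear_division: "h = linear_quotient g h * (fps_X - fps_const g) + fps_const (linear_remainder g h)"
proof -
  obtain q r where h: "h = q * (fps_X - fps_const g) + r" and r: "\<And>i. 1 \<le> i \<Longrightarrow> r $ i = 0"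
    using weierstrass_division[OF regular_linear, of h] by blast
  define c where "c = r $ 0"
  have "r = fps_const c"
    using r by (intro fps_ext) (simp add: fps_nth_fps_const c_def)
  then have "h = q * (fps_X - fps_const g) + fps_const c" using h by (simp only:)
  then have "\<exists>q r. h = q * (fps_X - fps_const g) + fps_const r" by (intro exI)
  then have "\<exists>r. h = linear_quotient g h * (fps_X - fps_const g) + fps_const r"
    unfolding linear_quotient_def
    by (rule someI_ex[where P = "\<lambda>q. \<exists>r. h = q * (fps_X - fps_const g) + fps_const r"])
  then show ?thesis
    unfolding linear_remainder_def
    by (rule someI_ex[where P = "\<lambda>r. h = linear_quotient g h * (fps_X - fps_const g) + fps_const r"])
qed

lemma linear_division_unique:
  assumes "h = q * (fps_X - fps_const g) + fps_const r"
  shows "linear_quotient g h = q" "linear_remainder g h = r"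
proof -
  have eq: "linear_quotient g h * (fps_X - fps_const g) + fps_const (linear_remainder g h) =
      q * (fps_X - fps_const g) + fps_const r"
    unfolding linear_division[symmetric] by (fact assms)
  show "linear_quotient g h = q"
    by (rule weierstrass_division_unique(1)[OF regular_linear eq]) (auto simp: fps_nth_fps_const)
  have "fps_const (linear_remainder g h) = fps_const r"
    by (rule weierstrass_division_unique(2)[OF regular_linear eq]) (auto simp: fps_nth_fps_const)
  then show "linear_remainder g h = r" by simp
qed

lemma linear_add:
  "linear_quotient g (h + h') = linear_quotient g h + linear_quotient g h'"
  "linear_remainder g (h + h') = linear_remainder g h + linear_remainder g h'"
proof -
  have "h + h' = (linear_quotient g h + linear_quotient g h') * (fps_X - fps_const g) +
      fps_const (linear_remainder g h + linear_remainder g h')"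
    using linear_division[of h] linear_division[of h'] unfolding fps_const_add[symmetric] by algebra
  from linear_division_unique[OF this] show
    "linear_quotient g (h + h') = linear_quotient g h + linear_quotient g h'"
    "linear_remainder g (h + h') = linear_remainder g h + linear_remainder g h'" .
qed

text \<open>Expanding h = q l + r with l = y - g, and h' = q' l + r' only in the term r h', gives a
  twisted Leibniz rule for the quotient; it fits the recursion of the Cauchy product in
  \<open>shear_mult\<close>.\<close>

lemma linear_mult:
  "linear_quotient g (h * h') = linear_quotient g h * h' + fps_const (linear_remainder g h) * linear_quotient g h'"
  "linear_remainder g (h * h') = linear_remainder g h * linear_remainder g h'"
proof -
  define q r where "q = linear_quotient g h" and "r = linear_remainder g h"
  define q' r' where "q' = linear_quotient g h'" and "r' = linear_remainder g h'"
  define l where "l = fps_X - fps_const g"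
  have h: "h = q * l + fps_const r" and h': "h' = q' * l + fps_const r'"
    unfolding q_def r_def q'_def r'_def l_def by (rule linear_division)+
  have "h * h' = (q * h' + fps_const r * q') * l + fps_const (r * r')"
    using h h' unfolding fps_const_mult[symmetric] by algebra
  from linear_division_unique[OF this[unfolded l_def]]
  show "linear_quotient g (h * h') = linear_quotient g h * h' + fps_const (linear_remainder g h) * linear_quotient g h'"
    "linear_remainder g (h * h') = linear_remainder g h * linear_remainder g h'"
    by (simp_all add: q_def r_def q'_def r'_def)
qed

lemma linear_const:
  "linear_quotient g (fps_const c) = 0" "linear_remainder g (fps_const c) = c"
  using linear_division_unique[of "fps_const c" 0 c] by simp_all

lemma shear_nth_0: "shear g h $ 0 = linear_remainder g h"
  and shear_nth_Suc: "shear g h $ Suc k = shear g (linear_quotient g h) $ k"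
  by (simp_all add: shear_def)

lemma shear_add: "shear g (h + h') = shear g h + shear g h'"
proof -
  have "shear g (h + h') $ k = shear g h $ k + shear g h' $ k" for k
    by (induction k arbitrary: h h') (simp_all add: shear_nth_0 shear_nth_Suc linear_add)
  then show ?thesis by (simp add: fps_eq_iff)
qed

lemma shear_const_mult: "shear g (fps_const c * h) $ k = c * shear g h $ k"
  by (induction k arbitrary: h) (simp_all add: shear_nth_0 shear_nth_Suc linear_mult linear_const)

lemma shear_mult: "shear g (h * h') = shear g h * shear g h'"
proof -
  have "shear g (h * h') $ k = (\<Sum>i=0..k. shear g h $ i * shear g h' $ (k - i))" for k
  proof (induction k arbitrary: h h')
    case (Suc k)
    have "shear g (h * h') $ Suc k =
        shear g (linear_quotient g h * h') $ k + linear_remainder g h * shear g (linear_quotient g h') $ k"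
      by (simp only: shear_nth_Suc linear_mult shear_add fps_add_nth shear_const_mult)
    also have "\<dots> = (\<Sum>i=0..k. shear g h $ Suc i * shear g h' $ (Suc k - Suc i)) + shear g h $ 0 * shear g h' $ Suc k"
      by (simp add: Suc shear_nth_Suc shear_nth_0)
    also have "\<dots> = (\<Sum>i=0..Suc k. shear g h $ i * shear g h' $ (Suc k - i))"
      by (simp only: sum.atLeast0_atMost_Suc_shift) (simp add: add.commute)
    finally show ?case .
  qed (simp add: shear_nth_0 linear_mult)
  then show ?thesis by (simp add: fps_eq_iff fps_mult_nth)
qed

lemma shear_const: "shear g (fps_const c) = fps_const c"
proof -
  have "shear g 0 $ k = 0" for k
    using shear_const_mult[of 0 0 k] by simp
  then have "shear g (fps_const c) $ k = fps_const c $ k" for k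
    by (cases k) (simp_all add: shear_nth_0 shear_nth_Suc linear_const)
  then show ?thesis by (simp add: fps_eq_iff)
qed

lemma shear_X: "shear g fps_X = fps_X + fps_const g"
proof -
  have l: "linear_quotient g fps_X = 1" "linear_remainder g fps_X = g"
    using linear_division_unique[of fps_X 1 g] by simp_all
  have "shear g 1 = 1" using shear_const[of 1] by simp
  then have "shear g fps_X $ k = (fps_X + fps_const g) $ k" for k
    by (cases k) (auto simp: shear_nth_0 shear_nth_Suc l)
  then show ?thesis by (simp add: fps_eq_iff)
qed

end

text \<open>Split h into its constant coefficient and X times the shifted series: coefficient k + 1
  of E h is then coefficient k of E at the shifted series.\<close>

lemma fps_hom_id:
  fixes E :: "'a::comm_ring_1 fps \<Rightarrow> 'a fps"
  assumes add: "\<And>f h. E (f + h) = E f + E h" and mult: "\<And>f h. E (f * h) = E f * E h"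
    and const: "\<And>c. E (fps_const c) = fps_const c" and X: "E fps_X = fps_X"
  shows "E h = h"
proof -
  have "E h $ k = h $ k" for k
  proof (induction k arbitrary: h)
    case 0
    have "E h = E (fps_const (h $ 0) + fps_X * fps_shift 1 h)"
      by (rule arg_cong[of _ _ E]) (auto simp: fps_eq_iff fps_X_mult_nth)
    then show ?case by (simp add: add mult const X)
  next
    case (Suc k)
    have "E h = E (fps_const (h $ 0) + fps_X * fps_shift 1 h)"
      by (rule arg_cong[of _ _ E]) (auto simp: fps_eq_iff fps_X_mult_nth)
    then show ?case by (simp add: add mult const X Suc)
  qed
  then show ?thesis by (simp add: fps_eq_iff)
qed

lemma shear_inverse:
  assumes "g $ 0 = 0"
  shows "shear (- g) (shear g h) = h"
proof -
  have "(- g) $ 0 = 0" using assms by simp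
  note 1 = shear_add[OF assms] shear_mult[OF assms] shear_const[OF assms] shear_X[OF assms]
    and 2 = shear_add[OF this] shear_mult[OF this] shear_const[OF this] shear_X[OF this]
  show ?thesis
    by (rule fps_hom_id[of "\<lambda>h. shear (- g) (shear g h)"]) (simp_all add: 1 2 flip: fps_const_neg)
qed

lemma coordinates_shear:
  assumes "g $ 0 = 0"
  shows "coordinates const2 (shear g)"
proof -
  have "shear (- g) \<circ> shear g = id" "shear g \<circ> shear (- g) = id"
    using shear_inverse[of g] shear_inverse[of "- g"] assms by (auto simp: fun_eq_iff)
  then have "bij (shear g)" by (rule o_bij)
  then show ?thesis
    unfolding coordinates_def
    using shear_add[OF assms] shear_mult[OF assms] shear_const[OF assms] shear_const[OF assms, of 1]
    by simp
qed

lemma coordinates_swap: "coordinates const2 fps_swap"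
  unfolding coordinates_def
  using fps_swap_const_const[of 1]
  by (auto simp: bij_fps_swap fps_swap_add fps_swap_mult simp del: fps_swap_const_const)
    (rule fps_swap_const_const)

text \<open>The Weierstrass polynomial of f is y + g(x) with g(0) = 0. The exchange sends x to y,
  and the shear sends y to y + g, a unit multiple of f.\<close>

lemma order_one_change_of_coordinates:
  fixes f :: "complex fps fps"
  assumes reg: "regular_of_order 1 f"
  obtains \<psi> u where "coordinates const2 \<psi>"
    "u dvd 1" "\<psi> (fps_const fps_X) = u * f"
proof -
  obtain W u where W: "weierstrass_polynomial W" "degree W = 1" "u dvd 1" "fps_of_poly W = u * f"
    by (rule weierstrass_preparation[OF reg])
  define g where "g = coeff W 0"
  have g: "g $ 0 = 0" using W by (simp add: weierstrass_polynomial_def g_def)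
  have "coeff W n = coeff [:g, 1:] n" for n
    using W by (auto simp: g_def weierstrass_polynomial_def coeff_pCons coeff_eq_0 split: nat.split)
  then have "W = [:g, 1:]" by (simp add: poly_eq_iff)
  then have fW: "fps_of_poly W = fps_X + fps_const g"
    by (auto simp: fps_eq_iff coeff_pCons split: nat.split)
  show ?thesis
  proof
    show "coordinates const2 (shear g \<circ> fps_swap)"
      using coordinates_comp[OF coordinates_shear[OF g] coordinates_swap] .
    have "fps_swap (fps_const fps_X) = (fps_X :: complex fps fps)"
      using fps_swap_swap[of "fps_X :: complex fps fps"] by simp
    then show "(shear g \<circ> fps_swap) (fps_const fps_X) = u * f"
      using W fW by (simp add: shear_X[OF g])
  qed (fact W)
qed

text \<open>A generator of L has a nonzero linear part, because L is not contained in the squared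
  maximal ideal; so it can serve as the first coordinate up to a unit.\<close>

lemma adapted_coordinates_exist:
  assumes \<iota>: "smooth_surface_germ \<iota>" and L: "smooth_branch L"
  obtains \<phi> where "adapted_coordinates \<iota> L \<phi>"
proof -
  obtain \<phi> where \<phi>: "coordinates \<iota> \<phi>" using \<iota> by (auto simp: smooth_surface_germ_def)
  obtain f where irr: "irreducible f" and Lf: "L = principal_ideal (\<phi> f)"
    using branch_coordinates[OF \<phi>] L by (auto simp: smooth_branch_def)
  have f00: "f $ 0 $ 0 = 0"
    using irr fps_fps_unit_iff[of f] by (auto simp: irreducible_not_unit)
  have "f $ 1 $ 0 \<noteq> 0 \<or> f $ 0 $ 1 \<noteq> 0"
  proof (rule ccontr)
    assume "\<not> ?thesis"
    then have z: "f $ Suc 0 $ 0 = 0" "f $ 0 $ Suc 0 = 0" by auto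
    define X Y where "X = fps_const (fps_X :: complex fps)" and "Y = (fps_X :: complex fps fps)"
    \<comment> \<open>The terms free of y are divisible by x^2, those linear in y by x y, and the
      others by y^2.\<close>
    define a b c where "a = fps_const (fps_shift 2 (f $ 0))"
      and "b = fps_const (fps_shift 1 (f $ 1))" and "c = fps_shift 2 f"
    have "f $ i = (X * (X * a) + X * (Y * b) + Y * (Y * c)) $ i" for i
    proof (cases i)
      case 0
      have "f $ 0 = fps_X * (fps_X * fps_shift 2 (f $ 0))"
        using f00 z by (auto simp: fps_eq_iff fps_X_mult_nth numeral_2_eq_2 gr0_conv_Suc neq0_conv)
          (metis Suc_diff_Suc Suc_lessI diff_zero not_gr0 One_nat_def)
      then show ?thesis using 0 by (simp add: X_def Y_def a_def b_def c_def)
    next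
      case (Suc j)
      have "f $ 1 = fps_X * fps_shift 1 (f $ 1)"
        using z by (auto simp: fps_eq_iff fps_X_mult_nth)
      then show ?thesis
        using Suc by (cases j) (auto simp: X_def Y_def a_def b_def c_def fps_X_mult_nth)
    qed
    then have f: "f = X * (X * a) + X * (Y * b) + Y * (Y * c)" by (simp add: fps_eq_iff)
    define S where "S = {a * b | a b :: 'a. a \<in> maximal_ideal \<and> b \<in> maximal_ideal}"
    have M: "module ((*) :: 'a \<Rightarrow> 'a \<Rightarrow> 'a)"
      by unfold_locales (auto simp: algebra_simps)
    have m: "\<phi> X \<in> maximal_ideal" "\<phi> Y \<in> maximal_ideal"
      by (auto simp: maximal_ideal_def coordinates_unit_iff[OF \<phi>] fps_fps_unit_iff X_def Y_def)
    have prod: "u * v * w \<in> module.span (*) S" if "u \<in> maximal_ideal" "v \<in> maximal_ideal" for u v w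
    proof -
      have "u * v \<in> module.span (*) S" using that by (intro module.span_base[OF M]) (auto simp: S_def)
      from module.span_scale[OF M this, of w] show ?thesis by (simp only: mult.commute[of w])
    qed
    have "\<phi> f = \<phi> X * \<phi> X * \<phi> a + \<phi> X * \<phi> Y * \<phi> b + \<phi> Y * \<phi> Y * \<phi> c"
      unfolding arg_cong[OF f, of \<phi>] by (simp only: coordinates_add[OF \<phi>] coordinates_mult[OF \<phi>] mult.assoc)
    then have "\<phi> f \<in> module.span (*) S"
      using m by (simp only: module.span_add[OF M] prod)
    then have "x * \<phi> f \<in> module.span (*) S" for x by (rule module.span_scale[OF M])
    then have "L \<subseteq> maximal_ideal_squared"
      by (auto simp: Lf principal_ideal_def maximal_ideal_squared_def S_def mult.commute)
    with L show False by (simp add: smooth_branch_def)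
  qed
  then obtain \<psi> u where \<psi>: "coordinates const2 \<psi>"
    and u: "u dvd 1" "\<psi> (fps_const fps_X) = u * f"
  proof
    assume "f $ 1 $ 0 \<noteq> 0"
    with f00 have "regular_of_order 1 f" by (simp add: regular_of_order_def)
    then show ?thesis by (rule order_one_change_of_coordinates) (rule that)
  next
    assume "f $ 0 $ 1 \<noteq> 0"
    with f00 have "regular_of_order 1 (fps_swap f)" by (simp add: regular_of_order_def)
    then obtain \<psi> u where *: "coordinates const2 \<psi>"
      "u dvd 1" "\<psi> (fps_const fps_X) = u * fps_swap f"
      by (rule order_one_change_of_coordinates)
    show ?thesis
    proof (rule that)
      show "coordinates const2 (fps_swap \<circ> \<psi>)"
        by (rule coordinates_comp[OF coordinates_swap *(1)])
      show "fps_swap u dvd 1" using *(2) by (simp add: fps_fps_unit_iff)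
      show "(fps_swap \<circ> \<psi>) (fps_const fps_X) = fps_swap u * f"
        by (simp add: * fps_swap_mult)
    qed
  qed
  have "principal_ideal (\<phi> f) = principal_ideal ((\<phi> \<circ> \<psi>) (fps_const fps_X))"
    using u by (simp add: principal_ideal_eq_iff coordinates_dvd_iff[OF \<phi>] mult_unit_dvd_iff')
  then have "adapted_coordinates \<iota> L (\<phi> \<circ> \<psi>)"
    using coordinates_comp[OF \<phi> \<psi>] Lf by (simp add: adapted_coordinates_def)
  then show ?thesis by (rule that)
qed

section \<open>The Newton-Puiseux theorem\<close>

text \<open>One predicate covers the base change \<open>ramify\<close>, the rotations, the constant
  coefficient and the embeddings of scalars.\<close>

definition ring_map :: "('a::comm_ring_1 \<Rightarrow> 'b::comm_ring_1) \<Rightarrow> bool" where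
  "ring_map h \<longleftrightarrow> h 1 = 1 \<and> (\<forall>a b. h (a + b) = h a + h b) \<and> (\<forall>a b. h (a * b) = h a * h b)"

context
  fixes h :: "'a::comm_ring_1 \<Rightarrow> 'b::comm_ring_1"
  assumes h: "ring_map h"
begin

lemma ring_map_1: "h 1 = 1"
  and ring_map_add: "h (a + b) = h a + h b"
  and ring_map_mult: "h (a * b) = h a * h b"
  using h by (auto simp: ring_map_def)

lemma ring_map_0: "h 0 = 0"
  using ring_map_add[of 0 0] by simp

lemma ring_map_uminus: "h (- a) = - h a"
  using ring_map_add[of a "- a"] by (simp add: ring_map_0 add_eq_0_iff)

lemma ring_map_sum: "h (sum f A) = (\<Sum>x\<in>A. h (f x))"
  by (induction A rule: infinite_finite_induct) (auto simp: ring_map_0 ring_map_add)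

lemma ring_map_prod: "h (prod f A) = (\<Prod>x\<in>A. h (f x))"
  by (induction A rule: infinite_finite_induct) (auto simp: ring_map_1 ring_map_mult)

lemma ring_map_power: "h (a ^ n) = h a ^ n"
  by (induction n) (auto simp: ring_map_1 ring_map_mult)

lemma ring_map_poly: "ring_map (map_poly h)"
  unfolding ring_map_def
proof (intro conjI allI)
  show "map_poly h 1 = 1" by (simp add: ring_map_1)
  show "map_poly h (p + q) = map_poly h p + map_poly h q" for p q
    by (rule poly_eqI) (simp add: coeff_map_poly ring_map_0 ring_map_add)
  show "map_poly h (p * q) = map_poly h p * map_poly h q" for p q
    by (rule poly_eqI) (simp add: coeff_map_poly coeff_mult ring_map_0 ring_map_mult ring_map_sum)
qed

lemma ring_map_linear: "map_poly h [:a, b:] = [:h a, h b:]"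
  by (simp add: map_poly_pCons ring_map_0)

lemma poly_ring_map: "poly (map_poly h p) (h a) = h (poly p a)"
  by (induction p) (simp_all add: map_poly_pCons ring_map_0 ring_map_add ring_map_mult)

end

context
  fixes h :: "'a::comm_ring_1 \<Rightarrow> 'b::comm_ring_1"
  assumes h: "ring_map h"
begin

lemmas map_poly_ring_map =
  ring_map_0[OF ring_map_poly[OF h]] ring_map_1[OF ring_map_poly[OF h]]
  ring_map_add[OF ring_map_poly[OF h]] ring_map_mult[OF ring_map_poly[OF h]]
  ring_map_prod[OF ring_map_poly[OF h]] ring_map_power[OF ring_map_poly[OF h]]

lemma pcompose_ring_map: "map_poly h (pcompose p q) = pcompose (map_poly h p) (map_poly h q)"
  by (induction p)
    (simp_all add: map_poly_pCons pcompose_pCons ring_map_0[OF h] map_poly_ring_map)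

lemma monic_ring_map:
  assumes "lead_coeff p = 1"
  shows "degree (map_poly h p) = degree p" "lead_coeff (map_poly h p) = 1"
proof -
  show "degree (map_poly h p) = degree p"
    by (rule map_poly_degree_eq) (simp add: assms ring_map_1[OF h])
  then show "lead_coeff (map_poly h p) = 1"
    by (simp add: coeff_map_poly ring_map_0[OF h] assms ring_map_1[OF h])
qed

end

lemma ring_map_nth_0: "ring_map (\<lambda>c :: 'a::comm_ring_1 fps. c $ 0)"
  by (simp add: ring_map_def)

section \<open>Ramified base change x = t^n and rotations t -> z t\<close>

definition ramify :: "nat \<Rightarrow> complex fps \<Rightarrow> complex fps" where
  "ramify n c = c oo fps_X ^ n"

text \<open>For z^n = 1 these are automorphisms of C[[t]] over C[[x]], x = t^n; they conjugate the
  Newton-Puiseux roots.\<close>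

definition rotate_fps :: "complex \<Rightarrow> complex fps \<Rightarrow> complex fps" where
  "rotate_fps z c = c oo (fps_const z * fps_X)"

lemma rotate_fps_nth [simp]: "rotate_fps z c $ k = z ^ k * c $ k"
  by (simp add: rotate_fps_def)

lemma ramify_nth:
  assumes "0 < n"
  shows "ramify n c $ k = (if n dvd k then c $ (k div n) else 0)"
proof -
  have "ramify n c $ k = (\<Sum>i=0..k. if k = n * i then c $ i else 0)"
    by (simp add: ramify_def fps_compose_nth flip: power_mult cong: if_cong)
      (intro sum.cong; simp)
  also have "\<dots> = (if n dvd k then c $ (k div n) else 0)"
  proof (cases "n dvd k")
    case True
    then have "(\<Sum>i=0..k. if k = n * i then c $ i else 0) = (\<Sum>i=0..k. if i = k div n then c $ i else 0)"
      using assms by (intro sum.cong) (auto elim!: dvdE)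
    then show ?thesis using True by (simp add: sum.delta)
  next
    case False
    then show ?thesis by (intro trans[OF sum.neutral]) auto
  qed
  finally show ?thesis .
qed

lemma ring_map_ramify:
  assumes "0 < n"
  shows "ring_map (ramify n)"
  unfolding ring_map_def ramify_def using assms
  by (simp add: fps_compose_add_distrib fps_compose_mult_distrib)

lemma ring_map_rotate: "ring_map (rotate_fps z)"
  unfolding ring_map_def rotate_fps_def
  by (simp add: fps_compose_add_distrib fps_compose_mult_distrib)

lemma ramify_ramify:
  assumes "0 < m" "0 < n"
  shows "ramify m (ramify n c) = ramify (n * m) c"
proof (rule fps_ext)
  fix k
  show "ramify m (ramify n c) $ k = ramify (n * m) c $ k"
  proof (cases "m dvd k")
    case True
    then obtain j where "k = m * j" by (rule dvdE)
    then show ?thesis using assms by (simp add: ramify_nth mult.commute)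
  next
    case False
    then have "\<not> n * m dvd k" using dvd_mult_right by blast
    with False show ?thesis using assms by (simp add: ramify_nth)
  qed
qed

lemma map_poly_ramify_ramify:
  assumes "0 < m" "0 < n"
  shows "map_poly (ramify m) (map_poly (ramify n) p) = map_poly (ramify (n * m)) p"
  using assms
  by (subst map_poly_map_poly) (auto simp: ring_map_0 ring_map_ramify ramify_ramify intro!: map_poly_cong)

lemma rotate_rotate: "rotate_fps w (rotate_fps z c) = rotate_fps (w * z) c"
  by (simp add: fps_eq_iff power_mult_distrib mult_ac)

lemma rotate_ramify:
  assumes "0 < n" "z ^ n = 1"
  shows "rotate_fps z (ramify n c) = ramify n c"
  using assms by (auto simp: fps_eq_iff ramify_nth power_mult elim!: dvdE)

lemma ramify_1 [simp]: "ramify (Suc 0) c = c"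
  by (simp add: ramify_def)

lemma ramify_eq_iff: "0 < n \<Longrightarrow> ramify n a = ramify n b \<longleftrightarrow> a = b"
proof
  assume "0 < n" "ramify n a = ramify n b"
  then have "a $ k = b $ k" for k
    using ramify_nth[of n a "n * k"] ramify_nth[of n b "n * k"] by simp
  then show "a = b" by (simp add: fps_eq_iff)
qed simp

lemma ramify_const [simp]: "ramify n (fps_const c) = fps_const c"
  by (simp add: ramify_def)

lemma ramify_X_power: "0 < n \<Longrightarrow> ramify n (fps_X ^ k) = fps_X ^ (n * k)"
  unfolding ramify_def by (simp add: fps_X_power_compose power_mult)

lemma subdegree_ramify: "0 < n \<Longrightarrow> subdegree (ramify n c) = n * subdegree c"
  by (simp add: ramify_def fps_X_power_subdegree)

lemma subdegree_rotate: "z \<noteq> 0 \<Longrightarrow> subdegree (rotate_fps z c) = subdegree c"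
  by (simp add: rotate_fps_def)

section \<open>Newton's algorithm: existence of one Puiseux root\<close>

lemma coeff_pcompose: "coeff (pcompose p q) k = (\<Sum>i\<le>degree p. coeff p i * coeff (q ^ i) k)"
  for p q :: "'a::comm_ring_1 poly"
proof -
  have "degree (map_poly (\<lambda>x. [:x:]) p) = degree p"
    by (rule degree_map_poly) simp
  then show ?thesis
    unfolding pcompose_altdef poly_altdef by (simp add: coeff_sum coeff_map_poly)
qed

lemma monic_pcompose_linear:
  fixes p :: "'a::idom poly"
  assumes "lead_coeff p = 1"
  shows "degree (pcompose p [:a, 1:]) = degree p" "lead_coeff (pcompose p [:a, 1:]) = 1"
  using assms lead_coeff_comp[of "[:a, 1:]" p] by (simp_all add: degree_pcompose)

text \<open>Only the powers m and m + 1 of y - e reach degree m, and their contributions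
  \<open>coeff p m\<close> and -(m + 1) e cancel. The vanishing coefficient later excludes a
  reduction (y - c)^(m+1) with c \<noteq> 0.\<close>

lemma tschirnhaus:
  fixes p :: "'a::idom poly"
  assumes p: "lead_coeff p = 1" "degree p = Suc m" and e: "of_nat (Suc m) * e = coeff p m"
  shows "coeff (pcompose p [:- e, 1:]) m = 0"
proof -
  have "coeff ([:- e, 1:] ^ i) m = 0" if "i < m" for i
    using that by (intro coeff_eq_0) (simp add: degree_linear_power)
  then have "(\<Sum>i<m. coeff p i * coeff ([:- e, 1:] ^ i) m) = 0"
    by (intro sum.neutral) auto
  moreover have "coeff ([:- e, 1:] ^ m) m = 1" by (rule coeff_linear_power)
  moreover have "coeff ([:- e, 1:] ^ Suc m) m = - (of_nat (Suc m) * e)"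
    by (subst coeff_linear_poly_power) (simp_all del: power_Suc add: binomial_Suc_n)
  ultimately show ?thesis
    using p e by (simp add: coeff_pcompose sum.atMost_Suc flip: lessThan_Suc_atMost del: power_Suc)
qed

lemma poly_eq_monom_iff:
  fixes p :: "'a::comm_ring_1 poly"
  assumes "lead_coeff p = 1" "degree p = n"
  shows "p = monom 1 n \<longleftrightarrow> (\<forall>j<n. coeff p j = 0)"
proof
  assume *: "\<forall>j<n. coeff p j = 0"
  show "p = monom 1 n"
  proof (rule poly_eqI)
    fix i show "coeff p i = coeff (monom 1 n) i"
      using * assms by (cases i n rule: linorder_cases) (auto simp: coeff_eq_0)
  qed
qed auto

text \<open>Substituting \<open>x = t\<^sup>v\<close>, \<open>y = t\<^sup>e z\<close>, where \<open>e / v\<close> is the least slope of the Newton polygon.\<close>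

lemma newton_slope:
  fixes p :: "complex fps poly"
  assumes p: "lead_coeff p = 1" "degree p = n" and c: "coeff p m = 0" and nm: "p \<noteq> monom 1 n"
  obtains v q where "0 < v" "lead_coeff q = 1" "degree q = n" "m \<noteq> n \<Longrightarrow> coeff q m = 0"
    "map_poly (\<lambda>c. c $ 0) q \<noteq> monom 1 n"
    "\<And>M s. 0 < M \<Longrightarrow> poly (map_poly (ramify M) q) s = 0 \<Longrightarrow> \<exists>s'. poly (map_poly (ramify (v * M)) p) s' = 0"
proof -
  define S where "S = {j. j < n \<and> coeff p j \<noteq> 0}"
  have "S \<noteq> {}" using poly_eq_monom_iff[OF p] nm by (auto simp: S_def)
  have "finite S" by (simp add: S_def)
  define slope where "slope = (\<lambda>j. real (subdegree (coeff p j)) / real (n - j))"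
  define j0 where "j0 = arg_min_on slope S"
  have j0: "j0 \<in> S" "\<And>j. j \<in> S \<Longrightarrow> slope j0 \<le> slope j"
    using arg_min_if_finite[OF \<open>finite S\<close> \<open>S \<noteq> {}\<close>, of slope] unfolding j0_def
    by (auto simp: not_less)
  define e v where "e = subdegree (coeff p j0)" and "v = n - j0"
  have v: "0 < v" using j0 by (simp add: v_def S_def)
  have slope: "e * (n - j) \<le> v * subdegree (coeff p j)" if "j \<in> S" for j
  proof -
    have "real e / real v \<le> real (subdegree (coeff p j)) / real (n - j)"
      using j0(2)[OF that] by (simp add: slope_def e_def v_def)
    then have "real (e * (n - j)) \<le> real (v * subdegree (coeff p j))"
      using v that by (simp add: S_def field_simps)
    then show ?thesis by linarith
  qed
  \<comment> \<open>\<open>b j\<close> is the j-th coefficient of p at x = t^v divided by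
    t^(e(n-j)). Minimality of the slope makes this division exact, and with y = t^e z the polynomial
    p becomes t^(en) q(z).\<close>
  define b where "b = (\<lambda>j. fps_shift (e * (n - j)) (ramify v (coeff p j)))"
  have b: "ramify v (coeff p j) = b j * fps_X ^ (e * (n - j))" if "j \<le> n" for j
  proof (cases "j \<in> S")
    case True
    then show ?thesis
      unfolding b_def using slope v by (intro fps_shift_times_fps_X_power[symmetric]) (simp add: subdegree_ramify)
  next
    case False
    then have "j = n \<or> coeff p j = 0" using that by (auto simp: S_def)
    then show ?thesis by (auto simp: b_def ring_map_0[OF ring_map_ramify[OF v]])
  qed
  define q where "q = (\<Sum>j\<le>n. monom (b j) j)"
  have cq: "coeff q j = (if j \<le> n then b j else 0)" for j
    by (auto simp: q_def coeff_sum_monom) (auto simp: coeff_sum)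
  have bn: "b n = 1" using b[of n] p by (simp add: ring_map_1[OF ring_map_ramify[OF v]])
  have dq: "degree q = n"
    by (rule antisym) (auto intro!: degree_le le_degree simp: cq bn)
  \<comment> \<open>At \<open>j0\<close> the shift e(n - j0) = v e is exactly the order of the
    ramified coefficient; the constant term that survives keeps the reduction of q from being a pure
    power.\<close>
  have bj0: "b j0 $ 0 \<noteq> 0"
    using j0(1) v unfolding b_def S_def by (simp add: ramify_nth e_def v_def)
  show ?thesis
  proof
    show "0 < v" by (fact v)
    show "lead_coeff q = 1" "degree q = n" using dq cq bn by auto
    show "coeff q m = 0" if "m \<noteq> n"
      using that by (simp add: cq b_def c ring_map_0[OF ring_map_ramify[OF v]])
    show "map_poly (\<lambda>c. c $ 0) q \<noteq> monom 1 n"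
    proof
      assume "map_poly (\<lambda>c. c $ 0) q = monom 1 n"
      then have "coeff (map_poly (\<lambda>c. c $ 0) q) j0 = coeff (monom 1 n) j0" by simp
      then show False using j0(1) bj0 by (auto simp: coeff_map_poly cq S_def)
    qed
    fix M s assume M: "0 < M" and s: "poly (map_poly (ramify M) q) s = 0"
    note hM = ring_map_ramify[OF M] and hvM = ring_map_ramify[of "v * M"]
    define s' where "s' = fps_X ^ (M * e) * s"
    have summand: "ramify (v * M) (coeff p j) * s' ^ j = fps_X ^ (M * e * n) * (ramify M (b j) * s ^ j)"
      if "j \<le> n" for j
    proof -
      have "ramify (v * M) (coeff p j) = ramify M (b j) * fps_X ^ (M * (e * (n - j)))"
        using M v b[OF that]
        by (simp add: ramify_ramify[symmetric] ring_map_mult[OF hM] ramify_X_power)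
      then have "ramify (v * M) (coeff p j) * s' ^ j =
          fps_X ^ (M * (e * (n - j)) + M * e * j) * (ramify M (b j) * s ^ j)"
        by (simp add: s'_def power_mult_distrib power_add flip: power_mult)
      also have "M * (e * (n - j)) + M * e * j = M * e * n"
        using that by (simp add: diff_mult_distrib2 mult.assoc)
      finally show ?thesis .
    qed
    have "poly (map_poly (ramify (v * M)) p) s' = (\<Sum>j\<le>n. ramify (v * M) (coeff p j) * s' ^ j)"
      using monic_ring_map[OF hvM p(1)] M v p
      by (simp add: poly_altdef coeff_map_poly ring_map_0[OF hvM])
    also have "\<dots> = fps_X ^ (M * e * n) * (\<Sum>j\<le>n. ramify M (b j) * s ^ j)"
      unfolding sum_distrib_left by (intro sum.cong refl summand) simp
    also have "(\<Sum>j\<le>n. ramify M (b j) * s ^ j) = poly (map_poly (ramify M) q) s"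
      using monic_ring_map[OF hM, of q] dq cq bn
      by (simp add: poly_altdef coeff_map_poly ring_map_0[OF hM])
    finally show "\<exists>s'. poly (map_poly (ramify (v * M)) p) s' = 0" using s by auto
  qed
qed

text \<open>A root of multiplicity m + 1 gives p = (y - c)^(m+1), whose coefficient of y^m is -(m +
  1) c; its vanishing forces c = 0, the excluded monomial.\<close>

lemma order_monic_less:
  fixes p :: "complex poly"
  assumes p: "lead_coeff p = 1" "degree p = Suc m" and c: "coeff p m = 0" and nm: "p \<noteq> monom 1 (Suc m)"
  shows "order c p < Suc m"
proof (rule ccontr)
  assume *: "\<not> order c p < Suc m"
  have p0: "p \<noteq> 0" using p by auto
  have "order c p = Suc m" using * order_degree[OF p0, of c] p by simp
  then obtain r where r: "p = [:- c, 1:] ^ Suc m * r"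
    using order_decomp[OF p0, of c] by auto
  then have "r \<noteq> 0" using p0 by auto
  then have "degree p = Suc m + degree r"
    unfolding r by (subst degree_mult_eq) (simp_all add: degree_linear_power del: power_Suc)
  moreover have "lead_coeff p = lead_coeff ([:- c, 1:] ^ Suc m) * lead_coeff r"
    unfolding r by (rule lead_coeff_mult)
  then have "lead_coeff p = lead_coeff r"
    by (simp add: lead_coeff_power del: power_Suc)
  ultimately have "degree p = Suc m + degree r" "lead_coeff p = lead_coeff r" by simp_all
  then have "r = 1"
    using p by (metis add_cancel_left_right degree_eq_zeroE lead_coeff_pCons(2) one_pCons)
  then have pc: "p = [:- c, 1:] ^ Suc m" using r by simp
  have "coeff p m = of_nat (Suc m) * (- c)"
    unfolding pc by (subst coeff_linear_poly_power) (simp_all del: power_Suc add: binomial_Suc_n)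
  then have "c = 0" using c by (simp del: of_nat_Suc)
  then show False using nm pc by (simp add: monom_altdef del: power_Suc)
qed

text \<open>Translating c to 0 turns its multiplicity as a root of the reduction into the y-order at
  x = 0, so that preparation can split off the factor belonging to c.\<close>

lemma regular_pcompose:
  fixes q :: "complex fps poly"
  assumes q: "lead_coeff q = 1"
  shows "regular_of_order (order c (map_poly (\<lambda>c. c $ 0) q)) (fps_of_poly (pcompose q [:fps_const c, 1:]))"
proof -
  define q0 where "q0 = map_poly (\<lambda>c. c $ 0) q"
  have q0: "q0 \<noteq> 0" using monic_ring_map(2)[OF ring_map_nth_0 q] by (auto simp: q0_def)
  define d where "d = order c q0"
  obtain r where r: "q0 = [:- c, 1:] ^ d * r" "\<not> [:- c, 1:] dvd r"
    using order_decomp[OF q0, of c] by (auto simp: d_def)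
  have "map_poly (\<lambda>c. c $ 0) (pcompose q [:fps_const c, 1:]) = pcompose q0 [:c, 1:]"
    unfolding pcompose_ring_map[OF ring_map_nth_0] q0_def
    by (simp add: ring_map_linear[OF ring_map_nth_0])
  also have "\<dots> = monom 1 d * pcompose r [:c, 1:]"
  proof -
    have "pcompose [:- c, 1:] [:c, 1:] = [:0, 1:]" by (simp add: pcompose_pCons)
    then have "pcompose ([:- c, 1:] ^ d) [:c, 1:] = [:0, 1:] ^ d"
      by (induction d) (simp_all only: pcompose_mult pcompose_1 power_0 power_Suc)
    then show ?thesis by (simp add: r pcompose_mult monom_altdef)
  qed
  finally have "coeff (pcompose q [:fps_const c, 1:]) i $ 0 = coeff (monom 1 d * pcompose r [:c, 1:]) i" for i
    by (metis (no_types, lifting) coeff_map_poly fps_zero_nth)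
  moreover have "poly r c \<noteq> 0" using r(2) by (simp add: poly_eq_0_iff_dvd)
  ultimately show ?thesis
    by (simp add: regular_of_order_def coeff_monom_mult pcompose_coeff_0 flip: q0_def d_def)
qed

text \<open>Induction on the degree: after translation and one Newton step, the reduction has a root
  of multiplicity below the degree, and preparation there yields a monic factor of that smaller
  degree.\<close>

lemma puiseux_root_exists:
  fixes p :: "complex fps poly"
  assumes "lead_coeff p = 1" "0 < degree p"
  shows "\<exists>N s. 0 < N \<and> poly (map_poly (ramify N) p) s = 0"
  using assms
proof (induction "degree p" arbitrary: p rule: less_induct)
  case less
  obtain m where m: "degree p = Suc m" using less.prems by (auto dest: gr0_implies_Suc)
  define e where "e = fps_const (inverse (of_nat (Suc m))) * coeff p m"
  define p1 where "p1 = pcompose p [:- e, 1:]"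
  have "of_nat (Suc m) * e = fps_const (of_nat (Suc m) * inverse (of_nat (Suc m))) * coeff p m"
    unfolding e_def fps_const_mult[symmetric] by (simp only: fps_of_nat mult.assoc)
  then have "of_nat (Suc m) * e = coeff p m" by (simp del: of_nat_Suc)
  from tschirnhaus[OF less.prems(1) m this] have c1: "coeff p1 m = 0" by (simp add: p1_def)
  have p1: "lead_coeff p1 = 1" "degree p1 = Suc m"
    using monic_pcompose_linear[OF less.prems(1)] m by (simp_all add: p1_def)
  have "\<exists>N s. 0 < N \<and> poly (map_poly (ramify N) p1) s = 0"
  proof (cases "p1 = monom 1 (Suc m)")
    case True
    then have "poly (map_poly (ramify 1) p1) 0 = 0"
      by (simp add: map_poly_monom poly_monom)
    then show ?thesis by (metis zero_less_one)
  next
    case False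
    obtain v q where v: "0 < v" and q: "lead_coeff q = 1" "degree q = Suc m" "coeff q m = 0"
      "map_poly (\<lambda>c. c $ 0) q \<noteq> monom 1 (Suc m)"
      and lift: "\<And>M s. 0 < M \<Longrightarrow> poly (map_poly (ramify M) q) s = 0 \<Longrightarrow>
        \<exists>s'. poly (map_poly (ramify (v * M)) p1) s' = 0"
      using newton_slope[OF p1 c1 False] by (metis n_not_Suc_n)
    define q0 where "q0 = map_poly (\<lambda>c. c $ 0) q"
    have q0: "lead_coeff q0 = 1" "degree q0 = Suc m"
      unfolding q0_def using monic_ring_map[OF ring_map_nth_0 q(1)] q(2) by auto
    have "\<not> constant (poly q0)" using q0 by (simp add: constant_degree)
    then obtain c where c: "poly q0 c = 0" using fundamental_theorem_of_algebra by blast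
    have "coeff q0 m = 0" using q(3) by (simp add: q0_def coeff_map_poly)
    then have d: "order c q0 < Suc m" using order_monic_less[OF q0] q(4) by (simp add: q0_def)
    have d0: "order c q0 \<noteq> 0" using c q0 by (auto simp: order_root)
    define q1 where "q1 = pcompose q [:fps_const c, 1:]"
    have "regular_of_order (order c q0) (fps_of_poly q1)"
      unfolding q0_def q1_def by (rule regular_pcompose[OF q(1)])
    then obtain W u where W: "weierstrass_polynomial W" "degree W = order c q0" "u dvd 1"
      "fps_of_poly W = u * fps_of_poly q1"
      by (rule weierstrass_preparation)
    then have "W dvd q1" by (intro weierstrass_dvd_poly) (auto simp: mult_unit_dvd_iff')
    then obtain k where k: "q1 = W * k" by (rule dvdE)
    obtain N s where N: "0 < N" and s: "poly (map_poly (ramify N) W) s = 0"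
      using less.hyps[of W] W d d0 m by (auto simp: weierstrass_polynomial_def)
    note h = ring_map_ramify[OF N]
    have "poly (map_poly (ramify N) q1) s = 0"
      using s by (simp add: k map_poly_ring_map[OF h])
    then have "poly (map_poly (ramify N) q) (fps_const c + s) = 0"
      by (simp add: q1_def pcompose_ring_map[OF h] ring_map_linear[OF h] ring_map_1[OF h] poly_pcompose)
    then show ?thesis using lift[OF N] v N by (metis nat_0_less_mult_iff)
  qed
  then obtain N s where N: "0 < N" and s: "poly (map_poly (ramify N) p1) s = 0" by blast
  note h = ring_map_ramify[OF N]
  have "poly (map_poly (ramify N) p) (ramify N (- e) + s) = 0"
    using s by (simp add: p1_def pcompose_ring_map[OF h] ring_map_linear[OF h] ring_map_1[OF h] poly_pcompose)
  with N show ?case by blast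
qed

section \<open>Descent from C[[t]] to C[[x]] and the conjugates of a root\<close>

definition ramify_component :: "nat \<Rightarrow> nat \<Rightarrow> complex fps \<Rightarrow> complex fps" where
  "ramify_component n i c = Abs_fps (\<lambda>k. c $ (n * k + i))"

lemma ramify_component_nth [simp]: "ramify_component n i c $ k = c $ (n * k + i)"
  by (simp add: ramify_component_def)

lemma ramify_component_0 [simp]: "ramify_component n i 0 = 0"
  by (simp add: fps_eq_iff)

lemma ramify_component_add: "ramify_component n i (a + b) = ramify_component n i a + ramify_component n i b"
  by (simp add: fps_eq_iff)

lemma ramify_component_sum: "ramify_component n i (sum f A) = (\<Sum>x\<in>A. ramify_component n i (f x))"
  by (simp add: fps_eq_iff fps_sum_nth)

text \<open>C[[t]] is free over C[[x]], x = t^n, with basis 1, t, ..., t^(n-1), and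
  \<open>ramify_component n i\<close> is the i-th coordinate. It is linear because only multiples of
  n occur as exponents in \<open>ramify n a\<close>.\<close>

lemma ramify_component_mult:
  assumes "i < n"
  shows "ramify_component n i (ramify n a * b) = a * ramify_component n i b"
proof (rule fps_ext)
  fix k
  have inj: "inj_on (\<lambda>j. n * j) {0..k}" using assms by (auto simp: inj_on_def)
  have sub: "(\<lambda>j. n * j) ` {0..k} \<subseteq> {0..n * k + i}" by (auto simp: trans_le_add1)
  have "ramify_component n i (ramify n a * b) $ k = (\<Sum>l=0..n * k + i. ramify n a $ l * b $ (n * k + i - l))"
    by (simp add: fps_mult_nth)
  also have "\<dots> = (\<Sum>l\<in>(\<lambda>j. n * j) ` {0..k}. ramify n a $ l * b $ (n * k + i - l))"
  proof (rule sum.mono_neutral_right[OF _ sub], safe)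
    fix l assume l: "l \<in> {0..n * k + i}" "l \<notin> (\<lambda>j. n * j) ` {0..k}"
    have "\<not> n dvd l"
    proof
      assume "n dvd l"
      then obtain j where j: "l = n * j" by (rule dvdE)
      with l(1) assms have "n * j < n * Suc k" by simp
      then have "j \<le> k" using assms by (simp only: mult_less_cancel1) simp
      then have "l \<in> (\<lambda>j. n * j) ` {0..k}" using j by (intro image_eqI[of _ _ j]) auto
      with l(2) show False by blast
    qed
    then show "ramify n a $ l * b $ (n * k + i - l) = 0" using assms by (simp add: ramify_nth)
  qed
  also have "\<dots> = (\<Sum>j=0..k. a $ j * b $ (n * (k - j) + i))"
    unfolding sum.reindex[OF inj] using assms
    by (intro sum.cong) (auto simp: ramify_nth diff_mult_distrib2)
  also have "\<dots> = (a * ramify_component n i b) $ k"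
    by (simp add: fps_mult_nth)
  finally show "ramify_component n i (ramify n a * b) $ k = (a * ramify_component n i b) $ k" .
qed

lemma map_poly_ramify_component_mult:
  assumes "i < n"
  shows "map_poly (ramify_component n i) (map_poly (ramify n) p * q) = p * map_poly (ramify_component n i) q"
proof -
  have "ramify n 0 = 0" using assms by (simp add: ring_map_0[OF ring_map_ramify])
  then show ?thesis
    by (intro poly_eqI)
      (simp add: coeff_map_poly coeff_mult ramify_component_sum ramify_component_mult[OF assms])
qed

lemma map_poly_ramify_component_ramify:
  assumes "0 < n"
  shows "map_poly (ramify_component n 0) (map_poly (ramify n) p) = p"
  using map_poly_ramify_component_mult[OF assms, of p 1] assms
  by (simp add: map_poly_1 ramify_component_def one_pCons) (simp add: fps_eq_iff flip: one_pCons)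

text \<open>The 0-th coordinate retracts C[[t]] linearly onto C[[x]], so it carries a cofactor over
  C[[t]] to one over C[[x]].\<close>

lemma map_poly_ramify_dvd_iff:
  assumes "0 < n"
  shows "map_poly (ramify n) p dvd map_poly (ramify n) q \<longleftrightarrow> p dvd q"
proof
  assume "map_poly (ramify n) p dvd map_poly (ramify n) q"
  then obtain k where "map_poly (ramify n) q = map_poly (ramify n) p * k" by (rule dvdE)
  then have "q = p * map_poly (ramify_component n 0) k"
    using map_poly_ramify_component_mult[OF assms] map_poly_ramify_component_ramify[OF assms] by metis
  then show "p dvd q" by simp
next
  assume "p dvd q"
  then show "map_poly (ramify n) p dvd map_poly (ramify n) q"
    using map_poly_ring_map(4)[OF ring_map_ramify[OF assms]] by (auto elim!: dvdE)
qed

lemma prod_linear_dvd: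
  fixes p :: "'a::idom poly"
  assumes "finite R" "\<And>r. r \<in> R \<Longrightarrow> poly p r = 0"
  shows "(\<Prod>r\<in>R. [:- r, 1:]) dvd p"
  using assms
proof (induction R rule: finite_induct)
  case (insert r R)
  then obtain k where k: "p = (\<Prod>r\<in>R. [:- r, 1:]) * k" by (metis dvdE insert_iff)
  have "poly (\<Prod>r\<in>R. [:- r, 1:]) r \<noteq> 0"
    using insert by (auto simp: poly_prod)
  then have "poly k r = 0" using insert.prems[of r] by (simp add: k)
  then obtain l where "k = [:- r, 1:] * l" by (metis poly_eq_0_iff_dvd dvdE)
  then have "p = (\<Prod>r\<in>insert r R. [:- r, 1:]) * l"
    using insert by (simp add: k mult_ac del: mult_pCons_left mult_pCons_right)
  then show ?case by (rule dvdI)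
qed simp

abbreviation unity_roots :: "nat \<Rightarrow> complex set" where
  "unity_roots n \<equiv> {z. z ^ n = 1}"

text \<open>Indexing by the roots of unity rather than by the set of conjugates counts repeated
  conjugates, so for n > 0 the degree is n whatever s is.\<close>

definition conjugates_poly :: "nat \<Rightarrow> complex fps \<Rightarrow> complex fps poly" where
  "conjugates_poly n s = (\<Prod>z\<in>unity_roots n. [:- rotate_fps z s, 1:])"

lemma finite_unity_roots: "0 < n \<Longrightarrow> finite (unity_roots n)"
  by (rule finite_roots_unity) simp

lemma card_unity_roots: "0 < n \<Longrightarrow> card (unity_roots n) = n"
  by (rule card_complex_roots_unity) simp

lemma degree_conjugates_poly: "0 < n \<Longrightarrow> degree (conjugates_poly n s) = n"
  unfolding conjugates_poly_def by (subst degree_prod_eq_sum_degree) (simp_all add: card_unity_roots)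

lemma lead_coeff_conjugates_poly: "lead_coeff (conjugates_poly n s) = 1"
  unfolding conjugates_poly_def by (subst lead_coeff_prod) simp

lemma unity_root_dvd:
  assumes n: "0 < n" and k: "\<And>z. z ^ n = 1 \<Longrightarrow> z ^ k = (1::complex)"
  shows "n dvd k"
proof -
  define z where "z = exp (2 * of_real pi * \<i> / of_nat n)"
  have z: "z ^ j = 1 \<longleftrightarrow> n dvd j" for j
  proof -
    have "z ^ j = exp (2 * of_real pi * \<i> * of_nat j / of_nat n)"
      by (simp add: z_def exp_of_nat_mult[symmetric] mult_ac)
    then show ?thesis using complex_root_unity_eq_1[of n j] n by simp
  qed
  then show ?thesis using k[of z] by simp
qed

text \<open>If k is not a multiple of n, some n-th root of unity has z^k \<noteq> 1, and invariance
  under its rotation kills the coefficient of t^k.\<close>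

lemma rotate_invariant_ramify:
  assumes n: "0 < n" and c: "\<And>z. z ^ n = 1 \<Longrightarrow> rotate_fps z c = c"
  shows "ramify n (ramify_component n 0 c) = c"
proof (rule fps_ext)
  fix k
  show "ramify n (ramify_component n 0 c) $ k = c $ k"
  proof (cases "n dvd k")
    case True
    then show ?thesis using n by (auto simp: ramify_nth elim!: dvdE)
  next
    case False
    then obtain z where z: "z ^ n = 1" "z ^ k \<noteq> (1::complex)" using unity_root_dvd[OF n] by blast
    have "z ^ k * c $ k = c $ k" using arg_cong[OF c[OF z(1)], of "\<lambda>c. c $ k"] by simp
    then have "(z ^ k - 1) * c $ k = 0" by (simp add: algebra_simps)
    then have "c $ k = 0" using z(2) by simp
    then show ?thesis using False n by (simp add: ramify_nth)
  qed
qed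

text \<open>A rotation by w permutes the factors through z -> w z, so every coefficient is invariant
  and comes from C[[x]].\<close>

lemma conjugates_poly_descends:
  assumes n: "0 < n"
  shows "map_poly (ramify n) (map_poly (ramify_component n 0) (conjugates_poly n s)) = conjugates_poly n s"
proof -
  have inv: "map_poly (rotate_fps w) (conjugates_poly n s) = conjugates_poly n s" if w: "w ^ n = 1" for w
  proof -
    note h = ring_map_rotate[of w]
    have w0: "w \<noteq> 0" using w n by (auto simp: power_0_left)
    have "map_poly (rotate_fps w) (conjugates_poly n s) = (\<Prod>z\<in>unity_roots n. [:- rotate_fps (w * z) s, 1:])"
      by (simp add: conjugates_poly_def map_poly_ring_map[OF h] ring_map_linear[OF h]
          ring_map_1[OF h] ring_map_uminus[OF h] rotate_rotate)
    also have "\<dots> = conjugates_poly n s"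
      unfolding conjugates_poly_def
      by (rule prod.reindex_bij_witness[of _ "\<lambda>z. z / w" "\<lambda>z. w * z"])
        (use w w0 in \<open>auto simp: power_mult_distrib power_divide\<close>)
    finally show ?thesis .
  qed
  have rot0: "rotate_fps w 0 = 0" for w by (simp add: fps_eq_iff)
  have ram0: "ramify n 0 = 0" by (rule ring_map_0[OF ring_map_ramify[OF n]])
  show ?thesis
  proof (rule poly_eqI)
    fix i
    have "rotate_fps w (coeff (conjugates_poly n s) i) = coeff (conjugates_poly n s) i" if "w ^ n = 1" for w
      using inv[OF that] by (metis coeff_map_poly rot0)
    then show "coeff (map_poly (ramify n) (map_poly (ramify_component n 0) (conjugates_poly n s))) i =
        coeff (conjugates_poly n s) i"
      by (simp add: coeff_map_poly ram0 rotate_invariant_ramify[OF n])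
  qed
qed

text \<open>Two equal conjugates would make \<open>s\<close> a series in \<open>t\<^sup>m\<close> for some \<open>m > 1\<close> dividing \<open>N\<close>, so that
  the conjugates are distinct once \<open>N\<close> is minimal.\<close>

lemma conjugates_distinct:
  fixes p :: "complex fps poly"
  assumes N: "0 < N" and root: "poly (map_poly (ramify N) p) s = 0"
    and min: "\<And>M s. 0 < M \<Longrightarrow> M < N \<Longrightarrow> poly (map_poly (ramify M) p) s \<noteq> 0"
  shows "inj_on (\<lambda>z. rotate_fps z s) (unity_roots N)"
proof (rule inj_onI, rule ccontr)
  fix z w assume z: "z \<in> unity_roots N" and w: "w \<in> unity_roots N" 
    and eq: "rotate_fps z s = rotate_fps w s" and "z \<noteq> w"
  define v where "v = z / w"
  have w0: "w \<noteq> 0" using w N by (auto simp: power_0_left)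
  have v: "v ^ N = 1" "v \<noteq> 1"
    using z w w0 \<open>z \<noteq> w\<close> by (auto simp: v_def power_divide)
  have vk: "v ^ k = 1" if "s $ k \<noteq> 0" for k
  proof -
    have "z ^ k * s $ k = w ^ k * s $ k" using arg_cong[OF eq, of "\<lambda>c. c $ k"] by simp
    then show ?thesis using that w0 by (simp add: v_def power_divide)
  qed
  define m where "m = (LEAST m. 0 < m \<and> v ^ m = 1)"
  have m: "0 < m" "v ^ m = 1"
    using LeastI[of "\<lambda>m. 0 < m \<and> v ^ m = 1" N] N v by (auto simp: m_def)
  have mdvd: "m dvd k" if "v ^ k = 1" for k
  proof -
    have "v ^ k = (v ^ m) ^ (k div m) * v ^ (k mod m)"
      by (simp flip: power_mult power_add)
    then have "v ^ (k mod m) = 1" using that m by simp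
    moreover have "k mod m < m" using m by simp
    ultimately show ?thesis
      using not_less_Least[of "k mod m" "\<lambda>m. 0 < m \<and> v ^ m = 1"] by (auto simp: m_def)
  qed
  have "m \<noteq> 1" using m v by auto
  define s' where "s' = ramify_component m 0 s"
  have s: "s = ramify m s'"
    using vk mdvd m by (auto simp: fps_eq_iff ramify_nth s'_def)
  obtain M where M: "N = m * M" using mdvd[OF v(1)] by (rule dvdE)
  then have M': "0 < M" "M < N" using N m \<open>m \<noteq> 1\<close> by auto
  have "ramify m (poly (map_poly (ramify M) p) s') = ramify m 0"
    using root poly_ring_map[OF ring_map_ramify[OF m(1)], of "map_poly (ramify M) p" s'] M' m
    by (simp add: s M map_poly_ramify_ramify mult.commute ring_map_0[OF ring_map_ramify])
  then have "poly (map_poly (ramify M) p) s' = 0" using ramify_eq_iff[OF m(1)] by simp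
  with min[OF M'] show False by blast
qed

text \<open>The coefficients of the ramified polynomial are series in t^n, fixed by the rotations,
  so every conjugate of s is a root; as the conjugates are distinct, their linear factors divide
  jointly.\<close>

lemma conjugates_poly_dvd:
  assumes n: "0 < n" and inj: "inj_on (\<lambda>z. rotate_fps z s) (unity_roots n)"
    and root: "poly (map_poly (ramify n) g) s = 0"
  shows "conjugates_poly n s dvd map_poly (ramify n) g"
proof -
  have "(\<Prod>r\<in>(\<lambda>z. rotate_fps z s) ` unity_roots n. [:- r, 1:]) dvd map_poly (ramify n) g"
  proof (rule prod_linear_dvd)
    fix r assume "r \<in> (\<lambda>z. rotate_fps z s) ` unity_roots n"
    then obtain z where z: "z ^ n = 1" "r = rotate_fps z s" by auto
    have "map_poly (rotate_fps z) (map_poly (ramify n) g) = map_poly (ramify n) g"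
      by (rule poly_eqI)
        (simp add: coeff_map_poly ring_map_0[OF ring_map_ramify[OF n]]
          ring_map_0[OF ring_map_rotate] rotate_ramify[OF n z(1)])
    then have "poly (map_poly (ramify n) g) r = rotate_fps z (poly (map_poly (ramify n) g) s)"
      using poly_ring_map[OF ring_map_rotate, of z "map_poly (ramify n) g" s] z by simp
    then show "poly (map_poly (ramify n) g) r = 0" by (simp add: root ring_map_0[OF ring_map_rotate])
  qed (simp add: finite_unity_roots n)
  then show ?thesis unfolding conjugates_poly_def prod.reindex[OF inj] by simp
qed

lemma monic_unit_eq_1:
  fixes p :: "'a::idom poly"
  assumes "lead_coeff p = 1" "p dvd 1"
  shows "p = 1"
proof -
  obtain q where q: "1 = p * q" using assms(2) by (rule dvdE)
  then have "p \<noteq> 0" "q \<noteq> 0" by auto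
  then have "degree p + degree q = 0" using q degree_mult_eq[of p q] by (metis degree_1)
  then obtain c where "p = [:c:]" by (metis add_is_0 degree_eq_zeroE)
  with assms show ?thesis by (simp add: one_pCons)
qed

text \<open>A root with least ramification N has N distinct conjugates. Their product descends to a
  factor of p, which irreducibility makes all of p; so N is the degree.\<close>

theorem newton_puiseux:
  fixes p :: "complex fps poly"
  assumes irr: "irreducible p" and monic: "lead_coeff p = 1"
  obtains s where "0 < degree p" "inj_on (\<lambda>z. rotate_fps z s) (unity_roots (degree p))"
    "map_poly (ramify (degree p)) p = conjugates_poly (degree p) s"
proof -
  have "degree p \<noteq> 0"
  proof
    assume "degree p = 0"
    then obtain c where "p = [:c:]" by (rule degree_eq_zeroE)
    with monic have "p = 1" by (simp add: one_pCons)
    with irr show False by simp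
  qed
  then have deg: "0 < degree p" by simp
  define P where "P = (\<lambda>N. 0 < N \<and> (\<exists>s. poly (map_poly (ramify N) p) s = 0))"
  define N where "N = (LEAST N. P N)"
  have "\<exists>N. P N" using puiseux_root_exists[OF monic deg] by (auto simp: P_def)
  then have "P N" unfolding N_def by (rule LeastI_ex)
  then obtain s where N: "0 < N" and s: "poly (map_poly (ramify N) p) s = 0" by (auto simp: P_def)
  have "poly (map_poly (ramify M) p) s \<noteq> 0" if "0 < M" "M < N" for M s
    using not_less_Least[of M P] that by (auto simp: N_def P_def)
  from conjugates_distinct[OF N s this] have inj: "inj_on (\<lambda>z. rotate_fps z s) (unity_roots N)" .
  define q where "q = map_poly (ramify_component N 0) (conjugates_poly N s)"
  have q: "map_poly (ramify N) q = conjugates_poly N s"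
    unfolding q_def by (rule conjugates_poly_descends[OF N])
  have "q dvd p"
    using conjugates_poly_dvd[OF N inj s] unfolding q[symmetric] map_poly_ramify_dvd_iff[OF N] .
  then obtain k where k: "p = q * k" by (rule dvdE)
  have rc: "ramify_component N 0 1 = 1" using N by (simp add: fps_eq_iff)
  have lq: "degree q = N" "lead_coeff q = 1"
  proof -
    show "degree q = N"
      unfolding q_def using lead_coeff_conjugates_poly[of N s] rc
      by (subst map_poly_degree_eq) (simp_all add: degree_conjugates_poly N)
    then show "lead_coeff q = 1"
      using lead_coeff_conjugates_poly[of N s] rc
      by (simp add: q_def coeff_map_poly degree_conjugates_poly N)
  qed
  have "\<not> q dvd 1" using monic_unit_eq_1[OF lq(2)] lq(1) N by auto
  then have "k dvd 1" using irreducibleD[OF irr k] by blast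
  moreover have "lead_coeff k = 1" using monic lq k by (simp add: lead_coeff_mult)
  ultimately have "k = 1" by (intro monic_unit_eq_1)
  then have "p = q" using k by simp
  then show ?thesis using that[of s] deg inj q lq by simp
qed

section \<open>Codimension of ideals\<close>

text \<open>The space \<open>\<complex>\<^sup>n\<close> is modelled as the space of power series without terms of degree \<open>n\<close> or more,
  so that a map witnesses that \<open>I\<close> has codimension \<open>n\<close> if it induces an isomorphism of the quotient
  with \<open>\<complex>\<^sup>n\<close>.\<close>

definition codim_map :: "(complex \<Rightarrow> 'r::comm_ring_1) \<Rightarrow> 'r set \<Rightarrow> nat \<Rightarrow> ('r \<Rightarrow> complex fps) \<Rightarrow> bool" where
  "codim_map \<iota> I n \<pi> \<longleftrightarrow>
     (\<forall>f g. \<pi> (f + g) = \<pi> f + \<pi> g) \<and> (\<forall>c f. \<pi> (\<iota> c * f) = fps_const c * \<pi> f) \<and>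
     (\<forall>f. f \<in> I \<longleftrightarrow> \<pi> f = 0) \<and> range \<pi> = {v. \<forall>i\<ge>n. v $ i = 0}"

definition has_codim :: "(complex \<Rightarrow> 'r::comm_ring_1) \<Rightarrow> 'r set \<Rightarrow> nat \<Rightarrow> bool" where
  "has_codim \<iota> I n \<longleftrightarrow> (\<exists>\<pi>. codim_map \<iota> I n \<pi>)"

lemma codim_mapI:
  fixes \<iota> :: "complex \<Rightarrow> 'r::comm_ring_1" and \<pi> :: "'r \<Rightarrow> complex fps"
  assumes "\<And>f g. \<pi> (f + g) = \<pi> f + \<pi> g" "\<And>c f. \<pi> (\<iota> c * f) = fps_const c * \<pi> f"
    "\<And>f. f \<in> I \<Longrightarrow> \<pi> f = 0" "\<And>f. \<pi> f = 0 \<Longrightarrow> f \<in> I"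
    "\<And>f i. n \<le> i \<Longrightarrow> \<pi> f $ i = 0" "\<And>v. (\<And>i. n \<le> i \<Longrightarrow> v $ i = 0) \<Longrightarrow> \<exists>f. \<pi> f = v"
  shows "codim_map \<iota> I n \<pi>"
  unfolding codim_map_def
proof (intro conjI allI set_eqI iffI)
  fix v :: "complex fps" assume "v \<in> {v. \<forall>i\<ge>n. v $ i = 0}"
  then show "v \<in> range \<pi>" using assms(6)[of v] by auto
qed (use assms in auto)

context
  fixes \<iota> :: "complex \<Rightarrow> 'r::comm_ring_1" and I n \<pi>
  assumes \<pi>: "codim_map \<iota> I n \<pi>"
begin

lemma codim_map_add: "\<pi> (f + g) = \<pi> f + \<pi> g"
  and codim_map_scale: "\<pi> (\<iota> c * f) = fps_const c * \<pi> f"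
  and codim_map_kernel: "f \<in> I \<longleftrightarrow> \<pi> f = 0"
  using \<pi> by (auto simp: codim_map_def)

lemma codim_map_nth: "n \<le> i \<Longrightarrow> \<pi> f $ i = 0"
  using \<pi> rangeI[of \<pi> f] by (auto simp: codim_map_def)

lemma codim_map_surj:
  assumes "\<And>i. n \<le> i \<Longrightarrow> v $ i = 0"
  obtains f where "\<pi> f = v"
proof -
  have "v \<in> range \<pi>" using \<pi> assms by (auto simp: codim_map_def)
  then show ?thesis using that by auto
qed

lemma codim_map_0: "\<pi> 0 = 0"
  using codim_map_add[of 0 0] by simp

lemma codim_map_diff: "\<pi> (f - g) = \<pi> f - \<pi> g"
  using codim_map_add[of "f - g" g] by simp

lemma codim_map_sum: "\<pi> (sum f A) = (\<Sum>x\<in>A. \<pi> (f x))"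
  by (induction A rule: infinite_finite_induct) (auto simp: codim_map_0 codim_map_add)

lemma codim_map_combination: "\<pi> (\<Sum>b\<in>B. \<iota> (c b) * b) = (\<Sum>b\<in>B. fps_const (c b) * \<pi> b)"
  by (simp add: codim_map_sum codim_map_scale)

text \<open>Preimages of 1, X, ..., X^(n-1) form a basis: the coefficients of f are those of
  \<open>\<pi> f\<close>.\<close>

lemma quotient_basis_exists: "\<exists>B. quotient_basis \<iota> I B \<and> card B = n"
proof -
  have "\<exists>f. \<pi> f = fps_X ^ i" if "i < n" for i
    using codim_map_surj[of "fps_X ^ i"] that by auto
  then obtain e where e: "\<And>i. i < n \<Longrightarrow> \<pi> (e i) = fps_X ^ i" by metis
  have inj: "inj_on e {..<n}"
    by (rule inj_onI) (metis e fps_X_power_subdegree lessThan_iff)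
  define B where "B = e ` {..<n}"
  have eq: "f - (\<Sum>b\<in>B. \<iota> (c b) * b) \<in> I \<longleftrightarrow> (\<forall>i<n. c (e i) = \<pi> f $ i)" for f c
  proof -
    have "(\<Sum>b\<in>B. fps_const (c b) * \<pi> b) $ i = (if i < n then c (e i) else 0)" for i
    proof -
      have "(\<Sum>b\<in>B. fps_const (c b) * \<pi> b) = (\<Sum>j<n. fps_const (c (e j)) * fps_X ^ j)"
        unfolding B_def sum.reindex[OF inj] by (simp add: e)
      then show ?thesis by (simp add: fps_sum_nth if_distrib cong: if_cong)
    qed
    then show ?thesis
      unfolding codim_map_kernel codim_map_diff codim_map_combination
      using codim_map_nth[of _ f] by (auto simp: fps_eq_iff not_less)
  qed
  have "\<exists>!c. c \<in> B \<rightarrow>\<^sub>E UNIV \<and> f - (\<Sum>b\<in>B. \<iota> (c b) * b) \<in> I" for f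
  proof (rule ex1I)
    define c where "c = restrict (\<lambda>b. \<pi> f $ (the_inv_into {..<n} e b)) B"
    have "c (e i) = \<pi> f $ i" if "i < n" for i
      using that inj by (simp add: c_def B_def the_inv_into_f_f)
    then show "c \<in> B \<rightarrow>\<^sub>E UNIV \<and> f - (\<Sum>b\<in>B. \<iota> (c b) * b) \<in> I"
      unfolding eq by (simp add: c_def)
    fix c' assume c': "c' \<in> B \<rightarrow>\<^sub>E UNIV \<and> f - (\<Sum>b\<in>B. \<iota> (c' b) * b) \<in> I"
    show "c' = c"
    proof
      fix b show "c' b = c b"
      proof (cases "b \<in> B")
        case True
        then obtain i where "i < n" "b = e i" by (auto simp: B_def)
        then show ?thesis using c' \<open>\<And>i. i < n \<Longrightarrow> c (e i) = \<pi> f $ i\<close> by (simp add: eq)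
      next
        case False
        then show ?thesis using c' by (simp add: c_def PiE_def extensional_def)
      qed
    qed
  qed
  then have "quotient_basis \<iota> I B" by (simp add: quotient_basis_def B_def)
  then show ?thesis using inj by (intro exI[of _ B]) (simp add: B_def card_image)
qed

text \<open>The images of any basis form a basis of the range of \<pi>, so its size is a dimension
  that does not depend on \<open>B\<close>; this makes the number in \<open>quotient_dim\<close>
  unique.\<close>

lemma card_quotient_basis:
  assumes \<iota>: "ring_map \<iota>" and B: "quotient_basis \<iota> I B"
  shows "card B = vector_space.dim (\<lambda>c v. fps_const c * v) (range \<pi>)"
proof -
  interpret V: vector_space "\<lambda>c (v :: complex fps). fps_const c * v"
    by unfold_locales (simp_all add: algebra_simps flip: fps_const_add fps_const_mult)
  have fin: "finite B" and ex1: "\<And>f. \<exists>!c. c \<in> B \<rightarrow>\<^sub>E UNIV \<and> f - (\<Sum>b\<in>B. \<iota> (c b) * b) \<in> I"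
    using B by (auto simp: quotient_basis_def)
  have unique: "\<forall>b\<in>B. c b = c' b"
    if "\<pi> f = (\<Sum>b\<in>B. fps_const (c b) * \<pi> b)" "\<pi> f = (\<Sum>b\<in>B. fps_const (c' b) * \<pi> b)" for f c c'
  proof -
    \<comment> \<open>Coefficient functions in \<open>quotient_basis\<close> are extensional, hence
      the restriction to \<open>B\<close>.\<close>
    have "f - (\<Sum>b\<in>B. \<iota> (restrict c B b) * b) \<in> I" "f - (\<Sum>b\<in>B. \<iota> (restrict c' B b) * b) \<in> I"
      using that by (simp_all add: codim_map_kernel codim_map_diff codim_map_combination)
    moreover have "restrict c B \<in> B \<rightarrow>\<^sub>E UNIV" "restrict c' B \<in> B \<rightarrow>\<^sub>E UNIV" by simp_all
    ultimately have "restrict c B = restrict c' B" using ex1[of f] by blast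
    then show ?thesis by (metis restrict_apply')
  qed
  \<comment> \<open>A basis element is represented by its indicator function; two elements with the
    same image would give one class two representations, so \<pi> is injective on
    \<open>B\<close>.\<close>
  have delta: "\<pi> b = (\<Sum>a\<in>B. fps_const (if a = b then 1 else 0) * \<pi> a)" if "b \<in> B" for b
  proof -
    have "(\<Sum>a\<in>B. fps_const (if a = b then 1 else 0) * \<pi> a) = (\<Sum>a\<in>B. if a = b then \<pi> a else 0)"
      by (intro sum.cong) auto
    then show ?thesis using that fin by simp
  qed
  have inj: "inj_on \<pi> B"
  proof (rule inj_onI)
    fix a b assume ab: "a \<in> B" "b \<in> B" "\<pi> a = \<pi> b"
    have "\<forall>x\<in>B. (if x = a then 1 else 0 :: complex) = (if x = b then 1 else 0)"
      using delta[OF ab(1)] delta[OF ab(2)] ab(3) by (intro unique[of a]) simp_all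
    then show "a = b" using ab(1) by (metis zero_neq_one)
  qed
  have "V.independent (\<pi> ` B)"
  proof -
    have "u v = 0" if "(\<Sum>v\<in>\<pi> ` B. fps_const (u v) * v) = 0" "v \<in> \<pi> ` B" for u v
    proof -
      have "(\<Sum>b\<in>B. fps_const (u (\<pi> b)) * \<pi> b) = 0"
        using that(1) by (simp add: sum.reindex[OF inj])
      then have "\<forall>b\<in>B. u (\<pi> b) = 0"
        by (intro unique[of 0]) (simp_all add: codim_map_0)
      with that(2) show ?thesis by auto
    qed
    then show ?thesis using fin by (subst V.dependent_finite) auto
  qed
  moreover have "V.span (\<pi> ` B) = V.span (range \<pi>)"
  proof (rule antisym[OF V.span_mono])
    have "\<pi> f \<in> V.span (\<pi> ` B)" for f
    proof -
      obtain c where "f - (\<Sum>b\<in>B. \<iota> (c b) * b) \<in> I" using ex1[of f] by auto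
      then have "\<pi> f = (\<Sum>b\<in>B. fps_const (c b) * \<pi> b)"
        by (simp add: codim_map_kernel codim_map_diff codim_map_combination)
      then show ?thesis by (simp only:) (intro V.span_sum V.span_scale V.span_base imageI)
    qed
    then show "V.span (range \<pi>) \<subseteq> V.span (\<pi> ` B)" by (intro V.span_minimal) auto
  qed auto
  ultimately have "V.dim (range \<pi>) = card (\<pi> ` B)" by (intro V.dim_eq_card)
  then show ?thesis by (simp add: card_image inj)
qed

lemma quotient_dim_eq:
  assumes "ring_map \<iota>"
  shows "quotient_dim \<iota> I = n"
  unfolding quotient_dim_def
proof (rule the_equality)
  show "\<exists>B. quotient_basis \<iota> I B \<and> card B = n" by (rule quotient_basis_exists)
  then show "m = n" if "\<exists>B. quotient_basis \<iota> I B \<and> card B = m" for m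
    using that card_quotient_basis[OF assms] by metis
qed

end

lemma has_codim_quotient_dim: "ring_map \<iota> \<Longrightarrow> has_codim \<iota> I n \<Longrightarrow> quotient_dim \<iota> I = n"
  unfolding has_codim_def using quotient_dim_eq by blast

text \<open>A surjective coordinate map is rebuilt one coefficient at a time: the top coefficient is
  dropped, and restored as a new coordinate exactly when it does not vanish on the kernel of the
  others.\<close>

lemma has_codim_kernel:
  fixes \<iota> :: "complex \<Rightarrow> 'r::comm_ring_1"
  assumes "\<And>f g. \<pi> (f + g) = \<pi> f + \<pi> g" "\<And>c f. \<pi> (\<iota> c * f) = fps_const c * \<pi> f"
    "\<And>f i. n \<le> i \<Longrightarrow> \<pi> f $ i = 0"
  shows "\<exists>m. has_codim \<iota> {f. \<pi> f = 0} m"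
  using assms
proof (induction n arbitrary: \<pi>)
  case 0
  then have "\<pi> f = 0" for f by (simp add: fps_eq_iff)
  then have "codim_map \<iota> {f. \<pi> f = 0} 0 \<pi>"
    using 0 by (intro codim_mapI) (auto simp: fps_eq_iff)
  then show ?case by (auto simp: has_codim_def)
next
  case (Suc n)
  define \<rho> where "\<rho> f = fps_cutoff n (\<pi> f)" for f
  have "\<exists>m. has_codim \<iota> {f. \<rho> f = 0} m"
  proof (rule Suc.IH)
    show "\<rho> (f + g) = \<rho> f + \<rho> g" for f g by (simp add: \<rho>_def Suc.prems(1) fps_cutoff_add)
    show "\<rho> (\<iota> c * f) = fps_const c * \<rho> f" for c f
      by (simp add: \<rho>_def Suc.prems(2) fps_eq_iff)
  qed (simp add: \<rho>_def)
  then obtain m \<pi>' where \<pi>': "codim_map \<iota> {f. \<rho> f = 0} m \<pi>'" by (auto simp: has_codim_def)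
  have ker: "\<pi> f = 0 \<longleftrightarrow> \<rho> f = 0 \<and> \<pi> f $ n = 0" for f
    using Suc.prems(3)[of _ f]
    by (auto simp: \<rho>_def fps_eq_iff) (metis not_less_eq_eq le_antisym not_le)
  show ?case
  proof (cases "\<forall>f. \<rho> f = 0 \<longrightarrow> \<pi> f $ n = 0")
    case True
    then have "{f. \<rho> f = 0} = {f. \<pi> f = 0}" using ker by blast
    with \<pi>' show ?thesis by (auto simp: has_codim_def)
  next
    case False
    then obtain k where k: "\<rho> k = 0" "\<pi> k $ n \<noteq> 0" by blast
    note ker' = codim_map_kernel[OF \<pi>', unfolded mem_Collect_eq]
    have k': "\<pi>' k = 0" using k(1) ker' by blast
    define \<sigma> where "\<sigma> f = \<pi>' f + fps_const (\<pi> f $ n) * fps_X ^ m" for f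
    have "codim_map \<iota> {f. \<pi> f = 0} (Suc m) \<sigma>"
    proof (rule codim_mapI)
      show "\<sigma> (f + g) = \<sigma> f + \<sigma> g" for f g
        by (simp add: \<sigma>_def codim_map_add[OF \<pi>'] Suc.prems(1) algebra_simps flip: fps_const_add)
      show "\<sigma> (\<iota> c * f) = fps_const c * \<sigma> f" for c f
        unfolding \<sigma>_def codim_map_scale[OF \<pi>'] Suc.prems(2)
        by (simp add: algebra_simps flip: fps_const_mult)
      show "\<sigma> f = 0" if "f \<in> {f. \<pi> f = 0}" for f
        using that ker[of f] ker'[of f] by (simp add: \<sigma>_def)
      show "f \<in> {f. \<pi> f = 0}" if "\<sigma> f = 0" for f
      proof -
        have "\<sigma> f $ m = 0" using that by simp
        then have "\<pi> f $ n = 0" by (simp add: \<sigma>_def codim_map_nth[OF \<pi>'])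
        then show ?thesis using that ker[of f] ker'[of f] by (simp add: \<sigma>_def)
      qed
      show "\<sigma> f $ i = 0" if "Suc m \<le> i" for f i
        using that by (simp add: \<sigma>_def codim_map_nth[OF \<pi>'])
      fix v :: "complex fps" assume v: "\<And>i. Suc m \<le> i \<Longrightarrow> v $ i = 0"
      obtain f where f: "\<pi>' f = fps_cutoff m v"
        using codim_map_surj[OF \<pi>', of "fps_cutoff m v"] by auto
      \<comment> \<open>Adding a multiple of k, which lies in the kernel of \<open>\<rho>\<close>,
        changes only the new coordinate; this multiple gives it the prescribed value.\<close>
      define a where "a = (v $ m - \<pi> f $ n) / \<pi> k $ n"
      have "\<sigma> (f + \<iota> a * k) = fps_cutoff m v + fps_const (v $ m) * fps_X ^ m"
        using k by (simp add: \<sigma>_def codim_map_add[OF \<pi>'] codim_map_scale[OF \<pi>'] f k' Suc.prems a_def)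
      also have "\<dots> = v"
        using v by (auto simp: fps_eq_iff not_less)
      finally show "\<exists>f. \<sigma> f = v" by blast
    qed
    then show ?thesis by (auto simp: has_codim_def)
  qed
qed

section \<open>Dimension of C[[x]][y] modulo two polynomials\<close>

abbreviation poly_const :: "complex \<Rightarrow> complex fps poly" where
  "poly_const \<equiv> \<lambda>c. [:fps_const c:]"

definition ideal2 :: "'r::comm_ring_1 \<Rightarrow> 'r \<Rightarrow> 'r set" where
  "ideal2 g h = {a * g + b * h | a b. True}"

lemma low_order_part_unique:
  fixes u :: "complex fps"
  assumes "u \<noteq> 0" "c + q * u = c' + q' * u"
    "\<And>i. subdegree u \<le> i \<Longrightarrow> c $ i = 0" "\<And>i. subdegree u \<le> i \<Longrightarrow> c' $ i = 0"
  shows "c = c'" "q = q'"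
proof -
  have eq: "(q - q') * u = c' - c" using assms(2) by algebra
  have "((q - q') * u) $ i = 0" for i
  proof (cases "subdegree u \<le> i")
    case True
    then show ?thesis unfolding eq by (simp add: assms)
  next
    case False
    then show ?thesis by (intro fps_mult_nth_eq0) auto
  qed
  then have "(q - q') * u = 0" by (simp add: fps_eq_iff)
  then show "q = q'" using assms(1) by simp
  then show "c = c'" using assms(2) by simp
qed

text \<open>An exact sequence: evaluation at y = s maps C[[x]][y] / (g, (y - s) h) onto C[[x]] /
  (g(s)), and multiplication by y - s identifies C[[x]][y] / (g, h) with its kernel. So the
  dimensions add.\<close>

lemma has_codim_linear_factor:
  fixes g h :: "complex fps poly"
  assumes u: "poly g s \<noteq> 0" and h: "has_codim poly_const (ideal2 g h) k"
  shows "has_codim poly_const (ideal2 g ([:- s, 1:] * h)) (subdegree (poly g s) + k)"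
proof -
  obtain \<pi> where \<pi>: "codim_map poly_const (ideal2 g h) k \<pi>"
    using h by (auto simp: has_codim_def)
  define u where "u = poly g s"
  define m where "m = subdegree u"
  define l where "l = [:- s, 1:]"
  have u0: "u \<noteq> 0" using u by (simp add: u_def)
  have pl: "poly l s = 0" by (simp add: l_def)
  have l0: "l \<noteq> 0" by (simp add: l_def)
  \<comment> \<open>The part of p(s) below order m represents its residue modulo g(s). The rest is q
    g(s), so p - c - q g vanishes at s and is divisible by y - s.\<close>
  have "\<exists>c q v. p = [:c:] + [:q:] * g + l * v \<and> (\<forall>i\<ge>m. c $ i = 0)" for p
  proof -
    define c where "c = fps_cutoff m (poly p s)"
    have "u dvd poly p s - c"
      unfolding c_def by (rule fps_dvd_diff_cutoff) (simp_all add: m_def u0)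
    then obtain q where "poly p s - c = u * q" by (rule dvdE)
    then have "poly (p - [:c:] - [:q:] * g) s = 0" by (simp add: u_def algebra_simps)
    then have "l dvd p - [:c:] - [:q:] * g" unfolding l_def by (simp only: poly_eq_0_iff_dvd)
    then obtain v where "p - [:c:] - [:q:] * g = l * v" by (rule dvdE)
    then have "p = [:c:] + [:q:] * g + l * v" by algebra
    moreover have "\<forall>i\<ge>m. c $ i = 0" by (simp add: c_def)
    ultimately show ?thesis by blast
  qed
  then obtain c q v where cqv: "\<And>p. p = [:c p:] + [:q p:] * g + l * v p"
    and c: "\<And>p i. m \<le> i \<Longrightarrow> c p $ i = 0" by metis
  have unique: "c p = c'" "v p = v'"
    if eq: "p = [:c':] + [:q':] * g + l * v'" and low: "\<And>i. m \<le> i \<Longrightarrow> c' $ i = 0" for p c' q' v'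
  proof -
    have "poly p s = c p + q p * u"
      by (subst cqv[of p]) (simp add: pl u_def)
    moreover have "poly p s = c' + q' * u"
      by (subst eq) (simp add: pl u_def)
    ultimately have "c p + q p * u = c' + q' * u" by simp
    from low_order_part_unique[OF u0 this] have 1: "c p = c'" "q p = q'"
      using c low by (auto simp: m_def)
    then show "c p = c'" by simp
    have "l * v p = l * v'" using cqv[of p] eq 1 by (metis add_left_cancel)
    then show "v p = v'" using l0 by simp
  qed
  have add: "c (p + p') = c p + c p'" "v (p + p') = v p + v p'" for p p'
  proof -
    have "p + p' = [:c p + c p':] + [:q p + q p':] * g + l * (v p + v p')"
    proof -
      have "[:c p + c p':] = [:c p:] + [:c p':]" "[:q p + q p':] = [:q p:] + [:q p':]" by simp_all
      then show ?thesis using cqv[of p] cqv[of p'] by algebra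
    qed
    from unique[OF this] show "c (p + p') = c p + c p'" "v (p + p') = v p + v p'"
      by (simp_all add: c)
  qed
  have scale: "c ([:fps_const a:] * p) = fps_const a * c p" "v ([:fps_const a:] * p) = [:fps_const a:] * v p" for a p
  proof -
    have "[:fps_const a:] * p = [:fps_const a * c p:] + [:fps_const a * q p:] * g + l * ([:fps_const a:] * v p)"
    proof -
      have "[:fps_const a * c p:] = [:fps_const a:] * [:c p:]" "[:fps_const a * q p:] = [:fps_const a:] * [:q p:]"
        by simp_all
      then show ?thesis using cqv[of p] by algebra
    qed
    from unique[OF this] show "c ([:fps_const a:] * p) = fps_const a * c p"
      "v ([:fps_const a:] * p) = [:fps_const a:] * v p"
      by (simp_all add: c)
  qed
  \<comment> \<open>The first m places record the residue modulo g(s), the next k places the class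
    of \<open>v p\<close> modulo (g, h).\<close>
  define \<sigma> where "\<sigma> p = c p + fps_X ^ m * \<pi> (v p)" for p
  have "codim_map poly_const (ideal2 g (l * h)) (m + k) \<sigma>"
  proof (rule codim_mapI)
    show "\<sigma> (p + p') = \<sigma> p + \<sigma> p'" for p p'
      unfolding \<sigma>_def add codim_map_add[OF \<pi>] by (simp add: algebra_simps)
    show "\<sigma> ([:fps_const a:] * p) = fps_const a * \<sigma> p" for a p
      unfolding \<sigma>_def scale codim_map_scale[OF \<pi>] by (simp add: algebra_simps)
  next
    fix p assume "p \<in> ideal2 g (l * h)"
    then obtain a b where p: "p = a * g + b * (l * h)" by (auto simp: ideal2_def)
    define a' where "a' = synthetic_div a s"
    have z: "[:0 :: complex fps:] = 0" by simp
    have a: "a = l * a' + [:poly a s:]"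
      using synthetic_div_correct'[of s a] by (simp add: a'_def l_def)
    have "p = [:0:] + [:poly a s:] * g + l * (a' * g + b * h)"
      unfolding p z using a by algebra
    from unique[OF this] have "c p = 0" "v p = a' * g + b * h" by simp_all
    then show "\<sigma> p = 0"
      using codim_map_kernel[OF \<pi>, of "a' * g + b * h"] by (auto simp: \<sigma>_def ideal2_def)
  next
    fix p assume \<sigma>: "\<sigma> p = 0"
    have "c p $ i = 0" for i
    proof (cases "m \<le> i")
      case False
      then have "\<sigma> p $ i = c p $ i" by (simp add: \<sigma>_def fps_X_power_mult_nth)
      then show ?thesis using \<sigma> by simp
    qed (rule c)
    then have c0: "c p = 0" by (simp add: fps_eq_iff)
    then have z: "[:c p:] = 0" by simp
    have "\<pi> (v p) = 0" using c0 \<sigma> by (simp add: \<sigma>_def)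
    then have "v p \<in> ideal2 g h" using codim_map_kernel[OF \<pi>] by blast
    then obtain a b where "v p = a * g + b * h" by (auto simp: ideal2_def)
    then have "p = ([:q p:] + l * a) * g + b * (l * h)"
      using cqv[of p] z by algebra
    then show "p \<in> ideal2 g (l * h)" by (auto simp: ideal2_def)
  next
    show "\<sigma> p $ i = 0" if "m + k \<le> i" for p i
      using that by (simp add: \<sigma>_def c fps_X_power_mult_nth codim_map_nth[OF \<pi>])
  next
    fix w :: "complex fps" assume w: "\<And>i. m + k \<le> i \<Longrightarrow> w $ i = 0"
    obtain v' where v': "\<pi> v' = fps_shift m w"
      using codim_map_surj[OF \<pi>, of "fps_shift m w"] w by auto
    define p where "p = [:fps_cutoff m w:] + [:0:] * g + l * v'"
    from unique[OF p_def] have "c p = fps_cutoff m w" "v p = v'" by simp_all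
    then have "\<sigma> p = w" by (auto simp: \<sigma>_def v' fps_eq_iff fps_X_power_mult_nth)
    then show "\<exists>p. \<sigma> p = w" by blast
  qed
  then show ?thesis by (auto simp: has_codim_def l_def m_def u_def simp del: mult_pCons_left)
qed

lemma has_codim_linear_factors:
  fixes g :: "complex fps poly"
  assumes "finite Z" "\<And>z. z \<in> Z \<Longrightarrow> poly g (r z) \<noteq> 0"
  shows "has_codim poly_const (ideal2 g (\<Prod>z\<in>Z. [:- r z, 1:])) (\<Sum>z\<in>Z. subdegree (poly g (r z)))"
  using assms
proof (induction Z rule: finite_induct)
  case empty
  have "p \<in> ideal2 g 1" for p
    unfolding ideal2_def by (rule CollectI, rule exI[of _ 0], rule exI[of _ p]) simp
  then have "codim_map poly_const (ideal2 g 1) 0 (\<lambda>_. 0)"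
    by (intro codim_mapI) (auto simp: fps_eq_iff)
  then show ?case by (auto simp: has_codim_def)
next
  case (insert z Z)
  then show ?case
    using has_codim_linear_factor[of g "r z"] by (simp del: mult_pCons_left)
qed

lemma ring_map_poly_const: "ring_map poly_const"
  by (auto simp: ring_map_def simp flip: fps_const_add fps_const_mult)

text \<open>C[[t]][y] is free over C[[x]][y] on 1, t, ..., t^(n-1), and the extended ideal consists
  of the elements all of whose coordinates lie in (g, h). So the quotient upstairs is n copies of
  the quotient downstairs.\<close>

lemma has_codim_ramify:
  fixes g h :: "complex fps poly"
  assumes n: "0 < n" and M: "has_codim poly_const (ideal2 (map_poly (ramify n) g) (map_poly (ramify n) h)) M"
  shows "\<exists>k. M = n * k \<and> has_codim poly_const (ideal2 g h) k"
proof -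
  define R where "R = map_poly (ramify n)"
  define C where "C i = map_poly (ramify_component n i)" for i
  define J where "J = ideal2 (R g) (R h)"
  define I where "I = ideal2 g h"
  note hR = map_poly_ring_map[OF ring_map_ramify[OF n], folded R_def]
  have CR: "C 0 (R p) = p" for p
    using map_poly_ramify_component_ramify[OF n] by (simp add: C_def R_def)
  have CRm: "C i (R p * q) = p * C i q" if "i < n" for i p q
    using map_poly_ramify_component_mult[OF that] by (simp add: C_def R_def)
  have Cadd: "C i (p + q) = C i p + C i q" for i p q
    by (rule poly_eqI) (simp add: C_def coeff_map_poly ramify_component_add)
  have C0: "C i 0 = 0" for i by (simp add: C_def)
  have Csum: "C i (sum f A) = (\<Sum>x\<in>A. C i (f x))" for i A and f :: "nat \<Rightarrow> _"
    by (induction A rule: infinite_finite_induct) (simp_all add: Cadd C0)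
  have CJ: "C i p \<in> I" if i: "i < n" and p: "p \<in> J" for i p
  proof -
    obtain a b where "p = a * R g + b * R h" using p by (auto simp: J_def ideal2_def)
    then have "p = R g * a + R h * b" by (simp add: mult.commute)
    then have "C i p = g * C i a + h * C i b" by (simp only: Cadd CRm[OF i])
    then show ?thesis
      unfolding I_def ideal2_def
      by (intro CollectI exI[of _ "C i a"] exI[of _ "C i b"]) (simp add: mult.commute)
  qed
  have RI: "q * R p \<in> J" if p: "p \<in> I" for p q
  proof -
    obtain a b where "p = a * g + b * h" using p by (auto simp: I_def ideal2_def)
    then have "q * R p = (q * R a) * R g + (q * R b) * R h" by (simp add: hR algebra_simps)
    then show ?thesis by (auto simp: J_def ideal2_def)
  qed
  obtain \<pi> where \<pi>: "codim_map poly_const J M \<pi>"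
    using M by (auto simp: has_codim_def J_def R_def)
  have const: "R [:fps_const c:] = [:fps_const c:]" for c
    by (simp add: R_def map_poly_pCons ring_map_0[OF ring_map_ramify[OF n]])
  \<comment> \<open>Finiteness downstairs: (g, h) is the preimage of the extended ideal, hence the
    kernel of \<pi> after the inclusion \<open>R\<close>.\<close>
  have "\<exists>k. has_codim poly_const {p. \<pi> (R p) = 0} k"
    by (rule has_codim_kernel[of _ _ M])
      (simp_all only: hR const codim_map_add[OF \<pi>] codim_map_scale[OF \<pi>] codim_map_nth[OF \<pi>])
  moreover have "{p. \<pi> (R p) = 0} = I"
    using CJ[OF n] RI[of _ 1] unfolding codim_map_kernel[OF \<pi>, symmetric] by (auto simp: CR) (metis CR)
  ultimately obtain k \<rho> where k: "has_codim poly_const I k"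
    and \<rho>: "codim_map poly_const I k \<rho>" by (auto simp: has_codim_def)
  have CX: "C i [:fps_X ^ j:] = (if i = j then 1 else 0)" if "i < n" "j < n" for i j
  proof -
    have "ramify_component n i (fps_X ^ j) = (if i = j then 1 else 0)"
    proof (rule fps_ext)
      fix k
      have "n * k + i = j \<longleftrightarrow> k = 0 \<and> i = j" using that by (cases k) auto
      then show "ramify_component n i (fps_X ^ j) $ k = (if i = j then 1 else 0) $ k" by auto
    qed
    then show ?thesis by (simp add: C_def map_poly_pCons one_pCons)
  qed
  have decomp: "p = (\<Sum>i<n. [:fps_X ^ i:] * R (C i p))" for p
  proof (rule poly_eqI, rule fps_ext)
    fix j l
    have "coeff (\<Sum>i<n. [:fps_X ^ i:] * R (C i p)) j $ l =
        (\<Sum>i<n. if i = l mod n then coeff p j $ l else 0)"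
    proof -
      have "(fps_X ^ i * ramify n (ramify_component n i (coeff p j))) $ l =
          (if i = l mod n then coeff p j $ l else 0)" if i: "i < n" for i
      proof (cases "i = l mod n")
        case True
        then have "n dvd l - i" "i \<le> l" "n * ((l - i) div n) + i = l"
          by (auto simp: dvd_minus_mod)
        moreover have "\<not> l < l mod n" by (simp add: not_less)
        ultimately show ?thesis using True n by (simp add: fps_X_power_mult_nth ramify_nth)
      next
        case False
        then have "\<not> n dvd l - i" if "i \<le> l"
          using i that by (metis mod_eq_iff_dvd_symdiff_nat mod_less mod_eq_dvd_iff_nat)
        then show ?thesis using False n by (auto simp: fps_X_power_mult_nth ramify_nth)
      qed
      then show ?thesis
        by (simp add: coeff_sum fps_sum_nth R_def C_def coeff_map_poly ring_map_0[OF ring_map_ramify[OF n]])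
    qed
    also have "\<dots> = coeff p j $ l" using n by simp
    finally show "coeff p j $ l = coeff (\<Sum>i<n. [:fps_X ^ i:] * R (C i p)) j $ l" by simp
  qed
  \<comment> \<open>The components are interleaved: place n j + i holds entry j of the i-th
    one.\<close>
  define \<sigma> where "\<sigma> p = Abs_fps (\<lambda>l. \<rho> (C (l mod n) p) $ (l div n))" for p
  have \<sigma>_nth: "\<sigma> p $ (n * j + i) = \<rho> (C i p) $ j" if "i < n" for p i j
    using that by (simp add: \<sigma>_def)
  have "codim_map poly_const J (n * k) \<sigma>"
  proof (rule codim_mapI)
    show "\<sigma> (p + q) = \<sigma> p + \<sigma> q" for p q
      by (simp add: fps_eq_iff \<sigma>_def Cadd codim_map_add[OF \<rho>])
    show "\<sigma> ([:fps_const c:] * p) = fps_const c * \<sigma> p" for c p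
    proof -
      have "C i ([:fps_const c:] * p) = [:fps_const c:] * C i p" if "i < n" for i
        using CRm[OF that, of "[:fps_const c:]" p] const by simp
      then show ?thesis
        using n by (simp add: fps_eq_iff \<sigma>_def codim_map_scale[OF \<rho>] del: mult_pCons_left)
    qed
    show "\<sigma> p = 0" if "p \<in> J" for p
      using CJ[OF _ that] n codim_map_kernel[OF \<rho>] by (simp add: fps_eq_iff \<sigma>_def)
    show "p \<in> J" if "\<sigma> p = 0" for p
    proof -
      have "C i p \<in> I" if "i < n" for i
      proof -
        have "\<rho> (C i p) = 0"
          using \<sigma>_nth[OF that, of p] \<open>\<sigma> p = 0\<close> by (simp add: fps_eq_iff)
        then show ?thesis using codim_map_kernel[OF \<rho>] by blast
      qed
      then have "\<pi> (\<Sum>i<n. [:fps_X ^ i:] * R (C i p)) = 0"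
        unfolding codim_map_sum[OF \<pi>]
        using RI codim_map_kernel[OF \<pi>] by (intro sum.neutral) blast
      then show ?thesis using codim_map_kernel[OF \<pi>] decomp[of p] by simp
    qed
    show "\<sigma> p $ l = 0" if "n * k \<le> l" for p l
      using that n by (simp add: \<sigma>_def codim_map_nth[OF \<rho>] less_eq_div_iff_mult_less_eq mult.commute)
    fix v :: "complex fps" assume v: "\<And>l. n * k \<le> l \<Longrightarrow> v $ l = 0"
    have "\<exists>p. \<rho> p = Abs_fps (\<lambda>j. v $ (n * j + i))" for i
      using codim_map_surj[OF \<rho>, of "Abs_fps (\<lambda>j. v $ (n * j + i))"] v
      by (auto simp: trans_le_add1)
    then obtain P where P: "\<And>i. \<rho> (P i) = Abs_fps (\<lambda>j. v $ (n * j + i))" by metis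
    define p where "p = (\<Sum>i<n. R (P i) * [:fps_X ^ i:])"
    have "C i p = P i" if "i < n" for i
    proof -
      have "C i p = (\<Sum>j<n. if j = i then P j else 0)"
        unfolding p_def Csum
        by (intro sum.cong refl) (use CRm[OF that] CX[OF that] in \<open>auto simp del: mult_pCons_right\<close>)
      then show ?thesis using that by simp
    qed
    then have "\<sigma> p = v" using n by (simp add: \<sigma>_def P fps_eq_iff)
    then show "\<exists>p. \<sigma> p = v" by blast
  qed
  then have "has_codim poly_const J (n * k)" by (auto simp: has_codim_def)
  moreover have "has_codim poly_const J M" using M by (simp add: J_def R_def)
  ultimately have "M = n * k" using has_codim_quotient_dim[OF ring_map_poly_const] by blast
  with k show ?thesis by (auto simp: I_def)
qed

section \<open>Intersection numbers\<close>

text \<open>Weierstrass division represents C[[x]][[y]] / (W) by the polynomials of degree below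
  that of W, as polynomial division does for C[[x]][y] / (W); so the further quotients by g
  agree.\<close>

lemma has_codim_weierstrass:
  fixes g W :: "complex fps poly"
  assumes W: "weierstrass_polynomial W" and k: "has_codim poly_const (ideal2 g W) k"
  shows "has_codim const2 (ideal2 (fps_of_poly g) (fps_of_poly W)) k"
proof -
  obtain \<pi> where \<pi>: "codim_map poly_const (ideal2 g W) k \<pi>"
    using k by (auto simp: has_codim_def)
  define d where "d = degree W"
  define w where "w = fps_of_poly W"
  have reg: "regular_of_order d w" unfolding d_def w_def by (rule weierstrass_regular[OF W])
  have "\<exists>q r. h = q * w + fps_of_poly r \<and> (\<forall>i\<ge>d. coeff r i = 0)" for h
  proof -
    obtain q r where "h = q * w + r" and r: "\<And>i. d \<le> i \<Longrightarrow> r $ i = 0"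
      using weierstrass_division[OF reg, of h] by blast
    moreover obtain p where "fps_of_poly p = r" "p = 0 \<or> degree p < d"
      using fps_of_poly_exists[OF r] by blast
    ultimately show ?thesis using r by (metis fps_of_poly_nth)
  qed
  then obtain Q R where h: "\<And>h. h = Q h * w + fps_of_poly (R h)"
    and low: "\<And>h i. d \<le> i \<Longrightarrow> coeff (R h) i = 0" by metis
  have unique: "R h = r" if "h = q * w + fps_of_poly r" "\<And>i. d \<le> i \<Longrightarrow> coeff r i = 0" for h q r
  proof -
    have "fps_of_poly (R h) = fps_of_poly r"
      using weierstrass_division_unique(2)[OF reg, of "Q h" "fps_of_poly (R h)" q "fps_of_poly r"]
        h[of h] that low by simp
    then show ?thesis by (simp add: fps_of_poly_eq_iff)
  qed
  have add: "R (h + h') = R h + R h'" for h h'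
  proof (rule unique)
    show "h + h' = (Q h + Q h') * w + fps_of_poly (R h + R h')"
      using h[of h] h[of h'] unfolding fps_of_poly_add by algebra
  qed (simp add: low)
  have scale: "R (fps_const (fps_const c) * h) = [:fps_const c:] * R h" for c h
  proof (rule unique)
    show "fps_const (fps_const c) * h = (fps_const (fps_const c) * Q h) * w + fps_of_poly ([:fps_const c:] * R h)"
      using h[of h] unfolding fps_of_poly_mult fps_of_poly_const by algebra
  qed (simp add: low)
  have rem: "\<exists>q r. p = q * W + r \<and> (\<forall>i\<ge>d. coeff r i = 0)" for p
  proof -
    obtain q r where "p = q * W + r" "r = 0 \<or> degree r < degree W"
      using monic_division[of W p] W by (auto simp: weierstrass_polynomial_def)
    moreover from this(2) have "\<forall>i\<ge>d. coeff r i = 0" by (auto simp: d_def coeff_eq_0)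
    ultimately show ?thesis by blast
  qed
  have "codim_map const2 (ideal2 (fps_of_poly g) w) k (\<lambda>h. \<pi> (R h))"
  proof (rule codim_mapI)
    show "\<pi> (R (h + h')) = \<pi> (R h) + \<pi> (R h')" for h h'
      by (simp add: add codim_map_add[OF \<pi>])
    show "\<pi> (R (fps_const (fps_const c) * h)) = fps_const c * \<pi> (R h)" for c h
      unfolding scale codim_map_scale[OF \<pi>] ..
    show "\<pi> (R h) $ i = 0" if "k \<le> i" for h i using that by (rule codim_map_nth[OF \<pi>])
  next
    fix h assume "\<pi> (R h) = 0"
    then have "R h \<in> ideal2 g W" using codim_map_kernel[OF \<pi>] by blast
    then obtain a b where "R h = a * g + b * W" by (auto simp: ideal2_def)
    then have "h = fps_of_poly a * fps_of_poly g + (Q h + fps_of_poly b) * w"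
      using h[of h] by (simp add: fps_of_poly_add fps_of_poly_mult w_def algebra_simps)
    then show "h \<in> ideal2 (fps_of_poly g) w" by (auto simp: ideal2_def)
  next
    fix h assume "h \<in> ideal2 (fps_of_poly g) w"
    then obtain a b where ab: "h = a * fps_of_poly g + b * w" by (auto simp: ideal2_def)
    \<comment> \<open>The product of a remainder with g may again have degree d or more, so it is
      reduced once more, now by polynomial division.\<close>
    obtain q r where qr: "R a * g = q * W + r" "\<forall>i\<ge>d. coeff r i = 0" using rem by blast
    have "fps_of_poly (R a) * fps_of_poly g = fps_of_poly q * w + fps_of_poly r"
      using arg_cong[OF qr(1), of fps_of_poly] by (simp add: fps_of_poly_add fps_of_poly_mult w_def)
    then have "h = (Q a * fps_of_poly g + fps_of_poly q + b) * w + fps_of_poly r"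
      using ab h[of a] by algebra
    then have "R h = r" using qr(2) by (intro unique) auto
    also have "r = R a * g + (- q) * W" using qr(1) by simp
    finally have "R h \<in> ideal2 g W" unfolding ideal2_def by blast
    then show "\<pi> (R h) = 0" using codim_map_kernel[OF \<pi>] by blast
  next
    fix v :: "complex fps" assume v: "\<And>i. k \<le> i \<Longrightarrow> v $ i = 0"
    obtain p where p: "\<pi> p = v" by (rule codim_map_surj[OF \<pi> v])
    obtain q r where qr: "p = q * W + r" "\<forall>i\<ge>d. coeff r i = 0" using rem by blast
    have "q * W \<in> ideal2 g W" unfolding ideal2_def by (rule CollectI, rule exI[of _ 0]) auto
    then have "\<pi> (q * W) = 0" using codim_map_kernel[OF \<pi>] by blast
    then have "\<pi> r = v" using p qr by (simp add: codim_map_add[OF \<pi>])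
    moreover have "R (fps_of_poly p) = r"
      using qr by (intro unique[of _ "fps_of_poly q"]) (simp_all add: fps_of_poly_add fps_of_poly_mult w_def)
    ultimately show "\<exists>h. \<pi> (R h) = v" by blast
  qed
  then show ?thesis by (auto simp: has_codim_def w_def)
qed

lemma has_codim_coordinates:
  assumes \<phi>: "coordinates \<iota> \<phi>" and k: "has_codim const2 I k"
  shows "has_codim \<iota> (\<phi> ` I) k"
proof -
  obtain \<pi> where \<pi>: "codim_map const2 I k \<pi>"
    using k by (auto simp: has_codim_def)
  have inv: "inv \<phi> (\<phi> f) = f" for f
    using \<phi> by (simp add: coordinates_def bij_is_inj)
  have "codim_map \<iota> (\<phi> ` I) k (\<lambda>a. \<pi> (inv \<phi> a))"
  proof (rule codim_mapI)
    fix a b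
    obtain f g where fg: "a = \<phi> f" "b = \<phi> g" by (metis coordinates_surj[OF \<phi>])
    then have "inv \<phi> (a + b) = f + g" using inv[of "f + g"] by (simp add: coordinates_add[OF \<phi>])
    then show "\<pi> (inv \<phi> (a + b)) = \<pi> (inv \<phi> a) + \<pi> (inv \<phi> b)"
      by (simp add: fg inv codim_map_add[OF \<pi>])
  next
    fix c a
    obtain f where f: "a = \<phi> f" by (rule coordinates_surj[OF \<phi>])
    then have "inv \<phi> (\<iota> c * a) = fps_const (fps_const c) * f"
      using inv[of "fps_const (fps_const c) * f"] by (simp add: coordinates_mult[OF \<phi>] coordinates_const[OF \<phi>])
    then have "\<pi> (inv \<phi> (\<iota> c * a)) = \<pi> (fps_const (fps_const c) * f)" by (simp only:)
    also have "\<dots> = fps_const c * \<pi> (inv \<phi> a)"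
      unfolding codim_map_scale[OF \<pi>] f inv ..
    finally show "\<pi> (inv \<phi> (\<iota> c * a)) = fps_const c * \<pi> (inv \<phi> a)" .
  next
    fix a assume "a \<in> \<phi> ` I"
    then obtain f where f: "a = \<phi> f" "f \<in> I" by (rule imageE)
    then have "\<pi> f = 0" using codim_map_kernel[OF \<pi>, of f] by blast
    then show "\<pi> (inv \<phi> a) = 0" unfolding f inv .
  next
    fix a assume a: "\<pi> (inv \<phi> a) = 0"
    obtain f where f: "a = \<phi> f" by (rule coordinates_surj[OF \<phi>])
    have "f \<in> I" using a codim_map_kernel[OF \<pi>, of f] unfolding f inv by blast
    then show "a \<in> \<phi> ` I" unfolding f by (rule imageI)
  next
    show "\<pi> (inv \<phi> a) $ i = 0" if "k \<le> i" for a i using that by (rule codim_map_nth[OF \<pi>])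
  next
    fix v :: "complex fps" assume v: "\<And>i. k \<le> i \<Longrightarrow> v $ i = 0"
    obtain f where "\<pi> f = v" by (rule codim_map_surj[OF \<pi> v])
    then have "\<pi> (inv \<phi> (\<phi> f)) = v" by (simp add: inv)
    then show "\<exists>a. \<pi> (inv \<phi> a) = v" by blast
  qed
  then show ?thesis by (auto simp: has_codim_def)
qed

lemma ring_map_coordinates:
  assumes "coordinates \<iota> \<phi>"
  shows "ring_map \<iota>"
  using coordinates_1[OF assms] coordinates_add[OF assms] coordinates_mult[OF assms]
  unfolding ring_map_def coordinates_const[OF assms, symmetric]
  by (metis fps_const_1_eq_1 fps_const_add fps_const_mult)

lemma intersection_number_eq:
  assumes \<phi>: "coordinates \<iota> \<phi>"
    and k: "has_codim const2 (ideal2 f g) k"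
  shows "intersection_number \<iota> (principal_ideal (\<phi> f)) (principal_ideal (\<phi> g)) = k"
proof -
  have "{a + b |a b. a \<in> principal_ideal (\<phi> f) \<and> b \<in> principal_ideal (\<phi> g)} = \<phi> ` ideal2 f g"
  proof (intro set_eqI iffI)
    fix c assume "c \<in> {a + b |a b. a \<in> principal_ideal (\<phi> f) \<and> b \<in> principal_ideal (\<phi> g)}"
    then obtain a b where "c = \<phi> f * a + \<phi> g * b" by (auto simp: principal_ideal_def)
    moreover obtain a' b' where "a = \<phi> a'" "b = \<phi> b'" by (metis coordinates_surj[OF \<phi>])
    ultimately have "c = \<phi> (a' * f + b' * g)"
      by (simp add: coordinates_add[OF \<phi>] coordinates_mult[OF \<phi>] mult.commute)
    then show "c \<in> \<phi> ` ideal2 f g" by (auto simp: ideal2_def)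
  next
    fix c assume "c \<in> \<phi> ` ideal2 f g"
    then obtain a b where "c = \<phi> (a * f + b * g)" by (auto simp: ideal2_def)
    then have "c = \<phi> f * \<phi> a + \<phi> g * \<phi> b"
      by (simp add: coordinates_add[OF \<phi>] coordinates_mult[OF \<phi>] mult.commute)
    then show "c \<in> {a + b |a b. a \<in> principal_ideal (\<phi> f) \<and> b \<in> principal_ideal (\<phi> g)}"
      by (auto simp: principal_ideal_def)
  qed
  then show ?thesis
    using has_codim_quotient_dim[OF ring_map_coordinates[OF \<phi>] has_codim_coordinates[OF \<phi> k]]
    by (simp add: intersection_number_def)
qed

lemma intersection_number_commute: "intersection_number \<iota> A B = intersection_number \<iota> B A"
proof -
  have "{a + b |a b. a \<in> A \<and> b \<in> B} = {a + b |a b. a \<in> B \<and> b \<in> A}"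
    by (auto; metis add.commute)
  then show ?thesis by (simp add: intersection_number_def)
qed

text \<open>Setting x = 0 turns W into y^d, d its degree, and leaves C[[y]] / (y^d). This yields L .
  A.\<close>

lemma has_codim_X_weierstrass:
  assumes W: "weierstrass_polynomial W"
  shows "has_codim const2 (ideal2 (fps_const fps_X) (fps_of_poly W)) (degree W)"
proof -
  define d where "d = degree W"
  define w where "w = fps_of_poly W"
  have reg: "regular_of_order d w" unfolding d_def w_def by (rule weierstrass_regular[OF W])
  define \<pi> where "\<pi> h = Abs_fps (\<lambda>i. if i < d then h $ i $ 0 else 0)" for h :: "complex fps fps"
  have w0: "(q * w) $ i $ 0 = 0" if "i < d" for q i
    using reg that by (auto simp: fps_mult_nth fps_sum_nth regular_of_order_def intro!: sum.neutral)
  have "codim_map const2 (ideal2 (fps_const fps_X) w) d \<pi>"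
  proof (rule codim_mapI)
    fix h assume "h \<in> ideal2 (fps_const fps_X) w"
    then obtain a b where "h = fps_const fps_X * a + b * w" by (auto simp: ideal2_def mult.commute)
    then show "\<pi> h = 0" by (simp add: \<pi>_def fps_eq_iff w0)
  next
    fix h assume \<pi>: "\<pi> h = 0"
    obtain q r where qr: "h = q * w + r" and r: "\<And>i. d \<le> i \<Longrightarrow> r $ i = 0"
      using weierstrass_division[OF reg, of h] by blast
    have "r $ i $ 0 = 0" for i
    proof (cases "i < d")
      case True
      then have "\<pi> h $ i = r $ i $ 0" by (simp add: \<pi>_def qr w0)
      then show ?thesis using \<pi> by simp
    qed (simp add: r)
    then obtain a where "r = fps_const fps_X * a" using fps_const_X_dvd by (metis dvdE)
    then have "h = a * fps_const fps_X + q * w" using qr by (simp add: mult.commute add.commute)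
    then show "h \<in> ideal2 (fps_const fps_X) w" by (auto simp: ideal2_def)
  next
    fix v :: "complex fps" assume v: "\<And>i. d \<le> i \<Longrightarrow> v $ i = 0"
    have "\<pi> (Abs_fps (\<lambda>i. fps_const (v $ i))) = v"
      using v by (auto simp: \<pi>_def fps_eq_iff)
    then show "\<exists>h. \<pi> h = v" by blast
  qed (auto simp: \<pi>_def fps_eq_iff)
  then show ?thesis by (auto simp: has_codim_def d_def w_def)
qed

text \<open>Modulo t the polynomial W becomes a pure power of y. Thus its roots have no constant
  term, which later makes intersection numbers positive.\<close>

lemma poly_ramify_nth_0:
  assumes W: "weierstrass_polynomial W" and n: "0 < n"
  shows "poly (map_poly (ramify n) W) s $ 0 = (s $ 0) ^ degree W"
proof -
  have "map_poly (\<lambda>c. c $ 0) (map_poly (ramify n) W) = monom 1 (degree W)"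
  proof (rule poly_eqI)
    fix i
    have "coeff (map_poly (\<lambda>c. c $ 0) (map_poly (ramify n) W)) i = coeff W i $ 0"
      by (simp add: coeff_map_poly ring_map_0[OF ring_map_ramify[OF n]] ramify_nth n)
    also have "\<dots> = coeff (monom 1 (degree W)) i"
      using W by (cases i "degree W" rule: linorder_cases) (auto simp: weierstrass_polynomial_def coeff_eq_0)
    finally show "coeff (map_poly (\<lambda>c. c $ 0) (map_poly (ramify n) W)) i = coeff (monom 1 (degree W)) i" .
  qed
  then show ?thesis
    using poly_ring_map[OF ring_map_nth_0, of "map_poly (ramify n) W" s] by (simp add: poly_monom)
qed

lemma poly_ramify_rotate:
  assumes n: "0 < n" and z: "z ^ n = 1"
  shows "poly (map_poly (ramify n) q) (rotate_fps z s) = rotate_fps z (poly (map_poly (ramify n) q) s)"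
proof -
  have "map_poly (rotate_fps z) (map_poly (ramify n) q) = map_poly (ramify n) q"
    by (rule poly_eqI) (simp add: coeff_map_poly ring_map_0[OF ring_map_ramify[OF n]]
        ring_map_0[OF ring_map_rotate] rotate_ramify[OF n z])
  then show ?thesis using poly_ring_map[OF ring_map_rotate, of z "map_poly (ramify n) q" s] by simp
qed

text \<open>The outcome of \<open>newton_puiseux\<close>: with t = x^(1/d), d the degree, s(t) is a
  root, and its d distinct rotations are all of them.\<close>

definition conjugate_root :: "complex fps poly \<Rightarrow> complex fps \<Rightarrow> bool" where
  "conjugate_root p s \<longleftrightarrow> 0 < degree p \<and> inj_on (\<lambda>z. rotate_fps z s) (unity_roots (degree p)) \<and>
     map_poly (ramify (degree p)) p = conjugates_poly (degree p) s"

lemma poly_conjugates_poly: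
  assumes "0 < n"
  shows "poly (conjugates_poly n s) t = (\<Prod>z\<in>unity_roots n. t - rotate_fps z s)"
  by (simp add: conjugates_poly_def poly_prod)

lemma rotate_1 [simp]: "rotate_fps 1 s = s"
  by (simp add: fps_eq_iff)

lemma conjugate_root_zero:
  assumes "conjugate_root p s"
  shows "poly (map_poly (ramify (degree p)) p) s = 0"
  using assms finite_unity_roots[of "degree p"]
  by (auto simp: conjugate_root_def poly_conjugates_poly intro!: exI[of _ 1])

context
  fixes \<iota> :: "complex \<Rightarrow> 'r::comm_ring_1" and L \<phi>
  assumes \<phi>: "adapted_coordinates \<iota> L \<phi>"
begin

lemma coordinates_adapted: "coordinates \<iota> \<phi>" "L = principal_ideal (\<phi> (fps_const fps_X))"
  using \<phi> by (auto simp: adapted_coordinates_def)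

lemma branch_conjugate_root:
  assumes "branch A" "A \<noteq> L"
  obtains s where "conjugate_root (branch_poly \<phi> A) s"
proof -
  have "lead_coeff (branch_poly \<phi> A) = 1"
    using branch_poly(1)[OF \<phi> assms] by (simp add: weierstrass_polynomial_def)
  from newton_puiseux[OF branch_poly(2)[OF \<phi> assms] this] show ?thesis
    using that unfolding conjugate_root_def by metis
qed

lemma intersection_number_L:
  assumes "branch A" "A \<noteq> L"
  shows "intersection_number \<iota> L A = degree (branch_poly \<phi> A)"
  using intersection_number_eq[OF coordinates_adapted(1) has_codim_X_weierstrass[OF branch_poly(1)[OF \<phi> assms]]]
    branch_poly(3)[OF \<phi> assms] coordinates_adapted(2) by simp

text \<open>Intersection by parametrization: A . B is the order in t of f_B(t^n, s(t)). Over C[[t]]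
  the polynomial of A splits, each of its n roots contributes this same order, and descent to C[[x]]
  divides the total by n.\<close>

lemma intersection_number_branches:
  assumes A: "branch A" "A \<noteq> L" and B: "branch B" "B \<noteq> L" and "A \<noteq> B"
    and s: "conjugate_root (branch_poly \<phi> A) s"
  defines "n \<equiv> degree (branch_poly \<phi> A)"
  shows "poly (map_poly (ramify n) (branch_poly \<phi> B)) s \<noteq> 0" (is ?nz)
    "intersection_number \<iota> A B = subdegree (poly (map_poly (ramify n) (branch_poly \<phi> B)) s)" (is ?int)
    "0 < intersection_number \<iota> A B"
proof -
  define p q where "p = branch_poly \<phi> A" and "q = branch_poly \<phi> B"
  note p = branch_poly[OF \<phi> A, folded p_def] and q = branch_poly[OF \<phi> B, folded q_def]
  have n: "0 < n" "inj_on (\<lambda>z. rotate_fps z s) (unity_roots n)"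
    "map_poly (ramify n) p = conjugates_poly n s"
    using s by (auto simp: conjugate_root_def n_def p_def)
  have monic: "lead_coeff p = 1" "lead_coeff q = 1"
    using p q by (auto simp: weierstrass_polynomial_def)
  define r where "r = map_poly (ramify n) q"
  \<comment> \<open>A common root would make f_A divide f_B; both being irreducible and monic, A and
    B would coincide.\<close>
  show nz: ?nz
  proof
    assume "poly (map_poly (ramify n) (branch_poly \<phi> B)) s = 0"
    then have "conjugates_poly n s dvd map_poly (ramify n) q"
      unfolding q_def by (rule conjugates_poly_dvd[OF n(1,2)])
    then have "p dvd q" unfolding n(3)[symmetric] map_poly_ramify_dvd_iff[OF n(1)] .
    then obtain k where k: "q = p * k" by (rule dvdE)
    then have "k dvd 1" using q(2) p(2) by (metis irreducibleD irreducible_not_unit)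
    moreover have "lead_coeff k = 1" using monic k by (simp add: lead_coeff_mult)
    ultimately have "k = 1" by (intro monic_unit_eq_1)
    then have "A = B" using k p(3) q(3) by simp
    with \<open>A \<noteq> B\<close> show False by simp
  qed
  have rot: "poly r (rotate_fps z s) = rotate_fps z (poly r s)" if "z ^ n = 1" for z
    unfolding r_def by (rule poly_ramify_rotate[OF n(1) that])
  have z0: "z \<noteq> 0" if "z ^ n = 1" for z :: complex
    using that n by (auto simp: power_0_left)
  have rs: "poly r s \<noteq> 0" using nz by (simp add: r_def q_def)
  have rz: "poly r (rotate_fps z s) \<noteq> 0" if "z ^ n = 1" for z
    using rs z0[OF that] by (simp add: rot[OF that] fps_eq_iff)
  have "has_codim poly_const (ideal2 r (\<Prod>z\<in>unity_roots n. [:- rotate_fps z s, 1:]))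
      (\<Sum>z\<in>unity_roots n. subdegree (poly r (rotate_fps z s)))"
    using rz by (intro has_codim_linear_factors finite_unity_roots n) auto
  also have "(\<Sum>z\<in>unity_roots n. subdegree (poly r (rotate_fps z s))) = (\<Sum>z\<in>unity_roots n. subdegree (poly r s))"
    by (intro sum.cong refl) (auto simp: rot subdegree_rotate z0)
  also have "\<dots> = n * subdegree (poly r s)" by (simp add: card_unity_roots n)
  also have "(\<Prod>z\<in>unity_roots n. [:- rotate_fps z s, 1:]) = map_poly (ramify n) p"
    by (simp add: n(3) conjugates_poly_def)
  finally have "has_codim poly_const (ideal2 (map_poly (ramify n) q) (map_poly (ramify n) p))
      (n * subdegree (poly r s))" by (simp add: r_def)
  from has_codim_ramify[OF n(1) this] have "has_codim poly_const (ideal2 q p) (subdegree (poly r s))"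
    using n by auto
  then have "has_codim const2 (ideal2 (fps_of_poly q) (fps_of_poly p)) (subdegree (poly r s))"
    by (rule has_codim_weierstrass[OF p(1)])
  from intersection_number_eq[OF coordinates_adapted(1) this]
  have "intersection_number \<iota> B A = subdegree (poly r s)" using p(3) q(3) by simp
  then show ?int by (simp add: intersection_number_commute[of _ A] r_def q_def)
  \<comment> \<open>The parametrization of A passes through the origin, where f_B vanishes, so the
    order is positive.\<close>
  have "s $ 0 = 0"
    using conjugate_root_zero[OF s] poly_ramify_nth_0[OF p(1) n(1), of s]
    by (simp add: n_def p_def)
  moreover have "degree q \<noteq> 0" using branch_conjugate_root[OF B] by (auto simp: conjugate_root_def q_def)
  ultimately have "poly r s $ 0 = 0" using poly_ramify_nth_0[OF q(1) n(1), of s] by (simp add: r_def)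
  then have "subdegree (poly r s) \<noteq> 0" using rs nth_subdegree_zero_iff by metis
  then show "0 < intersection_number \<iota> A B" using \<open>?int\<close> by (simp add: r_def q_def)
qed

end

section \<open>Orders of coincidence\<close>

lemma puiseux_series_nth:
  assumes "0 < n"
  shows "puiseux_series n s (of_nat k / of_nat n) = s $ k"
  using assms by (simp add: puiseux_series_def)

lemma puiseux_series_cases:
  assumes "0 < n"
  obtains k where "q = of_nat k / of_nat n" | "q * of_nat n \<notin> \<nat>" "\<And>s. puiseux_series n s q = 0"
proof (cases "q * of_nat n \<in> \<nat>")
  case True
  then obtain k where "q * of_nat n = of_nat k" by (auto simp: Nats_def)
  then have "q = of_nat k / of_nat n" using assms by (simp add: field_simps)
  then show ?thesis by (rule that)
qed (use that in \<open>auto simp: puiseux_series_def\<close>)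

lemma puiseux_series_inj:
  assumes "0 < n" "puiseux_series n s = puiseux_series n t"
  shows "s = t"
  using assms puiseux_series_nth by (metis fps_ext)

lemma puiseux_series_diff:
  "puiseux_series n s q - puiseux_series n t q = puiseux_series n (s - t) q"
  by (simp add: puiseux_series_def)

text \<open>Roots of different branches have different denominators; this rewrites both over a
  common one.\<close>

lemma puiseux_series_ramify:
  assumes n: "0 < n" and m: "0 < m"
  shows "puiseux_series (n * m) (ramify m s) = puiseux_series n s"
proof
  fix q
  have nm: "0 < n * m" using n m by simp
  show "puiseux_series (n * m) (ramify m s) q = puiseux_series n s q"
  proof (cases q rule: puiseux_series_cases[OF n])
    case (1 k)
    then have q: "q = of_nat (k * m) / of_nat (n * m)" using m by simp
    have "puiseux_series (n * m) (ramify m s) q = s $ k"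
      unfolding q puiseux_series_nth[OF nm] using m by (simp add: ramify_nth)
    also have "\<dots> = puiseux_series n s q" unfolding 1 puiseux_series_nth[OF n] ..
    finally show ?thesis .
  next
    case 2
    show ?thesis
    proof (cases q rule: puiseux_series_cases[OF nm])
      case (1 l)
      have "\<not> m dvd l"
      proof
        assume "m dvd l"
        then obtain j where "l = m * j" by (rule dvdE)
        then have "q * of_nat n = of_nat j" using 1 n m by simp
        then show False using 2(1) by simp
      qed
      then show ?thesis
        unfolding 2(2) unfolding 1 puiseux_series_nth[OF nm] by (simp add: ramify_nth m)
    qed (simp add: 2)
  qed
qed

lemma x_order_puiseux_series:
  assumes n: "0 < n" and s: "s \<noteq> 0"
  shows "x_order (puiseux_series n s) = ennreal (real (subdegree s) / real n)"
  unfolding x_order_def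
proof (rule antisym)
  let ?q = "of_nat (subdegree s) / of_nat n :: rat"
  have "puiseux_series n s ?q \<noteq> 0" using s n by (simp add: puiseux_series_nth)
  then have "(INF q\<in>{q. puiseux_series n s q \<noteq> 0}. ennreal (real_of_rat q)) \<le> ennreal (real_of_rat ?q)"
    by (intro INF_lower) simp
  then show "(INF q\<in>{q. puiseux_series n s q \<noteq> 0}. ennreal (real_of_rat q)) \<le> ennreal (real (subdegree s) / real n)"
    by (simp add: of_rat_divide)
  show "ennreal (real (subdegree s) / real n) \<le> (INF q\<in>{q. puiseux_series n s q \<noteq> 0}. ennreal (real_of_rat q))"
  proof (rule INF_greatest)
    fix q assume "q \<in> {q. puiseux_series n s q \<noteq> 0}"
    then have q: "puiseux_series n s q \<noteq> 0" by simp
    then obtain k where k: "q = of_nat k / of_nat n" using puiseux_series_cases[OF n, of q] by metis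
    then have "s $ k \<noteq> 0" using q n by (simp add: puiseux_series_nth)
    then have "subdegree s \<le> k" by (rule subdegree_leI)
    then show "ennreal (real (subdegree s) / real n) \<le> ennreal (real_of_rat q)"
      by (intro ennreal_leI) (simp add: k of_rat_divide divide_right_mono)
  qed
qed

section \<open>Contact of Puiseux series and the monodromy action\<close>

definition contact :: "(rat \<Rightarrow> complex) \<Rightarrow> (rat \<Rightarrow> complex) \<Rightarrow> ennreal" where
  "contact \<eta> \<theta> = x_order (\<lambda>q. \<eta> q - \<theta> q)"

lemma contact_commute: "contact \<eta> \<theta> = contact \<theta> \<eta>"
proof -
  have "{q. \<eta> q - \<theta> q \<noteq> 0} = {q. \<theta> q - \<eta> q \<noteq> 0}" by auto
  then show ?thesis by (simp add: contact_def x_order_def)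
qed

text \<open>The infimum over an empty set of exponents is \<infinity>.\<close>

lemma contact_self: "contact \<eta> \<eta> = \<infinity>"
  by (simp add: contact_def x_order_def)

text \<open>Where \<eta> and \<zeta> differ, at least one of them differs from \<theta>.\<close>

lemma contact_ultra: "min (contact \<eta> \<theta>) (contact \<theta> \<zeta>) \<le> contact \<eta> \<zeta>"
proof -
  have "min (contact \<eta> \<theta>) (contact \<theta> \<zeta>) \<le> ennreal (real_of_rat q)" if "\<eta> q - \<zeta> q \<noteq> 0" for q
  proof -
    have "\<eta> q - \<theta> q \<noteq> 0 \<or> \<theta> q - \<zeta> q \<noteq> 0" using that by auto
    then show ?thesis
      unfolding contact_def x_order_def by (auto intro: min.coboundedI1 min.coboundedI2 INF_lower)
  qed
  then show ?thesis unfolding contact_def[of \<eta> \<zeta>] x_order_def by (intro INF_greatest) auto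
qed

text \<open>The monodromy x -> exp(2 pi i j) x acts on x^q without reference to a denominator, so
  that one j moves the roots of all branches simultaneously.\<close>

definition puiseux_rotate :: "nat \<Rightarrow> (rat \<Rightarrow> complex) \<Rightarrow> rat \<Rightarrow> complex" where
  "puiseux_rotate j \<eta> q = exp (2 * of_real pi * \<i> * of_nat j * of_rat q) * \<eta> q"

lemma contact_puiseux_rotate: "contact (puiseux_rotate j \<eta>) (puiseux_rotate j \<theta>) = contact \<eta> \<theta>"
proof -
  have "puiseux_rotate j \<eta> q - puiseux_rotate j \<theta> q \<noteq> 0 \<longleftrightarrow> \<eta> q - \<theta> q \<noteq> 0" for q
    by (simp add: puiseux_rotate_def)
  then show ?thesis by (simp only: contact_def x_order_def)
qed

lemma puiseux_rotate_series:
  assumes n: "0 < n"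
  shows "puiseux_rotate j (puiseux_series n s) =
    puiseux_series n (rotate_fps (exp (2 * of_real pi * \<i> * of_nat j / of_nat n)) s)"
proof
  fix q
  show "puiseux_rotate j (puiseux_series n s) q =
    puiseux_series n (rotate_fps (exp (2 * of_real pi * \<i> * of_nat j / of_nat n)) s) q"
  proof (cases q rule: puiseux_series_cases[OF n])
    case (1 k)
    have "exp (2 * of_real pi * \<i> * of_nat j * of_rat q) = exp (2 * of_real pi * \<i> * of_nat j / of_nat n) ^ k"
      by (simp add: 1 of_rat_divide exp_of_nat_mult[symmetric] mult_ac)
    then show ?thesis by (simp add: puiseux_rotate_def) (simp add: 1 puiseux_series_nth n)
  qed (simp add: puiseux_rotate_def)
qed

lemma newton_puiseux_roots_eq:
  assumes s: "conjugate_root p s"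
  shows "newton_puiseux_roots p =
    (\<lambda>z. puiseux_series (degree p) (rotate_fps z s)) ` unity_roots (degree p)"
proof -
  let ?n = "degree p"
  have n: "0 < ?n" and p: "map_poly (ramify ?n) p = conjugates_poly ?n s"
    using s by (auto simp: conjugate_root_def)
  have "poly (map_poly (\<lambda>c. fps_compose c (fps_X ^ ?n)) p) t = 0 \<longleftrightarrow>
      t \<in> (\<lambda>z. rotate_fps z s) ` unity_roots ?n" for t
  proof -
    have "poly (map_poly (\<lambda>c. fps_compose c (fps_X ^ ?n)) p) t = poly (conjugates_poly ?n s) t"
      unfolding p[symmetric] by (simp add: ramify_def[abs_def])
    then show ?thesis
      using finite_unity_roots[OF n] by (auto simp: poly_conjugates_poly[OF n])
  qed
  then show ?thesis by (auto simp: newton_puiseux_roots_def)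
qed

lemma newton_puiseux_roots:
  assumes s: "conjugate_root p s"
  shows "finite (newton_puiseux_roots p)" "newton_puiseux_roots p \<noteq> {}"
  using finite_unity_roots[of "degree p"] s power_one[of "degree p", where 'a=complex]
  unfolding newton_puiseux_roots_eq[OF s] by (auto simp: conjugate_root_def simp del: power_one)

lemma puiseux_rotate_roots:
  assumes s: "conjugate_root p s" and \<eta>: "\<eta> \<in> newton_puiseux_roots p"
  shows "puiseux_rotate j \<eta> \<in> newton_puiseux_roots p"
proof -
  have n: "0 < degree p" using s by (simp add: conjugate_root_def)
  obtain z where z: "z ^ degree p = 1" "\<eta> = puiseux_series (degree p) (rotate_fps z s)"
    using \<eta> by (auto simp: newton_puiseux_roots_eq[OF s])
  let ?e = "exp (2 * of_real pi * \<i> * of_nat j / of_nat (degree p)) :: complex"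
  have "(?e * z) ^ degree p = 1"
    using z n complex_root_unity[of "degree p" j] by (simp add: power_mult_distrib)
  then show ?thesis
    by (auto simp: newton_puiseux_roots_eq[OF s] z puiseux_rotate_series[OF n] rotate_rotate)
qed

lemma puiseux_rotate_transitive:
  assumes s: "conjugate_root p s" and \<eta>: "\<eta> \<in> newton_puiseux_roots p" and \<theta>: "\<theta> \<in> newton_puiseux_roots p"
  obtains j where "puiseux_rotate j \<eta> = \<theta>"
proof -
  have n: "0 < degree p" using s by (simp add: conjugate_root_def)
  obtain z where z: "z ^ degree p = 1" "\<eta> = puiseux_series (degree p) (rotate_fps z s)"
    using \<eta> by (auto simp: newton_puiseux_roots_eq[OF s])
  obtain w where w: "w ^ degree p = 1" "\<theta> = puiseux_series (degree p) (rotate_fps w s)"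
    using \<theta> by (auto simp: newton_puiseux_roots_eq[OF s])
  have z0: "z \<noteq> 0" using z n by (auto simp: power_0_left)
  have "w / z \<in> unity_roots (degree p)" using z w by (simp add: power_divide)
  then obtain j where j: "w / z = exp (2 * of_real pi * \<i> * of_nat j / of_nat (degree p))"
    using complex_roots_unity[of "degree p"] n by auto
  have "puiseux_rotate j \<eta> = \<theta>"
    unfolding z(2) w(2) puiseux_rotate_series[OF n] rotate_rotate j[symmetric] using z0 by simp
  then show ?thesis by (rule that)
qed

context
  fixes \<iota> :: "complex \<Rightarrow> 'r::comm_ring_1" and L \<phi>
  assumes \<phi>: "adapted_coordinates \<iota> L \<phi>"
begin

abbreviation np_roots :: "'r set \<Rightarrow> (rat \<Rightarrow> complex) set" where
  "np_roots A \<equiv> newton_puiseux_roots (branch_poly \<phi> A)"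

text \<open>Since f_A is the product of the y - \<eta>, the contacts with \<theta> add up to the
  x-order of f_A at \<theta>. In t = x^(1/m), m the degree of f_B, this order is A . B; measuring it
  in x divides it by m.\<close>

lemma sum_contact:
  assumes A: "branch A" "A \<noteq> L" and B: "branch B" "B \<noteq> L" and "A \<noteq> B"
    and \<theta>: "\<theta> \<in> np_roots B"
  shows "(\<Sum>\<eta>\<in>np_roots A. contact \<eta> \<theta>) =
    ennreal (real (intersection_number \<iota> A B) / real (degree (branch_poly \<phi> B)))"
proof -
  define p q where "p = branch_poly \<phi> A" and "q = branch_poly \<phi> B"
  define n m where "n = degree p" and "m = degree q"
  obtain s where s: "conjugate_root p s" unfolding p_def by (rule branch_conjugate_root[OF \<phi> A])
  obtain t where t: "conjugate_root q t" unfolding q_def by (rule branch_conjugate_root[OF \<phi> B])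
  have n: "0 < n" and inj: "inj_on (\<lambda>z. rotate_fps z s) (unity_roots n)"
    and p: "map_poly (ramify n) p = conjugates_poly n s"
    using s by (auto simp: conjugate_root_def n_def)
  have m: "0 < m" using t by (simp add: conjugate_root_def m_def)
  obtain w where w: "w ^ m = 1" and \<theta>w: "\<theta> = puiseux_series m (rotate_fps w t)"
    using \<theta> newton_puiseux_roots_eq[OF t] by (auto simp: q_def m_def)
  define t' where "t' = rotate_fps w t"
  have w0: "w \<noteq> 0" using w m by (auto simp: power_0_left)
  define I where "I = intersection_number \<iota> A B"
  \<comment> \<open>The parametrized branch is now B, hence the exchanged roles.\<close>
  have BA: "poly (map_poly (ramify m) p) t \<noteq> 0" "I = subdegree (poly (map_poly (ramify m) p) t)"
    using intersection_number_branches[OF \<phi> B A \<open>A \<noteq> B\<close>[symmetric] t[unfolded q_def]]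
    by (simp_all add: p_def q_def m_def I_def intersection_number_commute[of _ A])
  have I: "subdegree (poly (map_poly (ramify m) p) t') = I" "poly (map_poly (ramify m) p) t' \<noteq> 0"
    unfolding t'_def poly_ramify_rotate[OF m w]
    using BA w0 by (simp_all add: subdegree_rotate fps_eq_iff)
  \<comment> \<open>The difference of the two roots in the variable x^(1/(n m)): t' is a series in
    x^(1/m), s one in x^(1/n).\<close>
  define D where "D z = ramify n t' - ramify m (rotate_fps z s)" for z
  note hm = ring_map_ramify[OF m] and hn = ring_map_ramify[OF n]
  have "ramify n (poly (map_poly (ramify m) p) t') = poly (map_poly (ramify n) (map_poly (ramify m) p)) (ramify n t')"
    by (rule poly_ring_map[OF hn, symmetric])
  also have "map_poly (ramify n) (map_poly (ramify m) p) = map_poly (ramify m) (conjugates_poly n s)"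
    unfolding p[symmetric] map_poly_ramify_ramify[OF n m] map_poly_ramify_ramify[OF m n]
    by (simp add: mult.commute)
  also have "poly \<dots> (ramify n t') = (\<Prod>z\<in>unity_roots n. D z)"
    unfolding conjugates_poly_def map_poly_ring_map(5)[OF hm] poly_prod
    by (simp add: ring_map_linear[OF hm] ring_map_1[OF hm] ring_map_uminus[OF hm] D_def)
  finally have prod: "ramify n (poly (map_poly (ramify m) p) t') = (\<Prod>z\<in>unity_roots n. D z)" .
  have "ramify n (poly (map_poly (ramify m) p) t') \<noteq> 0"
    using I(2) ramify_eq_iff[OF n, of _ 0] by (simp add: ring_map_0[OF hn])
  then have D0: "D z \<noteq> 0" if "z \<in> unity_roots n" for z
    using that finite_unity_roots[OF n] unfolding prod by simp
  have "subdegree (\<Prod>z\<in>unity_roots n. D z) = (\<Sum>z\<in>unity_roots n. subdegree (D z))"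
    by (rule subdegree_prod) (rule D0)
  then have nI: "n * I = (\<Sum>z\<in>unity_roots n. subdegree (D z))"
    using arg_cong[OF prod, of subdegree] by (simp only: subdegree_ramify[OF n] I)
  have contact: "contact (puiseux_series n (rotate_fps z s)) \<theta> = ennreal (real (subdegree (D z)) / real (n * m))"
    if "z \<in> unity_roots n" for z
  proof -
    have "puiseux_series n (rotate_fps z s) = puiseux_series (n * m) (ramify m (rotate_fps z s))"
      using n m by (simp add: puiseux_series_ramify)
    moreover have "\<theta> = puiseux_series (n * m) (ramify n t')"
      using n m puiseux_series_ramify[OF m n, of t'] by (simp add: \<theta>w t'_def mult.commute)
    ultimately have "contact (puiseux_series n (rotate_fps z s)) \<theta> = contact \<theta> (puiseux_series (n * m) (ramify m (rotate_fps z s)))"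
      by (simp add: contact_commute)
    also have "\<dots> = x_order (puiseux_series (n * m) (D z))"
      unfolding \<open>\<theta> = puiseux_series (n * m) (ramify n t')\<close> contact_def D_def puiseux_series_diff ..
    also have "\<dots> = ennreal (real (subdegree (D z)) / real (n * m))"
      using n m D0[OF that] by (intro x_order_puiseux_series) simp_all
    finally show ?thesis .
  qed
  have inj': "inj_on (\<lambda>z. puiseux_series n (rotate_fps z s)) (unity_roots n)"
    using inj puiseux_series_inj[OF n] by (auto simp: inj_on_def)
  have "(\<Sum>\<eta>\<in>newton_puiseux_roots p. contact \<eta> \<theta>) = (\<Sum>z\<in>unity_roots n. ennreal (real (subdegree (D z)) / real (n * m)))"
    unfolding newton_puiseux_roots_eq[OF s, folded n_def] sum.reindex[OF inj']
    by (simp add: contact)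
  also have "\<dots> = ennreal (\<Sum>z\<in>unity_roots n. real (subdegree (D z)) / real (n * m))"
    by (intro sum_ennreal) simp
  also have "(\<Sum>z\<in>unity_roots n. real (subdegree (D z)) / real (n * m)) = real (n * I) / real (n * m)"
    unfolding nI by (simp add: sum_divide_distrib)
  also have "\<dots> = real I / real m" using n by simp
  finally show ?thesis by (simp add: p_def I_def m_def q_def)
qed

lemma coincidence_order_altdef:
  "coincidence_order \<phi> A B = Max ((\<lambda>(\<eta>, \<theta>). contact \<eta> \<theta>) `
    (np_roots A \<times> np_roots B))"
  unfolding coincidence_order_def contact_def by (rule arg_cong[of _ _ Max]) auto

context
  fixes A B :: "'r set"
  assumes A: "branch A" "A \<noteq> L" and B: "branch B" "B \<noteq> L"
begin

lemma finite_contacts: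
  "finite (np_roots A \<times> np_roots B)"
  "np_roots A \<times> np_roots B \<noteq> {}"
  using newton_puiseux_roots branch_conjugate_root[OF \<phi> A] branch_conjugate_root[OF \<phi> B]
  by (metis finite_cartesian_product, metis Times_empty)

lemma contact_le_coincidence_order:
  assumes "\<eta> \<in> np_roots A" "\<theta> \<in> np_roots B"
  shows "contact \<eta> \<theta> \<le> coincidence_order \<phi> A B"
  unfolding coincidence_order_altdef using assms finite_contacts(1) by (intro Max_ge) auto

text \<open>A pair of maximal contact can be moved by monodromy until its first member is the
  prescribed root, and contacts are preserved.\<close>

lemma coincidence_order_attained:
  assumes \<eta>: "\<eta> \<in> np_roots A"
  obtains \<theta> where "\<theta> \<in> np_roots B" "contact \<eta> \<theta> = coincidence_order \<phi> A B"
proof -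
  obtain s where s: "conjugate_root (branch_poly \<phi> A) s" by (rule branch_conjugate_root[OF \<phi> A])
  obtain t where t: "conjugate_root (branch_poly \<phi> B) t" by (rule branch_conjugate_root[OF \<phi> B])
  have "coincidence_order \<phi> A B \<in> (\<lambda>(\<eta>, \<theta>). contact \<eta> \<theta>) `
    (np_roots A \<times> np_roots B)"
    unfolding coincidence_order_altdef using finite_contacts by (intro Max_in) auto
  then obtain \<eta>' \<theta>' where *: "\<eta>' \<in> np_roots A"
    "\<theta>' \<in> np_roots B" "contact \<eta>' \<theta>' = coincidence_order \<phi> A B"
    by auto
  obtain j where j: "puiseux_rotate j \<eta>' = \<eta>" by (rule puiseux_rotate_transitive[OF s *(1) \<eta>])
  have "contact \<eta> (puiseux_rotate j \<theta>') = coincidence_order \<phi> A B"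
    unfolding j[symmetric] contact_puiseux_rotate by (rule *(3))
  with puiseux_rotate_roots[OF t *(2)] show ?thesis by (rule that)
qed

end

lemma coincidence_order_commute: "coincidence_order \<phi> A B = coincidence_order \<phi> B A"
proof -
  have "(\<lambda>(\<eta>, \<theta>). contact \<eta> \<theta>) ` (N \<times> M) \<subseteq> (\<lambda>(\<eta>, \<theta>). contact \<eta> \<theta>) ` (M \<times> N)" for N M
  proof (intro image_subsetI)
    fix p assume p: "p \<in> N \<times> M"
    obtain \<eta> \<theta> where "p = (\<eta>, \<theta>)" by (cases p)
    with p show "(case p of (\<eta>, \<theta>) \<Rightarrow> contact \<eta> \<theta>) \<in> (\<lambda>(\<eta>, \<theta>). contact \<eta> \<theta>) ` (M \<times> N)"
      by (intro image_eqI[of _ _ "(\<theta>, \<eta>)"]) (simp_all add: contact_commute[of \<eta>])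
  qed
  then show ?thesis unfolding coincidence_order_altdef by (intro arg_cong[of _ _ Max] antisym)
qed

text \<open>From a root of A pass to a closest root of B, and from there to a closest root of C;
  then apply the inequality for contacts.\<close>

lemma coincidence_order_ultra:
  assumes A: "branch A" "A \<noteq> L" and B: "branch B" "B \<noteq> L" and C: "branch C" "C \<noteq> L"
  shows "min (coincidence_order \<phi> A B) (coincidence_order \<phi> B C) \<le> coincidence_order \<phi> A C"
proof -
  obtain s where s: "conjugate_root (branch_poly \<phi> A) s" by (rule branch_conjugate_root[OF \<phi> A])
  obtain \<eta> where \<eta>: "\<eta> \<in> np_roots A"
    using newton_puiseux_roots(2)[OF s] by blast
  obtain \<theta> where \<theta>: "\<theta> \<in> np_roots B" "contact \<eta> \<theta> = coincidence_order \<phi> A B"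
    by (rule coincidence_order_attained[OF A B \<eta>])
  obtain \<zeta> where \<zeta>: "\<zeta> \<in> np_roots C" "contact \<theta> \<zeta> = coincidence_order \<phi> B C"
    by (rule coincidence_order_attained[OF B C \<theta>(1)])
  show ?thesis
    using contact_ultra[of \<eta> \<theta> \<zeta>] contact_le_coincidence_order[OF A C \<eta> \<zeta>(1)] \<theta> \<zeta> by simp
qed

text \<open>If \<open>\<eta>\<^sub>0\<close> and \<open>\<theta>\<close> realize the order of coincidence \<open>k\<close>, then \<open>\<eta> - \<theta>\<close> has order
  \<open>min (\<nu>(\<eta> - \<eta>\<^sub>0)) k\<close> for every conjugate \<open>\<eta>\<close> of \<open>\<eta>\<^sub>0\<close>.\<close>

lemma sum_min_contact:
  assumes A: "branch A" "A \<noteq> L" and B: "branch B" "B \<noteq> L" and "A \<noteq> B"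
    and \<eta>\<^sub>0: "\<eta>\<^sub>0 \<in> np_roots A"
  shows "(\<Sum>\<eta>\<in>np_roots A. min (contact \<eta> \<eta>\<^sub>0) (coincidence_order \<phi> A B)) =
    ennreal (real (intersection_number \<iota> A B) / real (degree (branch_poly \<phi> B)))"
proof -
  obtain \<theta> where \<theta>: "\<theta> \<in> np_roots B" "contact \<eta>\<^sub>0 \<theta> = coincidence_order \<phi> A B"
    by (rule coincidence_order_attained[OF A B \<eta>\<^sub>0])
  have "min (contact \<eta> \<eta>\<^sub>0) (coincidence_order \<phi> A B) = contact \<eta> \<theta>"
    if \<eta>: "\<eta> \<in> np_roots A" for \<eta>
  proof (rule antisym)
    show "min (contact \<eta> \<eta>\<^sub>0) (coincidence_order \<phi> A B) \<le> contact \<eta> \<theta>"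
      using contact_ultra[of \<eta> \<eta>\<^sub>0 \<theta>] \<theta>(2) by simp
    have le: "contact \<eta> \<theta> \<le> coincidence_order \<phi> A B"
      by (rule contact_le_coincidence_order[OF A B \<eta> \<theta>(1)])
    then have "contact \<eta> \<theta> \<le> contact \<eta> \<eta>\<^sub>0"
      using contact_ultra[of \<eta> \<theta> \<eta>\<^sub>0] \<theta>(2) contact_commute[of \<eta>\<^sub>0 \<theta>] by (simp add: min_absorb1)
    with le show "contact \<eta> \<theta> \<le> min (contact \<eta> \<eta>\<^sub>0) (coincidence_order \<phi> A B)" by simp
  qed
  then show ?thesis
    using sum_contact[OF A B \<open>A \<noteq> B\<close> \<theta>(1)] by simp
qed

lemma degree_branch_poly_pos:
  assumes "branch A" "A \<noteq> L"
  shows "0 < degree (branch_poly \<phi> A)"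
proof -
  obtain s where "conjugate_root (branch_poly \<phi> A) s" by (rule branch_conjugate_root[OF \<phi> assms])
  then show ?thesis by (simp add: conjugate_root_def)
qed

lemma intersection_number_pos:
  assumes A: "branch A" "A \<noteq> L" and B: "branch B" "B \<noteq> L" and "A \<noteq> B"
  shows "0 < intersection_number \<iota> A B"
proof -
  obtain s where "conjugate_root (branch_poly \<phi> A) s" by (rule branch_conjugate_root[OF \<phi> A])
  then show ?thesis by (rule intersection_number_branches(3)[OF \<phi> A B \<open>A \<noteq> B\<close>])
qed

text \<open>In the sum of \<open>sum_min_contact\<close> the summand of
  \<open>\<eta>\<^sub>0\<close> is the order of coincidence itself, so the finite sum bounds it.
  Were it 0, all summands would be 0, against the positive intersection number.\<close>

lemma coincidence_order_finite_pos:
  assumes A: "branch A" "A \<noteq> L" and B: "branch B" "B \<noteq> L" and "A \<noteq> B"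
  shows "coincidence_order \<phi> A B < \<infinity>" "0 < coincidence_order \<phi> A B"
proof -
  let ?N = "np_roots A"
  obtain s where s: "conjugate_root (branch_poly \<phi> A) s" by (rule branch_conjugate_root[OF \<phi> A])
  obtain \<eta>\<^sub>0 where \<eta>\<^sub>0: "\<eta>\<^sub>0 \<in> ?N"
    using newton_puiseux_roots(2)[OF s] by blast
  note sum = sum_min_contact[OF A B \<open>A \<noteq> B\<close> \<eta>\<^sub>0]
  have "coincidence_order \<phi> A B = min (contact \<eta>\<^sub>0 \<eta>\<^sub>0) (coincidence_order \<phi> A B)"
    by (simp add: contact_self)
  also have "\<dots> \<le> (\<Sum>\<eta>\<in>?N. min (contact \<eta> \<eta>\<^sub>0) (coincidence_order \<phi> A B))"
    by (rule member_le_sum[OF \<eta>\<^sub>0]) (simp_all add: newton_puiseux_roots(1)[OF s])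
  also have "\<dots> < \<infinity>" unfolding sum by simp
  finally show "coincidence_order \<phi> A B < \<infinity>" .
  have "(\<Sum>\<eta>\<in>?N. min (contact \<eta> \<eta>\<^sub>0) (coincidence_order \<phi> A B)) \<noteq> 0"
    unfolding sum
    using intersection_number_pos[OF A B \<open>A \<noteq> B\<close>] degree_branch_poly_pos[OF B]
    by (simp add: ennreal_eq_0_iff field_simps)
  moreover have "min x (0 :: ennreal) = 0" for x by (simp add: min_absorb2)
  ultimately have "coincidence_order \<phi> A B \<noteq> 0" by auto
  then show "0 < coincidence_order \<phi> A B" by (simp add: zero_less_iff_neq_zero)
qed

text \<open>The inner quotient is the sum in \<open>sum_min_contact\<close>, and the numerator
  depends on A alone.\<close>

lemma U_L_eq:
  assumes A: "branch A" "A \<noteq> L" and B: "branch B" "B \<noteq> L" and "A \<noteq> B"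
  shows "U_L \<iota> L A B = real (degree (branch_poly \<phi> A)) /
    (real (intersection_number \<iota> A B) / real (degree (branch_poly \<phi> B)))"
  using assms by (simp add: U_L_def intersection_number_L[OF \<phi>])

lemma U_L_pos:
  assumes A: "branch A" "A \<noteq> L" and B: "branch B" "B \<noteq> L" and "A \<noteq> B"
  shows "0 < U_L \<iota> L A B"
  unfolding U_L_eq[OF assms]
  using intersection_number_pos[OF assms] degree_branch_poly_pos[OF A] degree_branch_poly_pos[OF B] by simp

lemma U_L_le_iff:
  assumes A: "branch A" "A \<noteq> L" and B: "branch B" "B \<noteq> L" and "A \<noteq> B"
    and C: "branch C" "C \<noteq> L" and "A \<noteq> C"
  shows "U_L \<iota> L A B \<le> U_L \<iota> L A C \<longleftrightarrow> coincidence_order \<phi> A C \<le> coincidence_order \<phi> A B"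
proof -
  let ?N = "np_roots A"
  obtain s where s: "conjugate_root (branch_poly \<phi> A) s" by (rule branch_conjugate_root[OF \<phi> A])
  obtain \<eta>\<^sub>0 where \<eta>\<^sub>0: "\<eta>\<^sub>0 \<in> ?N"
    using newton_puiseux_roots(2)[OF s] by blast
  define S where "S k = (\<Sum>\<eta>\<in>?N. min (contact \<eta> \<eta>\<^sub>0) k)" for k
  define x where "x B = real (intersection_number \<iota> A B) / real (degree (branch_poly \<phi> B))" for B
  have S: "S (coincidence_order \<phi> A B) = ennreal (x B)" "S (coincidence_order \<phi> A C) = ennreal (x C)"
    unfolding S_def x_def by (rule sum_min_contact[OF A B \<open>A \<noteq> B\<close> \<eta>\<^sub>0], rule sum_min_contact[OF A C \<open>A \<noteq> C\<close> \<eta>\<^sub>0])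
  have x: "0 < x B" "0 < x C"
    using intersection_number_pos[OF A B \<open>A \<noteq> B\<close>] intersection_number_pos[OF A C \<open>A \<noteq> C\<close>]
      degree_branch_poly_pos[OF B] degree_branch_poly_pos[OF C] by (simp_all add: x_def)
  have mono: "S k \<le> S k'" if "k \<le> k'" for k k'
    unfolding S_def by (intro sum_mono min.mono that order.refl)
  \<comment> \<open>The summand of \<open>\<eta>\<^sub>0\<close> equals k and grows strictly; the
    others, collected in \<open>R k\<close>, are finite, so that adding them in
    \<open>ennreal\<close> keeps the inequality strict.\<close>
  have strict: "S k < S k'" if "k < k'" "k < \<infinity>" for k k'
  proof -
    define R where "R k = (\<Sum>\<eta>\<in>?N - {\<eta>\<^sub>0}. min (contact \<eta> \<eta>\<^sub>0) k)" for k
    have SR: "S k = R k + k" for k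
      using sum.remove[OF newton_puiseux_roots(1)[OF s] \<eta>\<^sub>0, of "\<lambda>\<eta>. min (contact \<eta> \<eta>\<^sub>0) k"]
      by (simp add: S_def R_def contact_self add.commute)
    have "R k \<le> (\<Sum>\<eta>\<in>?N - {\<eta>\<^sub>0}. k)" unfolding R_def by (intro sum_mono) simp
    also have "\<dots> < \<infinity>" using that(2) by (simp add: ennreal_mult_less_top of_nat_less_top)
    finally have "R k + k < R k + k'" using that(1) by (simp add: ennreal_add_left_cancel_less)
    also have "\<dots> \<le> R k' + k'"
      unfolding R_def using that(1) by (intro add_mono sum_mono min.mono) auto
    finally show ?thesis unfolding SR .
  qed
  have "coincidence_order \<phi> A C \<le> coincidence_order \<phi> A B \<longleftrightarrow> x C \<le> x B"
  proof
    assume "coincidence_order \<phi> A C \<le> coincidence_order \<phi> A B"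
    from mono[OF this] show "x C \<le> x B" using x unfolding S by (simp add: ennreal_le_iff)
  next
    assume *: "x C \<le> x B"
    show "coincidence_order \<phi> A C \<le> coincidence_order \<phi> A B"
    proof (rule ccontr)
      assume "\<not> ?thesis"
      then have "S (coincidence_order \<phi> A B) < S (coincidence_order \<phi> A C)"
        using coincidence_order_finite_pos(1)[OF A B \<open>A \<noteq> B\<close>] by (intro strict) auto
      with * x show False unfolding S by (simp add: ennreal_less_iff)
    qed
  qed
  also have "x C \<le> x B \<longleftrightarrow> U_L \<iota> L A B \<le> U_L \<iota> L A C"
    unfolding U_L_eq[OF A B \<open>A \<noteq> B\<close>] U_L_eq[OF A C \<open>A \<noteq> C\<close>] x_def[symmetric]
    using x degree_branch_poly_pos[OF A] by (simp add: field_simps)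
  finally show ?thesis ..
qed

end

lemma U_L_commute: "U_L \<iota> L A B = U_L \<iota> L B A"
  by (simp add: U_L_def intersection_number_commute[of _ A] mult.commute)

section \<open>The Eggers-Wall space\<close>

text \<open>Each piece is clopen, its complement being the union of the other open pieces. A
  component meeting a piece lies in it, and contains it by maximality.\<close>

lemma connected_components_of_partition:
  assumes conn: "\<And>U. U \<in> \<U> \<Longrightarrow> connectedin X U" and op: "\<And>U. U \<in> \<U> \<Longrightarrow> openin X U"
    and ne: "\<And>U. U \<in> \<U> \<Longrightarrow> U \<noteq> {}" and disj: "\<And>U V. U \<in> \<U> \<Longrightarrow> V \<in> \<U> \<Longrightarrow> U \<inter> V \<noteq> {} \<Longrightarrow> U = V"
    and cover: "\<Union>\<U> = topspace X"
  shows "connected_components_of X = \<U>"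
proof -
  have closed: "closedin X U" if "U \<in> \<U>" for U
  proof -
    have "topspace X - U = \<Union>(\<U> - {U})" using that disj unfolding cover[symmetric] by blast
    moreover have "openin X (\<Union>(\<U> - {U}))" using op by (intro openin_Union) auto
    ultimately show ?thesis using openin_subset[OF op[OF that]] by (simp add: closedin_def)
  qed
  have eq: "C = U" if C: "C \<in> connected_components_of X" and U: "U \<in> \<U>" and "C \<inter> U \<noteq> {}" for C U
  proof
    have "\<not> disjnt C U" using that by (simp add: disjnt_def)
    then show "U \<subseteq> C" by (rule connected_components_of_maximal[OF C conn[OF U]])
    have "C \<subseteq> U \<or> disjnt C U"
      using connectedin_clopen_cases[OF connectedin_connected_components_of[OF C] closed[OF U] op[OF U]] .
    then show "C \<subseteq> U" using \<open>\<not> disjnt C U\<close> by blast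
  qed
  show ?thesis
  proof (intro set_eqI iffI)
    fix C assume C: "C \<in> connected_components_of X"
    then obtain x where x: "x \<in> C" using nonempty_connected_components_of by blast
    then have "x \<in> \<Union>\<U>" using C connected_components_of_subset cover by blast
    then obtain U where "U \<in> \<U>" "x \<in> U" by blast
    then show "C \<in> \<U>" using eq[OF C, of U] x by blast
  next
    fix U assume U: "U \<in> \<U>"
    then obtain x where x: "x \<in> U" using ne by blast
    then have "x \<in> topspace X" using U cover by blast
    then obtain C where "C \<in> connected_components_of X" "x \<in> C"
      using Union_connected_components_of[of X] by blast
    then show "U \<in> connected_components_of X" using eq[OF _ U, of C] x by blast
  qed
qed

text \<open>From here on, branches enter only through these properties of the order of
  coincidence.\<close>

locale coincidence_tree =
  fixes \<phi> :: "complex fps fps \<Rightarrow> 'r::comm_ring_1" and F :: "'r set set"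
  assumes finite_F: "finite F" and F_nonempty: "F \<noteq> {}"
    and commute: "coincidence_order \<phi> A B = coincidence_order \<phi> B A"
    and ultra: "A \<in> F \<Longrightarrow> B \<in> F \<Longrightarrow> C \<in> F \<Longrightarrow>
      min (coincidence_order \<phi> A B) (coincidence_order \<phi> B C) \<le> coincidence_order \<phi> A C"
    and finite_order: "A \<in> F \<Longrightarrow> B \<in> F \<Longrightarrow> A \<noteq> B \<Longrightarrow> coincidence_order \<phi> A B < \<infinity>"
    and pos_order: "A \<in> F \<Longrightarrow> B \<in> F \<Longrightarrow> A \<noteq> B \<Longrightarrow> 0 < coincidence_order \<phi> A B"
begin

text \<open>The diagonal value \<infinity> identifies each segment with itself up to its end, and
  makes A alone the cluster at its leaf.\<close>

definition coin :: "'r set \<Rightarrow> 'r set \<Rightarrow> ennreal" where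
  "coin A B = (if A = B then \<infinity> else coincidence_order \<phi> A B)"

lemma coin_self [simp]: "coin A A = \<infinity>"
  by (simp add: coin_def)

lemma coin_commute: "coin A B = coin B A"
  by (simp add: coin_def commute[of A])

lemma coin_ultra:
  assumes "A \<in> F" "B \<in> F" "C \<in> F" "\<alpha> \<le> coin A B" "\<alpha> \<le> coin B C"
  shows "\<alpha> \<le> coin A C"
proof (cases "A = B \<or> B = C \<or> A = C")
  case True
  then show ?thesis using assms(4-5) by (elim disjE) simp_all
next
  case False
  then have "\<alpha> \<le> min (coincidence_order \<phi> A B) (coincidence_order \<phi> B C)"
    using assms(4-5) by (simp add: coin_def)
  also note ultra[OF assms(1-3)]
  finally show ?thesis using False by (simp add: coin_def)
qed

lemma coin_ultra_less:
  assumes "A \<in> F" "B \<in> F" "C \<in> F" "\<alpha> < coin A B" "\<alpha> < coin B C"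
  shows "\<alpha> < coin A C"
proof -
  have "\<alpha> < min (coin A B) (coin B C)" using assms(4-5) by simp
  also have "\<dots> \<le> coin A C" by (rule coin_ultra[OF assms(1-3)]) simp_all
  finally show ?thesis .
qed

lemma coin_pos: "A \<in> F \<Longrightarrow> B \<in> F \<Longrightarrow> 0 < coin A B"
  by (simp add: coin_def pos_order)

lemma coin_eq_top_iff: "A \<in> F \<Longrightarrow> B \<in> F \<Longrightarrow> \<infinity> \<le> coin A B \<longleftrightarrow> A = B"
proof (cases "A = B")
  case False
  assume "A \<in> F" "B \<in> F"
  from finite_order[OF this False] show ?thesis using False by (simp add: coin_def)
qed simp

definition cluster :: "'r set \<Rightarrow> ennreal \<Rightarrow> 'r set set" where
  "cluster A \<alpha> = {B \<in> F. \<alpha> \<le> coin A B}"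

text \<open>The class of (A, \<alpha>) in the glued space as an explicit product, by
  \<open>EW_class\<close>.\<close>

definition point :: "'r set \<Rightarrow> ennreal \<Rightarrow> ('r set \<times> ennreal) set" where
  "point A \<alpha> = cluster A \<alpha> \<times> {\<alpha>}"

lemma self_in_cluster: "A \<in> F \<Longrightarrow> A \<in> cluster A \<alpha>"
  by (simp add: cluster_def)

lemma cluster_eq:
  assumes "A \<in> F" "B \<in> F" "\<alpha> \<le> coin A B"
  shows "cluster A \<alpha> = cluster B \<alpha>"
  using assms coin_ultra[of A B _ \<alpha>] coin_ultra[of B A _ \<alpha>] coin_commute[of A B]
  by (auto simp: cluster_def)

lemma point_eq_iff:
  assumes "A \<in> F" "B \<in> F"
  shows "point A \<alpha> = point B \<beta> \<longleftrightarrow> \<alpha> = \<beta> \<and> \<alpha> \<le> coin A B"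
proof
  assume eq: "point A \<alpha> = point B \<beta>"
  have "(B, \<beta>) \<in> point B \<beta>" using self_in_cluster[OF assms(2)] by (simp add: point_def)
  then have "(B, \<beta>) \<in> point A \<alpha>" by (simp only: eq)
  then show "\<alpha> = \<beta> \<and> \<alpha> \<le> coin A B" by (simp add: point_def cluster_def)
next
  assume "\<alpha> = \<beta> \<and> \<alpha> \<le> coin A B"
  then show "point A \<alpha> = point B \<beta>" using cluster_eq[OF assms, of \<alpha>] unfolding point_def by metis
qed

text \<open>By the ultrametric inequality the gluing, with the diagonal added, is already
  transitive, so the generated equivalence identifies nothing further.\<close>

lemma EW_rel_iff:
  "((A, \<alpha>), (B, \<beta>)) \<in> EW_rel \<phi> F \<longleftrightarrow> A \<in> F \<and> B \<in> F \<and> \<alpha> = \<beta> \<and> \<alpha> \<le> coin A B"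
proof
  assume rel: "((A, \<alpha>), (B, \<beta>)) \<in> EW_rel \<phi> F"
  then have A: "A \<in> F" and eq: "equivclp (EW_glued \<phi> F) (A, \<alpha>) (B, \<beta>)" by (auto simp: EW_rel_def)
  from eq have "fst (B, \<beta>) \<in> F \<and> snd (B, \<beta>) = \<alpha> \<and> \<alpha> \<le> coin A (fst (B, \<beta>))"
  proof (induction rule: equivclp_induct)
    case base
    then show ?case using A by simp
  next
    case (step y z)
    then have "fst z \<in> F" "snd z = snd y" "snd y \<le> coin (fst y) (fst z)"
      by (auto simp: EW_glued_def coin_def commute)
    then show ?case using step.IH coin_ultra[OF A, of "fst y" "fst z" \<alpha>] by auto
  qed
  then show "A \<in> F \<and> B \<in> F \<and> \<alpha> = \<beta> \<and> \<alpha> \<le> coin A B" using A by simp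
next
  assume *: "A \<in> F \<and> B \<in> F \<and> \<alpha> = \<beta> \<and> \<alpha> \<le> coin A B"
  have "equivclp (EW_glued \<phi> F) (A, \<alpha>) (B, \<beta>)"
  proof (cases "A = B")
    case True
    then show ?thesis using * by simp
  next
    case False
    then have "EW_glued \<phi> F (A, \<alpha>) (B, \<beta>)" using * by (clarsimp simp: EW_glued_def coin_def)
    then show ?thesis by (rule r_into_equivclp)
  qed
  with * show "((A, \<alpha>), (B, \<beta>)) \<in> EW_rel \<phi> F" by (simp add: EW_rel_def)
qed

lemma EW_class: "A \<in> F \<Longrightarrow> EW_rel \<phi> F `` {(A, \<alpha>)} = point A \<alpha>"
  by (auto simp: EW_rel_iff point_def cluster_def)

lemma EW_quotient: "(F \<times> UNIV) // EW_rel \<phi> F = {point A \<alpha> | A \<alpha>. A \<in> F}"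
  using EW_class by (auto simp: quotient_def) (metis)

lemma topspace_segments: "topspace (segments_topology F) = F \<times> UNIV"
  by (auto simp: segments_topology_def)

text \<open>Openness in a quotient of a disjoint union can be tested on each segment; this reduces
  the topology of the tree to sets of exponents.\<close>

lemma openin_EW_space:
  "openin (EW_space \<phi> F) U \<longleftrightarrow> U \<subseteq> {point A \<alpha> | A \<alpha>. A \<in> F} \<and> (\<forall>A\<in>F. open {\<alpha>. point A \<alpha> \<in> U})"
proof -
  have "openin (segments_topology F) (\<Union>U) \<longleftrightarrow> (\<forall>A\<in>F. open {\<alpha>. point A \<alpha> \<in> U})"
    if U: "U \<subseteq> {point A \<alpha> | A \<alpha>. A \<in> F}"
  proof -
    have "(A, \<alpha>) \<in> \<Union>U \<longleftrightarrow> point A \<alpha> \<in> U" if A: "A \<in> F" for A \<alpha>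
    proof
      assume "(A, \<alpha>) \<in> \<Union>U"
      then obtain P where P: "P \<in> U" "(A, \<alpha>) \<in> P" by blast
      then obtain B \<beta> where B: "B \<in> F" "P = point B \<beta>" using U by blast
      then have "\<beta> = \<alpha> \<and> \<beta> \<le> coin B A" using P by (auto simp: point_def cluster_def)
      then have "P = point A \<alpha>" using B point_eq_iff[OF B(1) A, of \<beta> \<alpha>] by metis
      then show "point A \<alpha> \<in> U" using P by simp
    next
      assume "point A \<alpha> \<in> U"
      moreover have "(A, \<alpha>) \<in> point A \<alpha>" using self_in_cluster[OF A] by (simp add: point_def)
      ultimately show "(A, \<alpha>) \<in> \<Union>U" by blast
    qed
    then have "{\<alpha>. (A, \<alpha>) \<in> \<Union>U} = {\<alpha>. point A \<alpha> \<in> U}" if "A \<in> F" for A using that by simp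
    moreover have "\<Union>U \<subseteq> F \<times> UNIV" using U by (auto simp: point_def cluster_def)
    ultimately show ?thesis by (auto simp: segments_topology_def openin_sum_topology)
  qed
  then show ?thesis
    unfolding EW_space_def
    by (subst openin_quotient_topology) (auto simp: topspace_segments EW_quotient equiv_EW_rel)
qed

lemma topspace_EW_space: "topspace (EW_space \<phi> F) = {point A \<alpha> | A \<alpha>. A \<in> F}"
proof
  show "topspace (EW_space \<phi> F) \<subseteq> {point A \<alpha> | A \<alpha>. A \<in> F}"
    using openin_topspace[of "EW_space \<phi> F"] unfolding openin_EW_space by blast
  have "{\<alpha>. point A \<alpha> \<in> {point A \<alpha> | A \<alpha>. A \<in> F}} = UNIV" if "A \<in> F" for A using that by auto
  then have "openin (EW_space \<phi> F) {point A \<alpha> | A \<alpha>. A \<in> F}" unfolding openin_EW_space by simp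
  then show "{point A \<alpha> | A \<alpha>. A \<in> F} \<subseteq> topspace (EW_space \<phi> F)" by (rule openin_subset)
qed

lemma closedin_EW_space:
  assumes "K \<subseteq> {point A \<alpha> | A \<alpha>. A \<in> F}" "\<And>A. A \<in> F \<Longrightarrow> closed {\<alpha>. point A \<alpha> \<in> K}"
  shows "closedin (EW_space \<phi> F) K"
proof -
  have "{\<alpha>. point A \<alpha> \<in> topspace (EW_space \<phi> F) - K} = - {\<alpha>. point A \<alpha> \<in> K}" if "A \<in> F" for A
    using that by (auto simp: topspace_EW_space)
  then have "openin (EW_space \<phi> F) (topspace (EW_space \<phi> F) - K)"
    unfolding openin_EW_space using assms(2) by (auto simp: topspace_EW_space open_closed)
  then show ?thesis using assms(1) by (simp add: closedin_def topspace_EW_space)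
qed

lemma continuous_point: "A \<in> F \<Longrightarrow> continuous_map euclidean (EW_space \<phi> F) (point A)"
  unfolding continuous_map by (auto simp: openin_EW_space topspace_EW_space)

lemma connectedin_point: "A \<in> F \<Longrightarrow> connected S \<Longrightarrow> connectedin (EW_space \<phi> F) (point A ` S)"
  using connectedin_continuous_map_image[OF continuous_point] by simp

lemma open_complement_point:
  assumes A: "A \<in> F"
  shows "openin (EW_space \<phi> F) (topspace (EW_space \<phi> F) - {point A \<alpha>})"
proof -
  have "{\<beta>. point B \<beta> \<in> {point A \<alpha>}} = (if \<alpha> \<le> coin B A then {\<alpha>} else {})" if "B \<in> F" for B
    using point_eq_iff[OF that A] by auto
  then have "closedin (EW_space \<phi> F) {point A \<alpha>}"
    using A by (intro closedin_EW_space) auto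
  then show ?thesis by (simp add: closedin_def)
qed

section \<open>Clusters and the range of exponents of each\<close>

definition clusters :: "'r set set set" where
  "clusters = {cluster A \<alpha> | A \<alpha>. A \<in> F}"

text \<open>The exponent up to which all members of the cluster run together. The pairs C = D count
  with value \<infinity>, which places the vertex of a singleton at its leaf.\<close>

definition top_exponent :: "'r set set \<Rightarrow> ennreal" where
  "top_exponent B = (INF (C, D)\<in>B \<times> B. coin C D)"

text \<open>The exponent of the lower end of the edge below the cluster; it is \<open>0\<close> for \<open>F\<close>, the supremum
  being taken over the empty set.\<close>

definition bottom_exponent :: "'r set set \<Rightarrow> ennreal" where
  "bottom_exponent B = (SUP (C, D)\<in>B \<times> (F - B). coin C D)"

definition vertex :: "'r set set \<Rightarrow> ('r set \<times> ennreal) set" where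
  "vertex B = B \<times> {top_exponent B}"

lemma cluster_subset: "cluster A \<alpha> \<subseteq> F"
  by (auto simp: cluster_def)

lemma clusters_subset: "B \<in> clusters \<Longrightarrow> B \<subseteq> F"
  by (auto simp: clusters_def cluster_def)

lemma clusters_finite: "B \<in> clusters \<Longrightarrow> finite B"
  using clusters_subset finite_F finite_subset by blast

lemma clusters_nonempty: "B \<in> clusters \<Longrightarrow> B \<noteq> {}"
  using self_in_cluster by (auto simp: clusters_def)

lemma top_exponent_le: "C \<in> B \<Longrightarrow> D \<in> B \<Longrightarrow> top_exponent B \<le> coin C D"
  unfolding top_exponent_def by (rule INF_lower2[of "(C, D)"]) auto

lemma top_exponent_attained:
  assumes "finite B" "B \<noteq> {}"
  obtains C D where "C \<in> B" "D \<in> B" "coin C D = top_exponent B"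
proof -
  let ?S = "(\<lambda>(C, D). coin C D) ` (B \<times> B)"
  have "Inf ?S = Min ?S" using assms by (intro cInf_eq_Min) auto
  then have "top_exponent B \<in> ?S" unfolding top_exponent_def using assms Min_in[of ?S] by auto
  then show ?thesis using that by auto
qed

lemma top_exponent_cluster:
  assumes A: "A \<in> F"
  shows "\<alpha> \<le> top_exponent (cluster A \<alpha>)"
proof -
  have "\<alpha> \<le> coin C D" if "C \<in> cluster A \<alpha>" "D \<in> cluster A \<alpha>" for C D
    using that A coin_ultra[of C A D \<alpha>] coin_commute[of A C] by (auto simp: cluster_def)
  then show ?thesis unfolding top_exponent_def by (intro INF_greatest) auto
qed

text \<open>Every member of an ultrametric ball is a centre of it.\<close>

lemma clusters_cluster:
  assumes B: "B \<in> clusters" and C: "C \<in> B"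
  obtains \<alpha> where "B = cluster C \<alpha>"
proof -
  obtain A \<alpha> where A: "A \<in> F" "B = cluster A \<alpha>" using B by (auto simp: clusters_def)
  then have "C \<in> F" "\<alpha> \<le> coin A C" using C by (auto simp: cluster_def)
  then have "B = cluster C \<alpha>" using cluster_eq[OF A(1)] A(2) by simp
  then show ?thesis by (rule that)
qed

lemma cluster_top_exponent:
  assumes B: "B \<in> clusters" and C: "C \<in> B"
  shows "cluster C (top_exponent B) = B"
proof -
  obtain \<alpha> where \<alpha>: "B = cluster C \<alpha>" using clusters_cluster[OF B C] .
  have "C \<in> F" using B C clusters_subset by blast
  then have "\<alpha> \<le> top_exponent B" using top_exponent_cluster \<alpha> by simp
  then have "cluster C (top_exponent B) \<subseteq> B" unfolding \<alpha> by (auto simp: cluster_def)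
  moreover have "B \<subseteq> cluster C (top_exponent B)"
    using top_exponent_le[OF C] clusters_subset[OF B] by (auto simp: cluster_def)
  ultimately show ?thesis by blast
qed

lemma vertex_eq_point: "B \<in> clusters \<Longrightarrow> C \<in> B \<Longrightarrow> vertex B = point C (top_exponent B)"
  by (simp add: vertex_def point_def cluster_top_exponent)

lemma top_exponent_pos:
  assumes "B \<in> clusters"
  shows "0 < top_exponent B"
proof -
  obtain C D where "C \<in> B" "D \<in> B" "coin C D = top_exponent B"
    using top_exponent_attained clusters_finite clusters_nonempty assms by metis
  then show ?thesis using coin_pos[of C D] clusters_subset[OF assms] by auto
qed

lemma coin_less_top_exponent:
  assumes B: "B \<in> clusters" and C: "C \<in> B" and D: "D \<in> F" "D \<notin> B"
  shows "coin C D < top_exponent B"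
proof -
  have "D \<notin> cluster C (top_exponent B)" using cluster_top_exponent[OF B C] D by simp
  then show ?thesis using D by (simp add: cluster_def not_le)
qed

lemma coin_le_bottom_exponent: "C \<in> B \<Longrightarrow> D \<in> F \<Longrightarrow> D \<notin> B \<Longrightarrow> coin C D \<le> bottom_exponent B"
  unfolding bottom_exponent_def by (rule SUP_upper2[of "(C, D)"]) auto

lemma bottom_exponent_F: "bottom_exponent F = 0"
  by (simp add: bottom_exponent_def bot_ennreal)

text \<open>The members of B are closer to each other than to any outsider, so all have the same
  order of coincidence with it; the supremum is thus attained from any A in B.\<close>

lemma bottom_exponent_attained:
  assumes B: "B \<in> clusters" and "B \<noteq> F" and A: "A \<in> B"
  obtains D where "D \<in> F" "D \<notin> B" "coin A D = bottom_exponent B"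
proof -
  let ?S = "(\<lambda>(C, D). coin C D) ` (B \<times> (F - B))"
  have S: "finite ?S" "?S \<noteq> {}"
    using assms clusters_finite[OF B] clusters_subset[OF B] finite_F by auto
  then have "Sup ?S = Max ?S" by (intro cSup_eq_Max)
  then have "bottom_exponent B \<in> ?S" unfolding bottom_exponent_def using S Max_in[of ?S] by auto
  then obtain C D where CD: "C \<in> B" "D \<in> F" "D \<notin> B" "coin C D = bottom_exponent B" by auto
  have "coin C D \<le> coin C A"
    using coin_less_top_exponent[OF B CD(1-3)] top_exponent_le[OF CD(1) A] by simp
  then have "coin C D \<le> coin A D"
    using coin_ultra[of A C D "coin C D"] A CD clusters_subset[OF B] by (auto simp: coin_commute)
  then have "coin A D = bottom_exponent B"
    using coin_le_bottom_exponent[OF A CD(2,3)] CD(4) by simp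
  then show ?thesis using that CD by blast
qed

lemma bottom_less_top:
  assumes B: "B \<in> clusters"
  shows "bottom_exponent B < top_exponent B"
proof (cases "B = F")
  case True
  then show ?thesis using top_exponent_pos[OF B] bottom_exponent_F by simp
next
  case False
  obtain A where A: "A \<in> B" using clusters_nonempty[OF B] by blast
  obtain D where "D \<in> F" "D \<notin> B" "coin A D = bottom_exponent B"
    by (rule bottom_exponent_attained[OF B False A])
  then show ?thesis using coin_less_top_exponent[OF B A, of D] by simp
qed

text \<open>Above the bottom exponent every outsider has separated from A, and up to the top
  exponent every member is still present.\<close>

lemma cluster_between:
  assumes B: "B \<in> clusters" and A: "A \<in> B" and "bottom_exponent B < \<gamma>" "\<gamma> \<le> top_exponent B"
  shows "cluster A \<gamma> = B"
proof
  show "cluster A \<gamma> \<subseteq> B"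
  proof
    fix D assume D: "D \<in> cluster A \<gamma>"
    show "D \<in> B"
    proof (rule ccontr)
      assume "D \<notin> B"
      then have "coin A D \<le> bottom_exponent B" using coin_le_bottom_exponent[OF A] D by (simp add: cluster_def)
      moreover have "\<gamma> \<le> coin A D" using D by (simp add: cluster_def)
      ultimately have "\<gamma> \<le> bottom_exponent B" by (rule order.trans[rotated])
      then show False using assms(3) by simp
    qed
  qed
  have "B = cluster A (top_exponent B)" using cluster_top_exponent[OF B A] by simp
  also have "\<dots> \<subseteq> cluster A \<gamma>" using assms(4) by (auto simp: cluster_def)
  finally show "B \<subseteq> cluster A \<gamma>" .
qed

lemma cluster_in_clusters: "A \<in> F \<Longrightarrow> cluster A \<alpha> \<in> clusters"
  by (auto simp: clusters_def)

lemma bottom_exponent_cluster: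
  assumes A: "A \<in> F" and \<gamma>: "0 < \<gamma>"
  shows "bottom_exponent (cluster A \<gamma>) < \<gamma>"
proof (cases "cluster A \<gamma> = F")
  case True
  then show ?thesis using \<gamma> bottom_exponent_F by simp
next
  case False
  obtain D where "D \<in> F" "D \<notin> cluster A \<gamma>" "coin A D = bottom_exponent (cluster A \<gamma>)"
    by (rule bottom_exponent_attained[OF cluster_in_clusters[OF A] False self_in_cluster[OF A]])
  then show ?thesis by (auto simp: cluster_def not_le)
qed

lemma cluster_0: "cluster A 0 = F"
  by (auto simp: cluster_def)

lemma F_in_clusters: "F \<in> clusters"
  using F_nonempty cluster_in_clusters cluster_0 by (metis all_not_in_conv)

lemma cluster_top: "A \<in> F \<Longrightarrow> cluster A \<infinity> = {A}"
  using coin_eq_top_iff by (auto simp: cluster_def)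

lemma singleton_in_clusters: "A \<in> F \<Longrightarrow> {A} \<in> clusters"
  using cluster_in_clusters[of A \<infinity>] cluster_top by simp

lemma top_exponent_singleton: "top_exponent {A} = \<infinity>"
  by (simp add: top_exponent_def)

lemma top_exponent_eq_top:
  assumes B: "B \<in> clusters" "top_exponent B = \<infinity>" and A: "A \<in> B"
  shows "B = {A}"
  using cluster_top_exponent[OF B(1) A] cluster_top[of A] B A clusters_subset by auto

lemma EW_root_eq: "EW_root \<phi> F = F \<times> {0}"
  unfolding EW_root_def
proof (rule the_equality)
  obtain A where A: "A \<in> F" using F_nonempty by blast
  have P: "point A 0 = F \<times> {0}" by (simp add: point_def cluster_0)
  then show "F \<times> {0} \<in> topspace (EW_space \<phi> F) \<and> (\<forall>A\<in>F. (A, 0) \<in> F \<times> {0})"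
    using A by (auto simp: topspace_EW_space)
  fix P assume *: "P \<in> topspace (EW_space \<phi> F) \<and> (\<forall>A\<in>F. (A, 0) \<in> P)"
  then obtain B \<beta> where "P = point B \<beta>" by (auto simp: topspace_EW_space)
  moreover have "(A, 0) \<in> P" using * A by blast
  ultimately show "P = F \<times> {0}" by (auto simp: point_def cluster_0)
qed

lemma EW_leaf_eq: "A \<in> F \<Longrightarrow> EW_leaf \<phi> F A = vertex {A}"
  by (simp add: EW_leaf_def EW_class point_def vertex_def cluster_top[simplified] top_exponent_singleton)

end

lemma times_singleton_eqD:
  assumes "B \<noteq> {}" "B \<times> {b} = C \<times> {c}"
  shows "B = C" "b = c"
  using assms unfolding times_eq_iff by blast+

context coincidence_tree
begin

section \<open>Complement of a point and valency\<close>

definition lower_part :: "'r set \<Rightarrow> ennreal \<Rightarrow> ('r set \<times> ennreal) set set" where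
  "lower_part A \<alpha> = (\<Union>D\<in>F. point D ` (if D \<in> cluster A \<alpha> then {..<\<alpha>} else UNIV))"

text \<open>The two kinds of components left by removing \<open>point A \<alpha>\<close>:
  \<open>lower_part\<close> contains the root and the entire segments outside the cluster;
  \<open>upper_part\<close>, for C in the cluster, is the direction towards the leaf of C.\<close>

definition upper_part :: "'r set \<Rightarrow> ennreal \<Rightarrow> ('r set \<times> ennreal) set set" where
  "upper_part C \<alpha> = (\<Union>D\<in>{D \<in> F. \<alpha> < coin C D}. point D ` {\<alpha><..})"

lemma point_in_lower_part:
  assumes A: "A \<in> F" and E: "E \<in> F"
  shows "point E \<gamma> \<in> lower_part A \<alpha> \<longleftrightarrow> (E \<in> cluster A \<alpha> \<longrightarrow> \<gamma> < \<alpha>)"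
proof
  assume "point E \<gamma> \<in> lower_part A \<alpha>"
  then obtain D \<gamma>' where D: "D \<in> F" "\<gamma>' \<in> (if D \<in> cluster A \<alpha> then {..<\<alpha>} else UNIV)"
    "point E \<gamma> = point D \<gamma>'" by (auto simp: lower_part_def)
  then have eq: "\<gamma>' = \<gamma>" "\<gamma> \<le> coin E D" using point_eq_iff[OF E D(1)] by metis+
  show "E \<in> cluster A \<alpha> \<longrightarrow> \<gamma> < \<alpha>"
  proof (rule impI, rule ccontr)
    assume "E \<in> cluster A \<alpha>" "\<not> \<gamma> < \<alpha>"
    then have "\<alpha> \<le> coin A E" "\<alpha> \<le> \<gamma>" by (auto simp: cluster_def)
    then have "\<alpha> \<le> coin A D" using coin_ultra[OF A E D(1)] eq(2) order.trans by blast
    then show False using D(1,2) eq(1) \<open>\<not> \<gamma> < \<alpha>\<close> by (simp add: cluster_def)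
  qed
next
  assume "E \<in> cluster A \<alpha> \<longrightarrow> \<gamma> < \<alpha>"
  then have "\<gamma> \<in> (if E \<in> cluster A \<alpha> then {..<\<alpha>} else UNIV)" by simp
  with E show "point E \<gamma> \<in> lower_part A \<alpha>" unfolding lower_part_def by blast
qed

lemma point_in_upper_part:
  assumes C: "C \<in> F" and E: "E \<in> F"
  shows "point E \<gamma> \<in> upper_part C \<alpha> \<longleftrightarrow> \<alpha> < coin C E \<and> \<alpha> < \<gamma>"
proof
  assume "point E \<gamma> \<in> upper_part C \<alpha>"
  then obtain D \<gamma>' where D: "D \<in> F" "\<alpha> < coin C D" "\<alpha> < \<gamma>'" "point E \<gamma> = point D \<gamma>'"
    by (auto simp: upper_part_def)
  then have eq: "\<gamma>' = \<gamma>" "\<gamma> \<le> coin E D" using point_eq_iff[OF E D(1)] by metis+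
  then have "\<alpha> < coin D E" using D(3) by (simp add: coin_commute[of D])
  then show "\<alpha> < coin C E \<and> \<alpha> < \<gamma>" using coin_ultra_less[OF C D(1) E D(2)] D(3) eq(1) by simp
next
  assume "\<alpha> < coin C E \<and> \<alpha> < \<gamma>"
  with E show "point E \<gamma> \<in> upper_part C \<alpha>" unfolding upper_part_def by blast
qed

lemma openin_lower_part: "A \<in> F \<Longrightarrow> openin (EW_space \<phi> F) (lower_part A \<alpha>)"
proof -
  assume A: "A \<in> F"
  have "open {\<gamma>. point E \<gamma> \<in> lower_part A \<alpha>}" if E: "E \<in> F" for E
    unfolding point_in_lower_part[OF A E] by (cases "E \<in> cluster A \<alpha>") (simp_all flip: lessThan_def)
  then show ?thesis unfolding openin_EW_space by (auto simp: lower_part_def)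
qed

lemma openin_upper_part: "C \<in> F \<Longrightarrow> openin (EW_space \<phi> F) (upper_part C \<alpha>)"
proof -
  assume C: "C \<in> F"
  have "open {\<gamma>. point E \<gamma> \<in> upper_part C \<alpha>}" if E: "E \<in> F" for E
    unfolding point_in_upper_part[OF C E] by (cases "\<alpha> < coin C E") (simp_all flip: greaterThan_def)
  then show ?thesis unfolding openin_EW_space by (auto simp: upper_part_def)
qed

lemma connectedin_lower_part:
  assumes "0 < \<alpha>"
  shows "connectedin (EW_space \<phi> F) (lower_part A \<alpha>)"
  unfolding lower_part_def
proof (rule connectedin_Union)
  have "F \<times> {0} \<in> point D ` (if D \<in> cluster A \<alpha> then {..<\<alpha>} else UNIV)" for D
    using assms by (intro image_eqI[of _ _ 0]) (auto simp: point_def cluster_0)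
  then show "(\<Inter>D\<in>F. point D ` (if D \<in> cluster A \<alpha> then {..<\<alpha>} else UNIV)) \<noteq> {}" by blast
  fix S assume "S \<in> (\<lambda>D. point D ` (if D \<in> cluster A \<alpha> then {..<\<alpha>} else UNIV)) ` F"
  then obtain D where D: "D \<in> F" "S = point D ` (if D \<in> cluster A \<alpha> then {..<\<alpha>} else UNIV)" by blast
  have "connected (if D \<in> cluster A \<alpha> then {..<\<alpha>} else UNIV)"
    by (auto simp: connected_iff_interval)
  then show "connectedin (EW_space \<phi> F) S" unfolding D(2) by (rule connectedin_point[OF D(1)])
qed

lemma connectedin_upper_part:
  assumes C: "C \<in> F" and "\<alpha> < \<infinity>"
  shows "connectedin (EW_space \<phi> F) (upper_part C \<alpha>)"
  unfolding upper_part_def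
proof (rule connectedin_Union)
  let ?K = "{D \<in> F. \<alpha> < coin C D}"
  \<comment> \<open>At the least order of coincidence with C, which exceeds \<alpha>, all these
    segments still run together; this common point connects them.\<close>
  define \<gamma> where "\<gamma> = Min (coin C ` ?K)"
  have K: "finite (coin C ` ?K)" "coin C ` ?K \<noteq> {}"
    using finite_F C assms(2) by auto
  have "\<alpha> < \<gamma>" using Min_in[OF K] by (auto simp: \<gamma>_def)
  have "point C \<gamma> \<in> point D ` {\<alpha><..}" if D: "D \<in> ?K" for D
  proof (rule image_eqI)
    have "\<gamma> \<le> coin C D" unfolding \<gamma>_def by (rule Min_le[OF K(1)]) (use D in blast)
    then show "point C \<gamma> = point D \<gamma>" using point_eq_iff[OF C, of D \<gamma> \<gamma>] D by blast
  qed (simp add: \<open>\<alpha> < \<gamma>\<close>)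
  then show "(\<Inter>D\<in>?K. point D ` {\<alpha><..}) \<noteq> {}" by blast
  fix S assume "S \<in> (\<lambda>D. point D ` {\<alpha><..}) ` ?K"
  then show "connectedin (EW_space \<phi> F) S"
    using connectedin_point[OF _ connected_Ioi] by auto
qed

lemma upper_part_eq_iff:
  assumes C: "C \<in> F" and D: "D \<in> F" and "\<alpha> < \<infinity>"
  shows "upper_part C \<alpha> = upper_part D \<alpha> \<longleftrightarrow> \<alpha> < coin C D"
proof
  assume eq: "upper_part C \<alpha> = upper_part D \<alpha>"
  have "point C \<infinity> \<in> upper_part C \<alpha>"
    using assms(3) by (subst point_in_upper_part[OF C C]) simp
  then have "point C \<infinity> \<in> upper_part D \<alpha>" by (simp only: eq)
  then show "\<alpha> < coin C D" unfolding point_in_upper_part[OF D C] by (simp add: coin_commute)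
next
  assume *: "\<alpha> < coin C D"
  then have "{E \<in> F. \<alpha> < coin C E} = {E \<in> F. \<alpha> < coin D E}"
    using coin_ultra_less[OF C D, of _ \<alpha>] coin_ultra_less[OF D C, of _ \<alpha>] coin_commute[of C D] by auto
  then show "upper_part C \<alpha> = upper_part D \<alpha>" by (simp add: upper_part_def)
qed

lemma components_complement_point:
  assumes A: "A \<in> F" and \<alpha>: "0 < \<alpha>" "\<alpha> < \<infinity>"
  shows "connected_components_of (subtopology (EW_space \<phi> F) (topspace (EW_space \<phi> F) - {point A \<alpha>})) =
    insert (lower_part A \<alpha>) ((\<lambda>C. upper_part C \<alpha>) ` cluster A \<alpha>)" (is "connected_components_of (subtopology ?T ?S) = ?\<U>")
proof (rule connected_components_of_partition)
  have cF: "C \<in> F" if "C \<in> cluster A \<alpha>" for C using that by (simp add: cluster_def)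
  have conn: "connectedin ?T U" and op: "openin ?T U" if "U \<in> ?\<U>" for U
    using that connectedin_lower_part[OF \<alpha>(1)] connectedin_upper_part[OF _ \<alpha>(2)]
      openin_lower_part[OF A] openin_upper_part cF by auto
  have sub: "U \<subseteq> ?S" if U: "U \<in> ?\<U>" for U
  proof -
    have "point A \<alpha> \<notin> lower_part A \<alpha>"
      using point_in_lower_part[OF A A] self_in_cluster[OF A] by simp
    moreover have "point A \<alpha> \<notin> upper_part C \<alpha>" if "C \<in> cluster A \<alpha>" for C
      using point_in_upper_part[OF cF[OF that] A] by simp
    ultimately have "point A \<alpha> \<notin> U" using U by blast
    then show ?thesis using openin_subset[OF op[OF U]] by blast
  qed
  show "connectedin (subtopology ?T ?S) U" if "U \<in> ?\<U>" for U
    using conn[OF that] sub[OF that] by (simp add: connectedin_subtopology)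
  show "openin (subtopology ?T ?S) U" if "U \<in> ?\<U>" for U
    using op[OF that] sub[OF that] openin_open_subtopology[OF open_complement_point[OF A]] by simp
  have "point A 0 \<in> lower_part A \<alpha>" using point_in_lower_part[OF A A] \<alpha> by simp
  moreover have "point C \<infinity> \<in> upper_part C \<alpha>" if "C \<in> cluster A \<alpha>" for C
    using point_in_upper_part[OF cF cF, OF that that] \<alpha> by simp
  ultimately show "U \<noteq> {}" if "U \<in> ?\<U>" for U using that by blast
  have lu: False if C: "C \<in> cluster A \<alpha>" and x: "x \<in> lower_part A \<alpha>" "x \<in> upper_part C \<alpha>" for C x
  proof -
    obtain E \<gamma> where E: "E \<in> F" "x = point E \<gamma>" using x(1) by (auto simp: lower_part_def)
    have 1: "E \<in> cluster A \<alpha> \<longrightarrow> \<gamma> < \<alpha>" using x(1) point_in_lower_part[OF A E(1)] E(2) by simp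
    have 2: "\<alpha> < coin C E" "\<alpha> < \<gamma>" using x(2) point_in_upper_part[OF cF[OF C] E(1)] E(2) by simp_all
    have "\<alpha> \<le> coin A E"
      using coin_ultra[OF A cF[OF C] E(1), of \<alpha>] C 2(1) by (simp add: cluster_def)
    then show False using 1 2 E(1) by (simp add: cluster_def)
  qed
  have uu: "upper_part C \<alpha> = upper_part D \<alpha>"
    if C: "C \<in> cluster A \<alpha>" and D: "D \<in> cluster A \<alpha>" and x: "x \<in> upper_part C \<alpha>" "x \<in> upper_part D \<alpha>" for C D x
  proof -
    obtain E \<gamma> where E: "E \<in> F" "x = point E \<gamma>" using x(1) by (auto simp: upper_part_def)
    have "\<alpha> < coin C E" "\<alpha> < coin D E"
      using x point_in_upper_part[OF cF[OF C] E(1)] point_in_upper_part[OF cF[OF D] E(1)] E(2) by simp_all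
    then have "\<alpha> < coin C D"
      using coin_ultra_less[OF cF[OF C] E(1) cF[OF D]] by (simp add: coin_commute[of E])
    then show ?thesis using upper_part_eq_iff[OF cF cF, OF C D \<alpha>(2)] by simp
  qed
  show "U = V" if "U \<in> ?\<U>" "V \<in> ?\<U>" "U \<inter> V \<noteq> {}" for U V
    using that lu uu by blast
  show "\<Union>?\<U> = topspace (subtopology ?T ?S)"
  proof
    show "\<Union>?\<U> \<subseteq> topspace (subtopology ?T ?S)" using sub by auto
    show "topspace (subtopology ?T ?S) \<subseteq> \<Union>?\<U>"
    proof
      fix x assume "x \<in> topspace (subtopology ?T ?S)"
      then have "x \<in> topspace ?T" "x \<noteq> point A \<alpha>" by auto
      then obtain E \<gamma> where E: "E \<in> F" "x = point E \<gamma>" by (auto simp: topspace_EW_space)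
      show "x \<in> \<Union>?\<U>"
      proof (cases "E \<in> cluster A \<alpha> \<and> \<alpha> \<le> \<gamma>")
        case True
        then have "\<alpha> \<noteq> \<gamma>"
          using \<open>x \<noteq> point A \<alpha>\<close> E point_eq_iff[OF E(1) A, of \<gamma> \<alpha>] by (auto simp: cluster_def coin_commute)
        then have "\<alpha> < \<gamma>" using True by (simp add: less_le)
        then have "x \<in> upper_part E \<alpha>"
          using True E point_in_upper_part[OF E(1) E(1)] \<alpha>(2) by simp
        then show ?thesis using True by blast
      next
        case False
        then have "x \<in> lower_part A \<alpha>" using E point_in_lower_part[OF A E(1)] by auto
        then show ?thesis by blast
      qed
    qed
  qed
qed

text \<open>The valency is one for the lower part plus the number of distinct upper parts, so it
  reaches 3 when two members of the cluster separate at \<alpha>. As the top exponent is never below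
  \<alpha>, it must then equal \<alpha>.\<close>

lemma valency_point:
  assumes A: "A \<in> F" and \<alpha>: "0 < \<alpha>" "\<alpha> < \<infinity>"
  shows "3 \<le> valency (EW_space \<phi> F) (point A \<alpha>) \<longleftrightarrow> top_exponent (cluster A \<alpha>) = \<alpha>"
proof -
  let ?B = "cluster A \<alpha>"
  have cF: "C \<in> F" if "C \<in> ?B" for C using that by (simp add: cluster_def)
  have fin: "finite ?B" and ne: "?B \<noteq> {}"
    using finite_F self_in_cluster[OF A] by (auto simp: cluster_def)
  have "lower_part A \<alpha> \<notin> (\<lambda>C. upper_part C \<alpha>) ` ?B"
  proof
    assume "lower_part A \<alpha> \<in> (\<lambda>C. upper_part C \<alpha>) ` ?B"
    then obtain C where C: "C \<in> ?B" "lower_part A \<alpha> = upper_part C \<alpha>" by blast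
    have "point A 0 \<in> lower_part A \<alpha>" using point_in_lower_part[OF A A] \<alpha> by simp
    then show False using C(2) point_in_upper_part[OF cF[OF C(1)] A, of 0 \<alpha>] by simp
  qed
  then have "valency (EW_space \<phi> F) (point A \<alpha>) = Suc (card ((\<lambda>C. upper_part C \<alpha>) ` ?B))"
    unfolding valency_def components_complement_point[OF assms] using fin by simp
  then have "3 \<le> valency (EW_space \<phi> F) (point A \<alpha>) \<longleftrightarrow> \<not> card ((\<lambda>C. upper_part C \<alpha>) ` ?B) \<le> Suc 0"
    by linarith
  also have "\<dots> \<longleftrightarrow> \<not> (\<forall>C\<in>?B. \<forall>D\<in>?B. upper_part C \<alpha> = upper_part D \<alpha>)"
    using fin by (simp add: card_le_Suc0_iff_eq)
  also have "\<dots> \<longleftrightarrow> (\<exists>C\<in>?B. \<exists>D\<in>?B. coin C D \<le> \<alpha>)"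
    using upper_part_eq_iff[OF cF cF \<alpha>(2)] by (meson not_le)
  also have "\<dots> \<longleftrightarrow> top_exponent ?B = \<alpha>"
  proof
    assume "\<exists>C\<in>?B. \<exists>D\<in>?B. coin C D \<le> \<alpha>"
    then obtain C D where "C \<in> ?B" "D \<in> ?B" "coin C D \<le> \<alpha>" by blast
    then have "top_exponent ?B \<le> \<alpha>" using top_exponent_le order.trans by blast
    then show "top_exponent ?B = \<alpha>" using top_exponent_cluster[OF A, of \<alpha>] by (rule antisym)
  next
    assume *: "top_exponent ?B = \<alpha>"
    obtain C D where "C \<in> ?B" "D \<in> ?B" "coin C D = top_exponent ?B"
      by (rule top_exponent_attained[OF fin ne])
    then show "\<exists>C\<in>?B. \<exists>D\<in>?B. coin C D \<le> \<alpha>" using * by (metis order.refl)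
  qed
  finally show ?thesis .
qed

text \<open>A cluster with top exponent \<infinity> is a singleton and gives a leaf; any other one
  gives a ramification point.\<close>

lemma EW_vertices_eq: "EW_vertices \<phi> F = insert (F \<times> {0}) (vertex ` clusters)"
proof
  show "EW_vertices \<phi> F \<subseteq> insert (F \<times> {0}) (vertex ` clusters)"
  proof
    fix P assume P: "P \<in> EW_vertices \<phi> F"
    then consider "P = EW_root \<phi> F" | "P \<in> EW_leaf \<phi> F ` F"
      | "P \<in> topspace (EW_space \<phi> F)" "3 \<le> valency (EW_space \<phi> F) P"
      by (auto simp: EW_vertices_def)
    then show "P \<in> insert (F \<times> {0}) (vertex ` clusters)"
    proof cases
      case 1
      then show ?thesis by (simp add: EW_root_eq)
    next
      case 2
      then obtain A where "A \<in> F" "P = EW_leaf \<phi> F A" by blast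
      then show ?thesis using EW_leaf_eq singleton_in_clusters by simp
    next
      case 3
      then obtain A \<alpha> where A: "A \<in> F" "P = point A \<alpha>" by (auto simp: topspace_EW_space)
      have B: "cluster A \<alpha> \<in> clusters" "A \<in> cluster A \<alpha>"
        using A by (auto simp: cluster_in_clusters self_in_cluster)
      show ?thesis
      proof (cases "\<alpha> = 0")
        case True
        then show ?thesis using A by (simp add: point_def cluster_0)
      next
        case False
        have "top_exponent (cluster A \<alpha>) = \<alpha>"
        proof (cases "\<alpha> < \<infinity>")
          case True
          then show ?thesis using 3(2) valency_point[OF A(1) _ True] False A(2) by (simp add: zero_less_iff_neq_zero)
        next
          case False
          \<comment> \<open>At a leaf the bound of the top exponent from below by \<alpha> already
            gives equality.\<close>
          then have "\<alpha> = top" by (simp flip: less_top)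
          then show ?thesis using top_exponent_cluster[OF A(1), of \<alpha>] by (simp add: top_unique)
        qed
        then have "P = vertex (cluster A \<alpha>)" using vertex_eq_point[OF B] A(2) by simp
        then show ?thesis using B(1) by blast
      qed
    qed
  qed
  have "vertex B \<in> EW_vertices \<phi> F" if B: "B \<in> clusters" for B
  proof -
    obtain A where A: "A \<in> B" using clusters_nonempty[OF B] by blast
    then have AF: "A \<in> F" using clusters_subset[OF B] by blast
    show ?thesis
    proof (cases "top_exponent B = \<infinity>")
      case True
      then have "B = {A}" using top_exponent_eq_top[OF B _ A] by simp
      then have "vertex B = EW_leaf \<phi> F A" using EW_leaf_eq[OF AF] by simp
      then show ?thesis using AF by (simp add: EW_vertices_def)
    next
      case False
      then have "top_exponent B < \<infinity>" by (simp add: less_top)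
      moreover have "top_exponent (cluster A (top_exponent B)) = top_exponent B"
        by (simp only: cluster_top_exponent[OF B A])
      ultimately have "3 \<le> valency (EW_space \<phi> F) (vertex B)"
        unfolding vertex_eq_point[OF B A] using valency_point[OF AF top_exponent_pos[OF B]] by simp
      moreover have "vertex B \<in> topspace (EW_space \<phi> F)"
        unfolding vertex_eq_point[OF B A] topspace_EW_space using AF by blast
      ultimately show ?thesis by (simp add: EW_vertices_def)
    qed
  qed
  then show "insert (F \<times> {0}) (vertex ` clusters) \<subseteq> EW_vertices \<phi> F"
    by (auto simp: EW_vertices_def EW_root_eq)
qed

section \<open>Edges of the tree and covers among clusters\<close>

definition edge_points :: "'r set set \<Rightarrow> ('r set \<times> ennreal) set set" where
  "edge_points B = {B \<times> {\<gamma>} | \<gamma>. bottom_exponent B < \<gamma> \<and> \<gamma> < top_exponent B}"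

lemma edge_points_eq:
  assumes B: "B \<in> clusters" and A: "A \<in> B"
  shows "edge_points B = point A ` {bottom_exponent B<..<top_exponent B}"
proof -
  have "point A \<gamma> = B \<times> {\<gamma>}" if "bottom_exponent B < \<gamma>" "\<gamma> < top_exponent B" for \<gamma>
    using cluster_between[OF B A that(1)] that(2) by (simp add: point_def)
  then show ?thesis by (auto simp: edge_points_def)
qed

lemma point_in_edge_points:
  assumes B: "B \<in> clusters" and D: "D \<in> F"
  shows "point D \<gamma> \<in> edge_points B \<longleftrightarrow> D \<in> B \<and> bottom_exponent B < \<gamma> \<and> \<gamma> < top_exponent B"
proof
  assume "point D \<gamma> \<in> edge_points B"
  then obtain \<gamma>' where \<gamma>': "point D \<gamma> = B \<times> {\<gamma>'}" "bottom_exponent B < \<gamma>'" "\<gamma>' < top_exponent B"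
    by (auto simp: edge_points_def)
  have "(D, \<gamma>) \<in> point D \<gamma>" using self_in_cluster[OF D] by (simp add: point_def)
  then have "(D, \<gamma>) \<in> B \<times> {\<gamma>'}" unfolding \<gamma>'(1) .
  then show "D \<in> B \<and> bottom_exponent B < \<gamma> \<and> \<gamma> < top_exponent B" using \<gamma>' by auto
next
  assume "D \<in> B \<and> bottom_exponent B < \<gamma> \<and> \<gamma> < top_exponent B"
  then show "point D \<gamma> \<in> edge_points B" using edge_points_eq[OF B, of D] by auto
qed

text \<open>Quantifying over the members avoids a choice; by \<open>parent_eq\<close> each of them
  gives the same ball. For F the formula returns F itself, hence the case distinction in
  \<open>lower_end\<close>.\<close>

definition parent :: "'r set set \<Rightarrow> 'r set set" where
  "parent B = {D \<in> F. \<exists>A\<in>B. bottom_exponent B \<le> coin A D}"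

definition lower_end :: "'r set set \<Rightarrow> ('r set \<times> ennreal) set" where
  "lower_end B = (if B = F then F \<times> {0} else vertex (parent B))"

lemma parent_eq:
  assumes B: "B \<in> clusters" and A: "A \<in> B"
  shows "parent B = cluster A (bottom_exponent B)"
proof -
  have "bottom_exponent B \<le> coin A D" if "A' \<in> B" "D \<in> F" "bottom_exponent B \<le> coin A' D" for A' D
  proof -
    have "bottom_exponent B \<le> coin A A'"
      using bottom_less_top[OF B] top_exponent_le[OF A that(1)] by simp
    then show ?thesis using coin_ultra[of A A' D] that A clusters_subset[OF B] by blast
  qed
  then show ?thesis using A by (auto simp: parent_def cluster_def)
qed

lemma parent_in_clusters: "B \<in> clusters \<Longrightarrow> parent B \<in> clusters"
  using clusters_nonempty clusters_subset parent_eq cluster_in_clusters by (metis all_not_in_conv subsetD)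

text \<open>For B \<noteq> F, a member A and a closest outsider D both belong to the parent and
  separate at the bottom exponent of B, which is therefore the top exponent of the parent.\<close>

lemma lower_end_eq:
  assumes B: "B \<in> clusters" and A: "A \<in> B"
  shows "lower_end B = point A (bottom_exponent B)"
proof (cases "B = F")
  case True
  then show ?thesis by (simp add: lower_end_def bottom_exponent_F point_def cluster_0)
next
  case False
  have AF: "A \<in> F" using A clusters_subset[OF B] by blast
  obtain D where D: "D \<in> F" "D \<notin> B" "coin A D = bottom_exponent B"
    by (rule bottom_exponent_attained[OF B False A])
  have "A \<in> parent B" "D \<in> parent B"
    using AF D by (simp_all add: parent_eq[OF B A] cluster_def)
  then have "top_exponent (parent B) \<le> bottom_exponent B"
    using top_exponent_le[of A "parent B" D] D(3) by simp
  moreover have "bottom_exponent B \<le> top_exponent (parent B)"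
    unfolding parent_eq[OF B A] by (rule top_exponent_cluster[OF AF])
  ultimately have "top_exponent (parent B) = bottom_exponent B" by simp
  then show ?thesis
    using False vertex_eq_point[OF parent_in_clusters[OF B] \<open>A \<in> parent B\<close>] by (simp add: lower_end_def)
qed

lemma closedin_edge:
  assumes B: "B \<in> clusters" and A: "A \<in> B"
  shows "closedin (EW_space \<phi> F) (point A ` {bottom_exponent B..top_exponent B})"
proof (rule closedin_EW_space)
  have AF: "A \<in> F" using A clusters_subset[OF B] by blast
  then show "point A ` {bottom_exponent B..top_exponent B} \<subseteq> {point A \<alpha> |A \<alpha>. A \<in> F}" by blast
  fix D assume D: "D \<in> F"
  \<comment> \<open>The segment of D runs along that of A only up to their order of coincidence, a
    closed condition.\<close>
  have eq: "{\<gamma>. point D \<gamma> \<in> point A ` {bottom_exponent B..top_exponent B}} =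
      {bottom_exponent B..top_exponent B} \<inter> {..coin D A}"
    using point_eq_iff[OF D AF] by auto
  show "closed {\<gamma>. point D \<gamma> \<in> point A ` {bottom_exponent B..top_exponent B}}"
    unfolding eq by (intro closed_Int closed_atLeastAtMost closed_atMost)
qed

lemma edge_points_disjoint_vertices:
  assumes B: "B \<in> clusters"
  shows "edge_points B \<inter> EW_vertices \<phi> F = {}"
proof -
  have "B \<times> {\<gamma>} \<noteq> F \<times> {0}" if "bottom_exponent B < \<gamma>" for \<gamma>
  proof
    assume "B \<times> {\<gamma>} = F \<times> {0}"
    then have "\<gamma> = 0" by (rule times_singleton_eqD(2)[OF clusters_nonempty[OF B]])
    then show False using that by simp
  qed
  moreover have "B \<times> {\<gamma>} \<noteq> vertex B'" if "\<gamma> < top_exponent B" "B' \<in> clusters" for \<gamma> B'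
  proof
    assume eq: "B \<times> {\<gamma>} = vertex B'"
    then have "B = B'" "\<gamma> = top_exponent B'"
      unfolding vertex_def by (fact times_singleton_eqD[OF clusters_nonempty[OF B]])+
    then show False using that(1) by simp
  qed
  ultimately have "P \<notin> EW_vertices \<phi> F" if "P \<in> edge_points B" for P
    using that unfolding EW_vertices_eq edge_points_def by fastforce
  then show ?thesis by blast
qed

text \<open>The closure of the open edge is the closed segment between its end exponents, and no
  vertex lies strictly inside it.\<close>

lemma vertices_closure_edge:
  assumes B: "B \<in> clusters" and P: "P \<in> EW_vertices \<phi> F"
  shows "P \<in> EW_space \<phi> F closure_of edge_points B \<longleftrightarrow> P = vertex B \<or> P = lower_end B"
proof -
  obtain A where A: "A \<in> B" using clusters_nonempty[OF B] by blast
  then have AF: "A \<in> F" using clusters_subset[OF B] by blast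
  let ?I = "{bottom_exponent B<..<top_exponent B}" and ?K = "{bottom_exponent B..top_exponent B}"
  have "point A ` ?K = point A ` (euclidean closure_of ?I)"
    using bottom_less_top[OF B] by simp
  also have "\<dots> \<subseteq> EW_space \<phi> F closure_of (point A ` ?I)"
    by (rule continuous_map_image_closure_subset[OF continuous_point[OF AF]])
  finally have 1: "point A ` ?K \<subseteq> EW_space \<phi> F closure_of edge_points B"
    unfolding edge_points_eq[OF B A] .
  have 2: "EW_space \<phi> F closure_of edge_points B \<subseteq> point A ` ?K"
    unfolding edge_points_eq[OF B A]
    by (intro closure_of_minimal[OF _ closedin_edge[OF B A]] image_mono) auto
  have "P \<in> point A ` ?K \<longleftrightarrow> P = point A (top_exponent B) \<or> P = point A (bottom_exponent B)"
  proof
    assume "P \<in> point A ` ?K"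
    then obtain \<gamma> where \<gamma>: "P = point A \<gamma>" "bottom_exponent B \<le> \<gamma>" "\<gamma> \<le> top_exponent B" by auto
    have "\<not> (bottom_exponent B < \<gamma> \<and> \<gamma> < top_exponent B)"
      using edge_points_disjoint_vertices[OF B] P \<gamma>(1) point_in_edge_points[OF B AF] A by blast
    then show "P = point A (top_exponent B) \<or> P = point A (bottom_exponent B)"
      using \<gamma> by (metis order.not_eq_order_implies_strict)
  next
    assume "P = point A (top_exponent B) \<or> P = point A (bottom_exponent B)"
    then show "P \<in> point A ` ?K" using bottom_less_top[OF B] by auto
  qed
  then show ?thesis
    using 1 2 unfolding vertex_eq_point[OF B A] lower_end_eq[OF B A] by blast
qed

lemma components_complement_vertices:
  "connected_components_of (subtopology (EW_space \<phi> F) (topspace (EW_space \<phi> F) - EW_vertices \<phi> F)) =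
    edge_points ` clusters" (is "connected_components_of (subtopology ?T ?S) = _")
proof (rule connected_components_of_partition)
  have op: "openin ?T (edge_points B)" if B: "B \<in> clusters" for B
  proof -
    have "open {\<gamma>. point D \<gamma> \<in> edge_points B}" if D: "D \<in> F" for D
      unfolding point_in_edge_points[OF B D]
      by (cases "D \<in> B") (simp_all add: open_Collect_conj open_Collect_less)
    moreover obtain A where "A \<in> B" using clusters_nonempty[OF B] by blast
    moreover have "A \<in> F" using \<open>A \<in> B\<close> clusters_subset[OF B] by blast
    ultimately show ?thesis unfolding openin_EW_space by (auto simp: edge_points_eq[OF B])
  qed
  have sub: "edge_points B \<subseteq> ?S" if "B \<in> clusters" for B
    using openin_subset[OF op[OF that]] edge_points_disjoint_vertices[OF that] by blast
  fix U assume "U \<in> edge_points ` clusters"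
  then obtain B where B: "B \<in> clusters" "U = edge_points B" by blast
  obtain A where A: "A \<in> B" using clusters_nonempty[OF B(1)] by blast
  then have AF: "A \<in> F" using clusters_subset[OF B(1)] by blast
  show "connectedin (subtopology ?T ?S) U"
    using connectedin_point[OF AF connected_Ioo] sub[OF B(1)] B(2)
    by (simp add: connectedin_subtopology edge_points_eq[OF B(1) A])
  show "openin (subtopology ?T ?S) U"
    unfolding openin_subtopology B(2) using op[OF B(1)] sub[OF B(1)] by blast
  show "U \<noteq> {}"
    using bottom_less_top[OF B(1)] by (simp add: B(2) edge_points_eq[OF B(1) A])
  fix V assume "V \<in> edge_points ` clusters" and UV: "U \<inter> V \<noteq> {}"
  then obtain B' where B': "B' \<in> clusters" "V = edge_points B'" by blast
  obtain \<gamma> \<gamma>' where "B \<times> {\<gamma>} = B' \<times> {\<gamma>'}" using UV by (auto simp: B B' edge_points_def)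
  then have "B = B'" by (rule times_singleton_eqD(1)[OF clusters_nonempty[OF B(1)]])
  then show "U = V" using B B' by simp
next
  show "\<Union>(edge_points ` clusters) = topspace (subtopology ?T ?S)"
  proof
    show "\<Union>(edge_points ` clusters) \<subseteq> topspace (subtopology ?T ?S)"
    proof
      fix P assume "P \<in> \<Union>(edge_points ` clusters)"
      then obtain B where B: "B \<in> clusters" "P \<in> edge_points B" by blast
      obtain A where A: "A \<in> B" using clusters_nonempty[OF B(1)] by blast
      then have "A \<in> F" using clusters_subset[OF B(1)] by blast
      then have "P \<in> topspace ?T" using B(2) by (auto simp: edge_points_eq[OF B(1) A] topspace_EW_space)
      then show "P \<in> topspace (subtopology ?T ?S)"
        using edge_points_disjoint_vertices[OF B(1)] B(2) by auto
    qed
    show "topspace (subtopology ?T ?S) \<subseteq> \<Union>(edge_points ` clusters)"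
    proof
      fix P assume "P \<in> topspace (subtopology ?T ?S)"
      then have P: "P \<in> topspace ?T" "P \<notin> EW_vertices \<phi> F" by auto
      then obtain A \<gamma> where A: "A \<in> F" "P = point A \<gamma>" by (auto simp: topspace_EW_space)
      \<comment> \<open>P lies on the edge below its own cluster: its exponent exceeds the bottom
        exponent since P is not the root, and stays below the top exponent since P is not a
        vertex.\<close>
      let ?B = "cluster A \<gamma>"
      have B: "?B \<in> clusters" "A \<in> ?B" using A(1) by (auto simp: cluster_in_clusters self_in_cluster)
      have "\<gamma> \<noteq> 0" using P(2) A(2) by (auto simp: EW_vertices_eq point_def cluster_0)
      then have "bottom_exponent ?B < \<gamma>"
        by (intro bottom_exponent_cluster A(1)) (simp add: zero_less_iff_neq_zero)
      moreover have "\<gamma> \<noteq> top_exponent ?B"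
      proof
        assume "\<gamma> = top_exponent ?B"
        then have "P = vertex ?B" using vertex_eq_point[OF B] A(2) by simp
        then show False using P(2) B(1) by (simp add: EW_vertices_eq)
      qed
      then have "\<gamma> < top_exponent ?B" using top_exponent_cluster[OF A(1), of \<gamma>] by simp
      ultimately have "P \<in> edge_points ?B" using point_in_edge_points[OF B(1) A(1)] A(2) B(2) by simp
      then show "P \<in> \<Union>(edge_points ` clusters)" using B(1) by blast
    qed
  qed
qed

lemma topological_edges_eq:
  "topological_edges (EW_space \<phi> F) (EW_vertices \<phi> F) = {{vertex B, lower_end B} | B. B \<in> clusters}"
proof
  show "topological_edges (EW_space \<phi> F) (EW_vertices \<phi> F) \<subseteq> {{vertex B, lower_end B} | B. B \<in> clusters}"
  proof
    fix e assume "e \<in> topological_edges (EW_space \<phi> F) (EW_vertices \<phi> F)"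
    then obtain P Q B where e: "e = {P, Q}" "P \<in> EW_vertices \<phi> F" "Q \<in> EW_vertices \<phi> F" "P \<noteq> Q"
      and B: "B \<in> clusters" "P \<in> EW_space \<phi> F closure_of edge_points B" "Q \<in> EW_space \<phi> F closure_of edge_points B"
      unfolding topological_edges_def components_complement_vertices by blast
    then have "P = vertex B \<or> P = lower_end B" "Q = vertex B \<or> Q = lower_end B"
      using vertices_closure_edge[OF B(1)] by blast+
    then have "e = {vertex B, lower_end B}" using e by blast
    then show "e \<in> {{vertex B, lower_end B} | B. B \<in> clusters}" using B(1) by blast
  qed
  show "{{vertex B, lower_end B} | B. B \<in> clusters} \<subseteq> topological_edges (EW_space \<phi> F) (EW_vertices \<phi> F)"
  proof
    fix e assume "e \<in> {{vertex B, lower_end B} | B. B \<in> clusters}"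
    then obtain B where B: "B \<in> clusters" "e = {vertex B, lower_end B}" by blast
    obtain A where A: "A \<in> B" using clusters_nonempty[OF B(1)] by blast
    then have AF: "A \<in> F" using clusters_subset[OF B(1)] by blast
    have V: "vertex B \<in> EW_vertices \<phi> F" "lower_end B \<in> EW_vertices \<phi> F"
      using B(1) parent_in_clusters[OF B(1)] by (auto simp: EW_vertices_eq lower_end_def)
    have "vertex B \<noteq> lower_end B"
      unfolding vertex_eq_point[OF B(1) A] lower_end_eq[OF B(1) A] point_eq_iff[OF AF AF]
      using bottom_less_top[OF B(1)] by simp
    then show "e \<in> topological_edges (EW_space \<phi> F) (EW_vertices \<phi> F)"
      unfolding topological_edges_def components_complement_vertices
      using B V vertices_closure_edge[OF B(1)] by blast
  qed
qed

text \<open>The parent is the least cluster properly containing B: any such cluster contains an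
  outsider, so its top exponent is at most the bottom exponent of B, and as a ball around A it
  contains the parent.\<close>

lemma covers_iff:
  assumes B: "B \<in> clusters"
  shows "covers clusters P B \<longleftrightarrow> B \<noteq> F \<and> P = parent B"
proof -
  obtain A where A: "A \<in> B" using clusters_nonempty[OF B] by blast
  have AF: "A \<in> F" using A clusters_subset[OF B] by blast
  have sup: "B \<subset> parent B" if BF: "B \<noteq> F"
  proof -
    obtain D where D: "D \<in> F" "D \<notin> B" "coin A D = bottom_exponent B"
      by (rule bottom_exponent_attained[OF B BF A])
    have "D \<in> parent B" using D by (simp add: parent_eq[OF B A] cluster_def)
    moreover have "B \<subseteq> parent B"
    proof
      fix C assume C: "C \<in> B"
      then have "bottom_exponent B \<le> coin A C"
        using bottom_less_top[OF B] top_exponent_le[OF A C] by simp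
      then show "C \<in> parent B" using C clusters_subset[OF B] by (auto simp: parent_eq[OF B A] cluster_def)
    qed
    ultimately show ?thesis using D(2) by blast
  qed
  have least: "parent B \<subseteq> Q" if Q: "Q \<in> clusters" "B \<subset> Q" for Q
  proof -
    obtain D where D: "D \<in> Q" "D \<notin> B" using Q(2) by blast
    have AQ: "A \<in> Q" using A Q(2) by blast
    have "D \<in> F" using D(1) clusters_subset[OF Q(1)] by blast
    then have "top_exponent Q \<le> bottom_exponent B"
      using top_exponent_le[OF AQ D(1)] coin_le_bottom_exponent[OF A _ D(2)] order.trans by blast
    then have "cluster A (bottom_exponent B) \<subseteq> cluster A (top_exponent Q)"
      by (auto simp: cluster_def)
    then show ?thesis unfolding parent_eq[OF B A] cluster_top_exponent[OF Q(1) AQ] .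
  qed
  show ?thesis
  proof
    assume c: "covers clusters P B"
    then have P: "P \<in> clusters" "B \<subset> P" "\<not> (\<exists>D\<in>clusters. B \<subset> D \<and> D \<subset> P)" by (auto simp: covers_def)
    have "B \<noteq> F" using P clusters_subset by blast
    then show "B \<noteq> F \<and> P = parent B"
      using sup least[OF P(1,2)] P(3) parent_in_clusters[OF B] by blast
  next
    assume "B \<noteq> F \<and> P = parent B"
    then show "covers clusters P B"
      unfolding covers_def using B parent_in_clusters[OF B] sup least by blast
  qed
qed

lemma end_rooted_tree_iso:
  assumes balls: "closed_balls F U = clusters"
  shows "rooted_tree_iso F (end_rooted_tree F U) (eggers_wall_tree \<phi> F)"
proof -
  define h where "h x = (case x of None \<Rightarrow> F \<times> {0} | Some B \<Rightarrow> vertex B)" for x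
  have h: "h None = F \<times> {0}" "h (Some B) = vertex B" for B by (simp_all add: h_def)
  let ?V = "insert None (Some ` clusters)"
  have inj: "inj_on h ?V"
  proof (rule inj_onI)
    have 1: "vertex B \<noteq> F \<times> {0}" if "B \<in> clusters" for B
    proof
      assume "vertex B = F \<times> {0}"
      then have "top_exponent B = 0"
        unfolding vertex_def by (rule times_singleton_eqD(2)[OF clusters_nonempty[OF that]])
      then show False using top_exponent_pos[OF that] by simp
    qed
    have 2: "B = C" if "B \<in> clusters" "C \<in> clusters" "vertex B = vertex C" for B C
      using that(3) unfolding vertex_def by (rule times_singleton_eqD(1)[OF clusters_nonempty[OF that(1)]])
    fix x y assume x: "x \<in> ?V" and y: "y \<in> ?V" and eq: "h x = h y"
    show "x = y"
    proof (cases "x = None \<or> y = None")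
      case True
      then show ?thesis using x y eq 1 by (auto simp: h dest!: sym[of "F \<times> {0}"])
    next
      case False
      then obtain B C where "x = Some B" "y = Some C" "B \<in> clusters" "C \<in> clusters" using x y by auto
      then show ?thesis using 2[of B C] eq by (simp add: h)
    qed
  qed
  \<comment> \<open>The neighbour of B towards the root, among balls. Since \<open>h\<close> carries
    it to \<open>lower_end B\<close>, both edge sets are indexed by the clusters in the same
    way.\<close>
  define low where "low B = (if B = F then None else Some (parent B))" for B
  have hlow: "h (low B) = lower_end B" for B by (simp add: low_def lower_end_def h)
  have lowV: "low B \<in> ?V" if "B \<in> clusters" for B
    using parent_in_clusters[OF that] by (simp add: low_def)
  have edges: "insert {None, Some F} {{Some P, Some B} | P B. covers clusters P B} =
      {{Some B, low B} | B. B \<in> clusters}"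
  proof -
    have "{{Some P, Some B} | P B. covers clusters P B} = {{Some B, low B} | B. B \<in> clusters \<and> B \<noteq> F}"
    proof (intro set_eqI iffI)
      fix e assume "e \<in> {{Some P, Some B} | P B. covers clusters P B}"
      then obtain P B where e: "e = {Some P, Some B}" "covers clusters P B" by blast
      then have B: "B \<in> clusters" by (simp add: covers_def)
      then have "e = {Some B, low B}" "B \<noteq> F" using e covers_iff[OF B] by (auto simp: low_def)
      then show "e \<in> {{Some B, low B} | B. B \<in> clusters \<and> B \<noteq> F}" using B by blast
    next
      fix e assume "e \<in> {{Some B, low B} | B. B \<in> clusters \<and> B \<noteq> F}"
      then obtain B where B: "B \<in> clusters" "B \<noteq> F" "e = {Some B, low B}" by blast
      then have "e = {Some (parent B), Some B}" "covers clusters (parent B) B"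
        using covers_iff[OF B(1)] by (auto simp: low_def)
      then show "e \<in> {{Some P, Some B} | P B. covers clusters P B}" by blast
    qed
    moreover have "{None, Some F} = {Some F, low F}" by (auto simp: low_def)
    moreover have "{{Some B, low B} | B. B \<in> clusters} =
        insert {Some F, low F} {{Some B, low B} | B. B \<in> clusters \<and> B \<noteq> F}"
    proof -
      let ?f = "\<lambda>B. {Some B, low B}"
      have "clusters = insert F {B \<in> clusters. B \<noteq> F}" using F_in_clusters by blast
      then have "?f ` clusters = ?f ` insert F {B \<in> clusters. B \<noteq> F}" by (rule arg_cong)
      also have "\<dots> = insert (?f F) (?f ` {B \<in> clusters. B \<noteq> F})" by (rule image_insert)
      finally show ?thesis by (simp only: setcompr_eq_image Collect_mem_eq)
    qed
    ultimately show ?thesis by (simp only:)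
  qed
  have iff: "{u, v} \<in> {{Some B, low B} | B. B \<in> clusters} \<longleftrightarrow>
      {h u, h v} \<in> {{vertex B, lower_end B} | B. B \<in> clusters}" if uv: "u \<in> ?V" "v \<in> ?V" for u v
  proof
    assume "{u, v} \<in> {{Some B, low B} | B. B \<in> clusters}"
    then obtain B where B: "B \<in> clusters" "{u, v} = {Some B, low B}" by blast
    have "h ` {u, v} = h ` {Some B, low B}" by (simp only: B(2))
    then have "{h u, h v} = {vertex B, lower_end B}" by (simp add: h hlow)
    then show "{h u, h v} \<in> {{vertex B, lower_end B} | B. B \<in> clusters}" using B(1) by blast
  next
    assume "{h u, h v} \<in> {{vertex B, lower_end B} | B. B \<in> clusters}"
    then obtain B where B: "B \<in> clusters" "{h u, h v} = {vertex B, lower_end B}" by blast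
    then have eq: "h ` {u, v} = h ` {Some B, low B}" by (simp add: h hlow)
    have "{u, v} \<subseteq> ?V" "{Some B, low B} \<subseteq> ?V"
      using uv B(1) lowV[OF B(1)] by (simp_all only: insert_subset empty_subsetI) simp_all
    from inj_on_image_eq_iff[OF inj this] eq have "{u, v} = {Some B, low B}" by (rule iffD1)
    then show "{u, v} \<in> {{Some B, low B} | B. B \<in> clusters}" using B(1) by blast
  qed
  have im: "h ` ?V = EW_vertices \<phi> F"
    unfolding EW_vertices_eq by (simp add: h image_image)
  show ?thesis
    unfolding rooted_tree_iso_def
  proof (intro exI[of _ h] conjI ballI)
    show "bij_betw h (tree_verts (end_rooted_tree F U)) (tree_verts (eggers_wall_tree \<phi> F))"
      using inj im by (simp add: end_rooted_tree_def eggers_wall_tree_def balls bij_betw_def)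
    show "h (tree_root (end_rooted_tree F U)) = tree_root (eggers_wall_tree \<phi> F)"
      by (simp add: end_rooted_tree_def eggers_wall_tree_def h EW_root_eq)
    show "h (tree_leaf (end_rooted_tree F U) a) = tree_leaf (eggers_wall_tree \<phi> F) a" if "a \<in> F" for a
      using that by (simp add: end_rooted_tree_def eggers_wall_tree_def h EW_leaf_eq)
    fix u v assume "u \<in> tree_verts (end_rooted_tree F U)" "v \<in> tree_verts (end_rooted_tree F U)"
    then have "u \<in> ?V" "v \<in> ?V" by (simp_all add: end_rooted_tree_def balls)
    from iff[OF this] show "({u, v} \<in> tree_edges (end_rooted_tree F U)) =
        ({h u, h v} \<in> tree_edges (eggers_wall_tree \<phi> F))"
      by (simp only: end_rooted_tree_def eggers_wall_tree_def balls edges topological_edges_eq rooted_tree.simps)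
  qed
qed

section \<open>Ultrametrics that decrease with the order of coincidence\<close>

context
  fixes U :: "'r set \<Rightarrow> 'r set \<Rightarrow> real"
  assumes U_nonneg: "\<And>A B. 0 \<le> U A B" and U_commute: "\<And>A B. U A B = U B A"
    and U_zero: "\<And>A B. A \<in> F \<Longrightarrow> B \<in> F \<Longrightarrow> U A B = 0 \<longleftrightarrow> A = B"
    and U_le_iff: "\<And>A B C. A \<in> F \<Longrightarrow> B \<in> F \<Longrightarrow> C \<in> F \<Longrightarrow> U A B \<le> U A C \<longleftrightarrow> coin A C \<le> coin A B"
begin

lemma ultrametric: "ultrametric_on F U"
proof -
  have ultra: "U A C \<le> max (U A B) (U B C)" if "A \<in> F" "B \<in> F" "C \<in> F" for A B C
  proof (cases "coin A B \<le> coin A C")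
    case True
    then show ?thesis using U_le_iff[OF that(1,3,2)] by (simp add: max.coboundedI1)
  next
    case False
    have "coin B C \<le> coin A C"
    proof (rule ccontr)
      assume "\<not> coin B C \<le> coin A C"
      then have "coin A C < coin A B" "coin A C < coin B C" using False by simp_all
      from coin_ultra_less[OF that this] show False by simp
    qed
    \<comment> \<open>\<open>U_le_iff\<close> compares only values with a common first argument, so
      by symmetry C is taken as the centre.\<close>
    then have "U C A \<le> U C B"
      using U_le_iff[of C A B] that by (simp add: coin_commute)
    then show ?thesis by (simp add: U_commute[of C] max.coboundedI2)
  qed
  have "Metric_space F U"
  proof
    fix A B C assume "A \<in> F" "B \<in> F" "C \<in> F"
    from ultra[OF this] show "U A C \<le> U A B + U B C"
      using U_nonneg[of A B] U_nonneg[of B C] by linarith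
  qed (simp_all add: U_nonneg U_zero U_commute)
  with ultra show ?thesis by (simp add: ultrametric_on_def)
qed

text \<open>Radii and thresholds cannot be compared directly. Both are replaced by the values of
  \<open>U\<close> and \<open>coin\<close> at a member farthest from the centre, and those are
  related by \<open>U_le_iff\<close>.\<close>

lemma closed_balls_eq_clusters: "closed_balls F U = clusters"
proof -
  have M: "Metric_space F U" using ultrametric by (simp add: ultrametric_on_def)
  have ball: "Metric_space.mcball F U A r = {B \<in> F. U A B \<le> r}" if "A \<in> F" for A r
    using that by (auto simp: Metric_space.mcball_def[OF M])
  have farthest: "\<exists>C\<in>S. \<forall>D\<in>S. U A D \<le> U A C" if "S \<subseteq> F" "S \<noteq> {}" for S A
  proof -
    have fin: "finite (U A ` S)" "U A ` S \<noteq> {}" using that finite_F finite_subset by auto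
    obtain C where C: "Max (U A ` S) = U A C" "C \<in> S" using Max_in[OF fin] by (rule imageE)
    have "U A D \<le> U A C" if "D \<in> S" for D
      unfolding C(1)[symmetric] using fin(1) that by (intro Max_ge) auto
    then show ?thesis using C(2) by blast
  qed
  show ?thesis
  proof (intro set_eqI iffI)
    fix S assume "S \<in> closed_balls F U"
    then obtain A r where A: "A \<in> F" "0 \<le> r" "S = {B \<in> F. U A B \<le> r}"
      using ball by (auto simp: closed_balls_def)
    have "A \<in> S" using A U_zero[OF A(1) A(1)] by simp
    then obtain C where C: "C \<in> S" "\<forall>D\<in>S. U A D \<le> U A C" using farthest[of S A] A(3) by blast
    have "S = cluster A (coin A C)"
    proof (intro set_eqI iffI)
      fix D assume D: "D \<in> S"
      then have "U A D \<le> U A C" using C(2) by blast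
      then show "D \<in> cluster A (coin A C)"
        using U_le_iff[OF A(1), of D C] D C(1) A(3) by (simp add: cluster_def)
    next
      fix D assume D: "D \<in> cluster A (coin A C)"
      then have "U A D \<le> U A C" using U_le_iff[OF A(1), of D C] C(1) A(3) by (simp add: cluster_def)
      then show "D \<in> S" using D C(1) A(3) by (simp add: cluster_def)
    qed
    then show "S \<in> clusters" using A(1) by (auto simp: clusters_def)
  next
    fix S assume "S \<in> clusters"
    then obtain A \<alpha> where A: "A \<in> F" "S = cluster A \<alpha>" by (auto simp: clusters_def)
    obtain C where C: "C \<in> S" "\<forall>D\<in>S. U A D \<le> U A C"
      using farthest[of S A] A self_in_cluster[OF A(1)] cluster_subset by blast
    have "S = {B \<in> F. U A B \<le> U A C}"
    proof (intro set_eqI iffI)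
      fix D assume "D \<in> S"
      then show "D \<in> {B \<in> F. U A B \<le> U A C}" using C(2) A(2) by (simp add: cluster_def)
    next
      fix D assume D: "D \<in> {B \<in> F. U A B \<le> U A C}"
      then have "coin A C \<le> coin A D" using U_le_iff[OF A(1), of D C] C(1) A(2) by (simp add: cluster_def)
      moreover have "\<alpha> \<le> coin A C" using C(1) A(2) by (simp add: cluster_def)
      ultimately show "D \<in> S" using D A(2) by (simp add: cluster_def)
    qed
    then show "S \<in> closed_balls F U"
      unfolding closed_balls_def using A(1) ball[OF A(1)] U_nonneg by blast
  qed
qed

end

end

lemma U_L_ultrametric_and_tree:
  fixes \<iota> :: "complex \<Rightarrow> 'r::comm_ring_1"
  assumes \<phi>: "adapted_coordinates \<iota> L \<phi>" and "finite F" "F \<noteq> {}"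
    and F: "\<forall>A\<in>F. branch A \<and> A \<noteq> L"
  shows "ultrametric_on F (U_L \<iota> L)"
    "rooted_tree_iso F (end_rooted_tree F (U_L \<iota> L)) (eggers_wall_tree \<phi> F)"
proof -
  interpret coincidence_tree \<phi> F
  proof
    show "coincidence_order \<phi> A B = coincidence_order \<phi> B A" for A B
      by (rule coincidence_order_commute[OF \<phi>])
    show "min (coincidence_order \<phi> A B) (coincidence_order \<phi> B C) \<le> coincidence_order \<phi> A C"
      if "A \<in> F" "B \<in> F" "C \<in> F" for A B C
      using that F by (intro coincidence_order_ultra[OF \<phi>]) auto
    show "coincidence_order \<phi> A B < \<infinity>" if "A \<in> F" "B \<in> F" "A \<noteq> B" for A B
      using that F by (intro coincidence_order_finite_pos[OF \<phi>]) auto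
    show "0 < coincidence_order \<phi> A B" if "A \<in> F" "B \<in> F" "A \<noteq> B" for A B
      using that F by (intro coincidence_order_finite_pos[OF \<phi>]) auto
  qed (fact assms)+
  have nonneg: "0 \<le> U_L \<iota> L A B" for A B by (simp add: U_L_def)
  have pos: "0 < U_L \<iota> L A B" if "A \<in> F" "B \<in> F" "A \<noteq> B" for A B
    using that F by (intro U_L_pos[OF \<phi>]) auto
  have zero: "U_L \<iota> L A B = 0 \<longleftrightarrow> A = B" if "A \<in> F" "B \<in> F" for A B
    using pos[OF that] by (cases "A = B") (simp_all add: U_L_def[of _ _ B B])
  \<comment> \<open>On the diagonal \<open>U_L\<close> is 0 and \<open>coin\<close> is \<infinity>,
    so the comparison extends to repeated branches.\<close>
  have le_iff: "U_L \<iota> L A B \<le> U_L \<iota> L A C \<longleftrightarrow> coin A C \<le> coin A B"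
    if "A \<in> F" "B \<in> F" "C \<in> F" for A B C
  proof -
    consider "A = B" | "A \<noteq> B" "A = C" | "A \<noteq> B" "A \<noteq> C" by blast
    then show ?thesis
    proof cases
      case 1
      then show ?thesis using zero[OF that(1,1)] nonneg by simp
    next
      case 2
      then show ?thesis
        using pos[OF that(1,2) 2(1)] zero[OF that(1,1)] coin_eq_top_iff[OF that(1,2)] by simp
    next
      case 3
      have "U_L \<iota> L A B \<le> U_L \<iota> L A C \<longleftrightarrow> coincidence_order \<phi> A C \<le> coincidence_order \<phi> A B"
        using that F 3 by (intro U_L_le_iff[OF \<phi>]) auto
      then show ?thesis using 3 by (simp add: coin_def)
    qed
  qed
  show "ultrametric_on F (U_L \<iota> L)"
    by (rule ultrametric) (simp_all add: nonneg zero le_iff U_L_commute)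
  have "closed_balls F (U_L \<iota> L) = clusters"
    by (rule closed_balls_eq_clusters) (simp_all add: nonneg zero le_iff U_L_commute)
  then show "rooted_tree_iso F (end_rooted_tree F (U_L \<iota> L)) (eggers_wall_tree \<phi> F)"
    by (rule end_rooted_tree_iso)
qed

theorem theorem111:
  fixes \<iota> :: "complex \<Rightarrow> 'r::comm_ring_1"
    and L :: "'r set"
    and F :: "'r set set"
  assumes "smooth_surface_germ \<iota>"
    and "smooth_branch L"
    and "finite F" and "F \<noteq> {}"
    and "\<forall>A\<in>F. branch A \<and> A \<noteq> L"
  shows "ultrametric_on F (U_L \<iota> L) \<and>
    (\<forall>\<phi>. adapted_coordinates \<iota> L \<phi> \<longrightarrow>
       rooted_tree_iso F (end_rooted_tree F (U_L \<iota> L)) (eggers_wall_tree \<phi> F))"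
proof
  \<comment> \<open>The ultrametric property does not involve coordinates, so any adapted ones will
    do for its proof.\<close>
  obtain \<phi> where "adapted_coordinates \<iota> L \<phi>"
    by (rule adapted_coordinates_exist[OF assms(1,2)])
  then show "ultrametric_on F (U_L \<iota> L)"
    by (rule U_L_ultrametric_and_tree(1)) (fact assms)+
  show "\<forall>\<phi>. adapted_coordinates \<iota> L \<phi> \<longrightarrow>
       rooted_tree_iso F (end_rooted_tree F (U_L \<iota> L)) (eggers_wall_tree \<phi> F)"
    using U_L_ultrametric_and_tree(2)[OF _ assms(3-5)] by blast
qed

end
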